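(* Let $\Bbbk$ be a field and let $H$ be a cocommutative Hopf algebra over $\Bbbk$. Then $H$ is amenable if and only if every nonzero left $H$-module coalgebra is amenable.
   Context: A left $H$-module coalgebra is a coalgebra $M$ endowed with a left $H$-module structure such that the action map $H\otimes M\to M$ is a (counital) coalgebra map, i.e. $\Delta(hm)=\sum h_{(1)}m_{(1)}\otimes h_{(2)}m_{(2)}$ and $\varepsilon(hm)=\varepsilon(h)\varepsilon(m)$. For subspaces $F\le H$ and $E\le M$, $FE$ denotes the linear span of $\{fe: f\in F, e\in E\}$. A left $H$-module coalgebra $M$ is called amenable if for every finite-dimensional subspace $F\le H$ and every $\epsilon>0$ there exists a finite-dimensional subcoalgebra $E\le M$ with $\dim\frac{E+FE}{E}<\epsilon\dim E$ (the strict inequality forces $E\ne0$). The Hopf algebra $H$ is called amenable if its left regular module ${}_HH$ (which is an $H$-module coalgebra) is amenable. *)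

theory Defs
  imports Complex_Main "HOL-Library.Poly_Mapping"
begin

text \<open>
  Vector spaces are those of the locale \<^locale>\<open>vector_space\<close>: the carrier is a whole type and the
  scalar multiplication is a parameter. Since the latter is not determined by the type, a tensor
  power cannot be a type of its own. It is presented here as the free vector space on pairs (or
  triples), i.e. the finitely supported functions \<open>'c \<times> 'c \<Rightarrow>\<^sub>0 'k\<close>, modulo the subspace spanned by
  the usual bilinearity (trilinearity) relations. A map into a tensor power is given by choosing a
  formal sum in the class of each value, and every equation in a tensor power is a congruence
  modulo the relations. Nothing below depends on the choice of representatives.
\<close>

definition fscale :: "'k::field \<Rightarrow> ('x \<Rightarrow>\<^sub>0 'k) \<Rightarrow> ('x \<Rightarrow>\<^sub>0 'k)" where
  "fscale c u = Poly_Mapping.map (\<lambda>a. c * a) u"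

lemma lookup_fscale [simp]: "Poly_Mapping.lookup (fscale c u) x = c * Poly_Mapping.lookup u x"
  by (simp add: fscale_def Poly_Mapping.map.rep_eq when_def)

lemma vector_space_fscale: "vector_space (fscale :: 'k::field \<Rightarrow> ('x \<Rightarrow>\<^sub>0 'k) \<Rightarrow> _)"
  by unfold_locales (auto intro!: poly_mapping_eqI simp: lookup_add algebra_simps)

text \<open>The linear extension of a function \<open>f\<close> on the basis of a free vector space; \<open>s\<close> is the scalar
  multiplication of the target.\<close>

definition lin_ext ::
  "('k::field \<Rightarrow> 'v::ab_group_add \<Rightarrow> 'v) \<Rightarrow> ('x \<Rightarrow> 'v) \<Rightarrow> ('x \<Rightarrow>\<^sub>0 'k) \<Rightarrow> 'v" where
  "lin_ext s f u = (\<Sum>x\<in>Poly_Mapping.keys u. s (Poly_Mapping.lookup u x) (f x))"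

definition tens :: "'a \<Rightarrow> 'b \<Rightarrow> ('a \<times> 'b \<Rightarrow>\<^sub>0 'k::field)" where
  "tens x y = Poly_Mapping.single (x, y) 1"

definition tens3 :: "'a \<Rightarrow> 'b \<Rightarrow> 'c \<Rightarrow> ('a \<times> 'b \<times> 'c \<Rightarrow>\<^sub>0 'k::field)" where
  "tens3 x y z = Poly_Mapping.single (x, y, z) 1"

definition tensor_rel ::
  "('k::field \<Rightarrow> 'c::ab_group_add \<Rightarrow> 'c) \<Rightarrow> ('c \<times> 'c \<Rightarrow>\<^sub>0 'k) set" where
  "tensor_rel s = module.span fscale
     ({tens (x + x') y - tens x y - tens x' y | x x' y. True} \<union>
      {tens x (y + y') - tens x y - tens x y' | x y y'. True} \<union>
      {tens (s a x) y - fscale a (tens x y) | a x y. True} \<union>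
      {tens x (s a y) - fscale a (tens x y) | a x y. True})"

definition tensor3_rel ::
  "('k::field \<Rightarrow> 'c::ab_group_add \<Rightarrow> 'c) \<Rightarrow> ('c \<times> 'c \<times> 'c \<Rightarrow>\<^sub>0 'k) set" where
  "tensor3_rel s = module.span fscale
     ({tens3 (x + x') y z - tens3 x y z - tens3 x' y z | x x' y z. True} \<union>
      {tens3 x (y + y') z - tens3 x y z - tens3 x y' z | x y y' z. True} \<union>
      {tens3 x y (z + z') - tens3 x y z - tens3 x y z' | x y z z'. True} \<union>
      {tens3 (s a x) y z - fscale a (tens3 x y z) | a x y z. True} \<union>
      {tens3 x (s a y) z - fscale a (tens3 x y z) | a x y z. True} \<union>
      {tens3 x y (s a z) - fscale a (tens3 x y z) | a x y z. True})"

definition tensor_eq ::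
  "('k::field \<Rightarrow> 'c::ab_group_add \<Rightarrow> 'c) \<Rightarrow> ('c \<times> 'c \<Rightarrow>\<^sub>0 'k) \<Rightarrow> ('c \<times> 'c \<Rightarrow>\<^sub>0 'k) \<Rightarrow> bool" where
  "tensor_eq s u v \<longleftrightarrow> u - v \<in> tensor_rel s"

definition tensor3_eq ::
  "('k::field \<Rightarrow> 'c::ab_group_add \<Rightarrow> 'c) \<Rightarrow>
     ('c \<times> 'c \<times> 'c \<Rightarrow>\<^sub>0 'k) \<Rightarrow> ('c \<times> 'c \<times> 'c \<Rightarrow>\<^sub>0 'k) \<Rightarrow> bool" where
  "tensor3_eq s u v \<longleftrightarrow> u - v \<in> tensor3_rel s"

text \<open>For \<open>u = \<Sum> h\<^sub>1 \<otimes> h\<^sub>2\<close> and \<open>v = \<Sum> m\<^sub>1 \<otimes> m\<^sub>2\<close> this is \<open>\<Sum> h\<^sub>1m\<^sub>1 \<otimes> h\<^sub>2m\<^sub>2\<close>.\<close>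

definition tensor_act ::
  "('h \<Rightarrow> 'm \<Rightarrow> 'm) \<Rightarrow> ('h \<times> 'h \<Rightarrow>\<^sub>0 'k::field) \<Rightarrow> ('m \<times> 'm \<Rightarrow>\<^sub>0 'k) \<Rightarrow> ('m \<times> 'm \<Rightarrow>\<^sub>0 'k)" where
  "tensor_act act u v =
     lin_ext fscale (\<lambda>(h1, h2). lin_ext fscale (\<lambda>(m1, m2). tens (act h1 m1) (act h2 m2)) v) u"

text \<open>The two iterated comultiplications are \<open>(\<Delta> \<otimes> id) \<circ> \<Delta>\<close> and \<open>(id \<otimes> \<Delta>) \<circ> \<Delta>\<close>.\<close>

locale coalgebra = vector_space scale
  for scale :: "'k::field \<Rightarrow> 'c::ab_group_add \<Rightarrow> 'c" +
  fixes \<Delta> :: "'c \<Rightarrow> ('c \<times> 'c \<Rightarrow>\<^sub>0 'k)"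
    and \<epsilon> :: "'c \<Rightarrow> 'k"
  assumes comult_add: "tensor_eq scale (\<Delta> (x + y)) (\<Delta> x + \<Delta> y)"
    and comult_scale: "tensor_eq scale (\<Delta> (scale a x)) (fscale a (\<Delta> x))"
    and counit_linear: "Vector_Spaces.linear scale (*) \<epsilon>"
    and coassoc: "tensor3_eq scale
      (lin_ext fscale (\<lambda>(x1, x2). lin_ext fscale (\<lambda>(y, z). tens3 y z x2) (\<Delta> x1)) (\<Delta> x))
      (lin_ext fscale (\<lambda>(x1, x2). lin_ext fscale (\<lambda>(y, z). tens3 x1 y z) (\<Delta> x2)) (\<Delta> x))"
    and counit_left: "lin_ext scale (\<lambda>(x1, x2). scale (\<epsilon> x1) x2) (\<Delta> x) = x"
    and counit_right: "lin_ext scale (\<lambda>(x1, x2). scale (\<epsilon> x2) x1) (\<Delta> x) = x"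

text \<open>The unit map is \<open>a \<mapsto> scale a 1\<close>. The axiom \<open>0 \<noteq> 1\<close> of the class \<^class>\<open>ring_1\<close> is no
  restriction, as \<open>\<epsilon> 1 = 1\<close>.\<close>

locale hopf_algebra = coalgebra scale \<Delta> \<epsilon>
  for scale :: "'k::field \<Rightarrow> 'h::ring_1 \<Rightarrow> 'h"
    and \<Delta> :: "'h \<Rightarrow> ('h \<times> 'h \<Rightarrow>\<^sub>0 'k)"
    and \<epsilon> :: "'h \<Rightarrow> 'k" +
  fixes S :: "'h \<Rightarrow> 'h"
  assumes scale_mult_left: "scale a x * y = scale a (x * y)"
    and scale_mult_right: "x * scale a y = scale a (x * y)"
    and comult_one: "tensor_eq scale (\<Delta> 1) (tens 1 1)"
    and comult_mult: "tensor_eq scale (\<Delta> (x * y)) (tensor_act (*) (\<Delta> x) (\<Delta> y))"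
    and counit_one: "\<epsilon> 1 = 1"
    and counit_mult: "\<epsilon> (x * y) = \<epsilon> x * \<epsilon> y"
    and antipode_linear: "Vector_Spaces.linear scale scale S"
    and antipode_left: "lin_ext scale (\<lambda>(x1, x2). S x1 * x2) (\<Delta> x) = scale (\<epsilon> x) 1"
    and antipode_right: "lin_ext scale (\<lambda>(x1, x2). x1 * S x2) (\<Delta> x) = scale (\<epsilon> x) 1"

locale cocommutative_hopf_algebra = hopf_algebra scale \<Delta> \<epsilon> S
  for scale :: "'k::field \<Rightarrow> 'h::ring_1 \<Rightarrow> 'h"
    and \<Delta> :: "'h \<Rightarrow> ('h \<times> 'h \<Rightarrow>\<^sub>0 'k)"
    and \<epsilon> :: "'h \<Rightarrow> 'k"
    and S :: "'h \<Rightarrow> 'h" +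
  assumes cocommutative: "tensor_eq scale (lin_ext fscale (\<lambda>(x1, x2). tens x2 x1) (\<Delta> x)) (\<Delta> x)"

locale module_coalgebra =
  H: hopf_algebra scaleH \<Delta>H \<epsilon>H S + coalgebra scaleM \<Delta>M \<epsilon>M
  for scaleH :: "'k::field \<Rightarrow> 'h::ring_1 \<Rightarrow> 'h"
    and \<Delta>H :: "'h \<Rightarrow> ('h \<times> 'h \<Rightarrow>\<^sub>0 'k)"
    and \<epsilon>H :: "'h \<Rightarrow> 'k"
    and S :: "'h \<Rightarrow> 'h"
    and scaleM :: "'k \<Rightarrow> 'm::ab_group_add \<Rightarrow> 'm"
    and \<Delta>M :: "'m \<Rightarrow> ('m \<times> 'm \<Rightarrow>\<^sub>0 'k)"
    and \<epsilon>M :: "'m \<Rightarrow> 'k" +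
  fixes act :: "'h \<Rightarrow> 'm \<Rightarrow> 'm"
  assumes act_linear_left: "Vector_Spaces.linear scaleH scaleM (\<lambda>h. act h m)"
    and act_linear_right: "Vector_Spaces.linear scaleM scaleM (act h)"
    and act_one: "act 1 m = m"
    and act_mult: "act (g * h) m = act g (act h m)"
    and comult_act: "tensor_eq scaleM (\<Delta>M (act h m)) (tensor_act act (\<Delta>H h) (\<Delta>M m))"
    and counit_act: "\<epsilon>M (act h m) = \<epsilon>H h * \<epsilon>M m"

definition fin_dim_subspace ::
  "('k::field \<Rightarrow> 'v::ab_group_add \<Rightarrow> 'v) \<Rightarrow> 'v set \<Rightarrow> bool" where
  "fin_dim_subspace s V \<longleftrightarrow> (\<exists>B. finite B \<and> V = module.span s B)"

text \<open>The condition \<open>\<Delta> E \<subseteq> E \<otimes> E\<close>, where \<open>E \<otimes> E\<close> is identified with its image in \<open>M \<otimes> M\<close>.\<close>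

definition subcoalgebra ::
  "('k::field \<Rightarrow> 'm::ab_group_add \<Rightarrow> 'm) \<Rightarrow> ('m \<Rightarrow> ('m \<times> 'm \<Rightarrow>\<^sub>0 'k)) \<Rightarrow> 'm set \<Rightarrow> bool" where
  "subcoalgebra s \<Delta> E \<longleftrightarrow> module.subspace s E \<and>
     (\<forall>x\<in>E. \<exists>u. Poly_Mapping.keys u \<subseteq> E \<times> E \<and> tensor_eq s (\<Delta> x) u)"

text \<open>Vectors of \<open>V\<close> whose classes form a basis of \<open>V/U\<close>, and the dimension of \<open>V/U\<close> (following the
  definition of \<open>dim\<close> in \<^locale>\<open>vector_space\<close>), for subspaces \<open>U \<subseteq> V\<close>.\<close>

definition quotient_basis ::
  "('k::field \<Rightarrow> 'v::ab_group_add \<Rightarrow> 'v) \<Rightarrow> 'v set \<Rightarrow> 'v set \<Rightarrow> 'v set \<Rightarrow> bool" where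
  "quotient_basis s V U B \<longleftrightarrow> B \<subseteq> V \<and> V \<subseteq> module.span s (B \<union> U) \<and>
     (\<forall>t r. finite t \<and> t \<subseteq> B \<and> (\<Sum>v\<in>t. s (r v) v) \<in> U \<longrightarrow> (\<forall>v\<in>t. r v = 0))"

definition quotient_dim ::
  "('k::field \<Rightarrow> 'v::ab_group_add \<Rightarrow> 'v) \<Rightarrow> 'v set \<Rightarrow> 'v set \<Rightarrow> nat" where
  "quotient_dim s V U =
     (if \<exists>B. quotient_basis s V U B then card (SOME B. quotient_basis s V U B) else 0)"

definition subspace_product ::
  "('k::field \<Rightarrow> 'm::ab_group_add \<Rightarrow> 'm) \<Rightarrow> ('h \<Rightarrow> 'm \<Rightarrow> 'm) \<Rightarrow> 'h set \<Rightarrow> 'm set \<Rightarrow> 'm set" where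
  "subspace_product s act F E = module.span s {act f e | f e. f \<in> F \<and> e \<in> E}"

definition subspace_sum :: "'m::ab_group_add set \<Rightarrow> 'm set \<Rightarrow> 'm set" where
  "subspace_sum U V = {u + v | u v. u \<in> U \<and> v \<in> V}"

definition amenable_module_coalgebra ::
  "('k::field \<Rightarrow> 'h::ring_1 \<Rightarrow> 'h) \<Rightarrow> ('k \<Rightarrow> 'm::ab_group_add \<Rightarrow> 'm) \<Rightarrow>
     ('m \<Rightarrow> ('m \<times> 'm \<Rightarrow>\<^sub>0 'k)) \<Rightarrow> ('h \<Rightarrow> 'm \<Rightarrow> 'm) \<Rightarrow> bool" where
  "amenable_module_coalgebra scaleH scaleM \<Delta>M act \<longleftrightarrow>
     (\<forall>F. \<forall>e::real. fin_dim_subspace scaleH F \<and> e > 0 \<longrightarrow>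
        (\<exists>E. fin_dim_subspace scaleM E \<and> subcoalgebra scaleM \<Delta>M E \<and>
           real (quotient_dim scaleM (subspace_sum E (subspace_product scaleM act F E)) E)
             < e * real (vector_space.dim scaleM E)))"

definition amenable_hopf_algebra ::
  "('k::field \<Rightarrow> 'h::ring_1 \<Rightarrow> 'h) \<Rightarrow> ('h \<Rightarrow> ('h \<times> 'h \<Rightarrow>\<^sub>0 'k)) \<Rightarrow> bool" where
  "amenable_hopf_algebra scale \<Delta> \<longleftrightarrow> amenable_module_coalgebra scale scale \<Delta> (*)"

end

theory Submission
  imports Defs "HOL-Library.Function_Algebras"
begin

text \<open>
  Fix \<open>c \<in> M\<close> with \<open>\<epsilon>(c) = 1\<close>. For a subcoalgebra \<open>D\<close> of \<open>M\<close> let \<open>H\<^sub>D\<close> consist of those \<open>h\<close> with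
  \<open>\<Sum> h\<^sub>1 \<otimes> h\<^sub>2c \<in> H \<otimes> D\<close>; then \<open>H\<^sub>0 = 0\<close>. The analogue of the level sets of the push-forward to \<open>M\<close> of
  a Foelner set \<open>E \<subseteq> H\<close> are the subcoalgebras \<open>D\<^sub>t(E)\<close> maximizing \<open>dim (E \<inter> H\<^sub>D) - t dim D\<close>, as in a
  Harder-Narasimhan filtration. As a function of \<open>t\<close> the maximum has slope \<open>- dim D\<^sub>t(E)\<close>, so
  \<open>\<integral> dim D\<^sub>t(E) dt = dim E\<close>. If \<open>FE \<subseteq> E'\<close>, then \<open>F D\<^sub>t(E) \<subseteq> D\<^sub>t(E')\<close>. Hence
  \<open>dim E' < (1 + e) dim E\<close> gives some \<open>t\<close> with \<open>dim D\<^sub>t(E') < (1 + e) dim D\<^sub>t(E)\<close>, and \<open>D\<^sub>t(E)\<close> is the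
  required subcoalgebra of \<open>M\<close>.

  For the inclusion \<open>F D\<^sub>t(E) \<subseteq> D\<^sub>t(E')\<close>, let \<open>F\<close> be spanned by the entries of a matrix \<open>\<Gamma>\<close> with
  \<open>\<Delta>(\<Gamma>\<^sub>i\<^sub>l) = \<Sum>\<^sub>j \<Gamma>\<^sub>i\<^sub>j \<otimes> \<Gamma>\<^sub>j\<^sub>l\<close>, which acts on \<open>M\<^sup>r\<close> and \<open>H\<^sup>r\<close> with inverse \<open>S(\<Gamma>)\<close>. By cocommutativity,
  pulling back and pushing forward along \<open>\<Gamma>\<close> preserves subspaces of \<open>M\<^sup>r\<close> that are stable under the
  dual of \<open>M\<close>. Such a subspace has the total dimension of its slices (sets of last nonzero
  entries), which are subcoalgebras of \<open>M\<close> and can be tested against the maximality of \<open>D\<^sub>t\<close>.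
\<close>

section \<open>Finite-dimensional subspaces and quotients\<close>

lemma linearI:
  assumes "vector_space s1" "vector_space s2"
    and "\<And>x y. f (x + y) = f x + f y" "\<And>c x. f (s1 c x) = s2 c (f x)"
  shows "Vector_Spaces.linear s1 s2 f"
  using assms by (simp add: Vector_Spaces.linear_iff)

context vector_space
begin

abbreviation functional :: "('b \<Rightarrow> 'a) \<Rightarrow> bool" where
  "functional \<equiv> Vector_Spaces.linear scale (*)"

lemma fin_dim_basis:
  assumes "fin_dim_subspace scale V"
  obtains B where "finite B" "independent B" "span B = V" "card B = dim V" "B \<subseteq> V"
proof -
  obtain A where A: "finite A" "V = span A"
    using assms unfolding fin_dim_subspace_def by auto
  obtain B where B: "B \<subseteq> V" "independent B" "V \<subseteq> span B" "card B = dim V"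
    by (rule basis_exists)
  have "finite B" using independent_span_bound[OF A(1) B(2)] A(2) B(1) by blast
  moreover have "span B = V"
    using span_subspace[OF B(1,3)] A(2) by blast
  ultimately show ?thesis using that B by blast
qed

lemma fin_dim_subspace_imp_subspace: "fin_dim_subspace scale V \<Longrightarrow> subspace V"
  unfolding fin_dim_subspace_def by auto

lemma fin_dim_subspaceI:
  assumes "subspace U" "U \<subseteq> span A" "finite A"
  shows "fin_dim_subspace scale U"
proof -
  obtain B where B: "B \<subseteq> U" "independent B" "U \<subseteq> span B" "card B = dim U"
    by (rule basis_exists)
  have "finite B" using independent_span_bound[OF assms(3) B(2) subset_trans[OF B(1) assms(2)]] ..
  moreover have "U = span B" using span_subspace[OF B(1,3) assms(1)] ..
  ultimately show ?thesis unfolding fin_dim_subspace_def by blast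
qed

lemma fin_dim_subspace_subset:
  assumes "fin_dim_subspace scale V" "subspace U" "U \<subseteq> V"
  shows "fin_dim_subspace scale U"
proof -
  obtain A where "finite A" "V = span A"
    using assms(1) unfolding fin_dim_subspace_def by blast
  then show ?thesis using assms(2,3) by (intro fin_dim_subspaceI) auto
qed

lemma fin_dim_subspace_zero: "fin_dim_subspace scale {0}"
  unfolding fin_dim_subspace_def by (rule exI[of _ "{}"]) simp

text \<open>Extend a basis \<open>A\<close> of \<open>U\<close> to a basis \<open>C\<close> of
  \<open>V\<close>. A combination of \<open>C - A\<close> lying in \<open>U\<close> is also a
  combination of \<open>A\<close>, so independence of \<open>C\<close> forces its coefficients to
  vanish.\<close>

lemma quotient_basis_exists:
  assumes "fin_dim_subspace scale V" "subspace U" "U \<subseteq> V"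
  obtains B where "quotient_basis scale V U B"
proof -
  obtain A where A: "finite A" "independent A" "span A = U" "A \<subseteq> U"
    using fin_dim_basis[OF fin_dim_subspace_subset[OF assms]] by metis
  obtain C where C: "A \<subseteq> C" "C \<subseteq> V" "independent C" "V \<subseteq> span C"
    using maximal_independent_subset_extend[of A V] A assms by blast
  have "quotient_basis scale V U (C - A)"
    unfolding quotient_basis_def
  proof (intro conjI allI impI ballI)
    show "C - A \<subseteq> V" using C by auto
    have "C \<subseteq> (C - A) \<union> U" using A by auto
    then show "V \<subseteq> span ((C - A) \<union> U)" using C(4) span_mono by blast
  next
    fix t r v
    assume t: "finite t \<and> t \<subseteq> C - A \<and> (\<Sum>v\<in>t. scale (r v) v) \<in> U" and v: "v \<in> t"
    have "(\<Sum>v\<in>t. scale (r v) v) \<in> span A" using t A by auto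
    then obtain q where q: "(\<Sum>v\<in>t. scale (r v) v) = (\<Sum>v\<in>A. scale (q v) v)"
      using span_finite[OF A(1)] by auto
    define p where "p v = (if v \<in> t then r v else - q v)" for v
    have d: "t \<inter> A = {}" using t by auto
    have "(\<Sum>v\<in>t \<union> A. scale (p v) v) = (\<Sum>v\<in>t. scale (p v) v) + (\<Sum>v\<in>A. scale (p v) v)"
      using t A d by (intro sum.union_disjoint) auto
    also have "(\<Sum>v\<in>t. scale (p v) v) = (\<Sum>v\<in>t. scale (r v) v)"
      by (intro sum.cong) (auto simp: p_def)
    also have "(\<Sum>v\<in>A. scale (p v) v) = (\<Sum>v\<in>A. - scale (q v) v)"
      using d by (intro sum.cong) (auto simp: p_def)
    finally have "(\<Sum>v\<in>t \<union> A. scale (p v) v) = 0"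
      using q by (simp add: sum_negf)
    moreover have "t \<union> A \<subseteq> C" using t C(1) by blast
    ultimately have "p v = 0"
      using independentD[OF C(3), of "t \<union> A" p v] t A(1) v by blast
    then show "r v = 0" using v by (simp add: p_def)
  qed
  then show ?thesis using that by blast
qed

text \<open>Together with a basis of \<open>U\<close>, a quotient basis is a basis of
  \<open>V\<close>. Its cardinality is therefore the same for every choice, so the
  \<open>SOME\<close> in \<open>quotient_dim\<close> is harmless.\<close>

lemma quotient_basis_card:
  assumes "fin_dim_subspace scale V" "subspace U" "U \<subseteq> V" and B: "quotient_basis scale V U B"
  shows "finite B" "card B + dim U = dim V"
proof -
  have fU: "fin_dim_subspace scale U" using assms fin_dim_subspace_subset by blast
  obtain A where A: "finite A" "independent A" "span A = U" "card A = dim U" "A \<subseteq> U"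
    using fin_dim_basis[OF fU] by metis
  have BV: "B \<subseteq> V" "V \<subseteq> span (B \<union> U)"
    and Bi: "\<And>t r v. finite t \<Longrightarrow> t \<subseteq> B \<Longrightarrow> (\<Sum>v\<in>t. scale (r v) v) \<in> U \<Longrightarrow> v \<in> t \<Longrightarrow> r v = 0"
    using B unfolding quotient_basis_def by blast+
  have disj: "b \<notin> U" if "b \<in> B" for b
    using Bi[of "{b}" "\<lambda>_. 1" b] that by auto
  have ind: "independent (B \<union> A)"
    unfolding independent_explicit_module
  proof (intro allI impI)
    fix t u v
    assume t: "finite t" "t \<subseteq> B \<union> A" and s: "(\<Sum>v\<in>t. scale (u v) v) = 0" and v: "v \<in> t"
    have split: "t = (t \<inter> B) \<union> (t - B)" by auto
    have "(\<Sum>v\<in>t. scale (u v) v) = (\<Sum>v\<in>t \<inter> B. scale (u v) v) + (\<Sum>v\<in>t - B. scale (u v) v)"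
      using t by (subst split, intro sum.union_disjoint) auto
    then have e: "(\<Sum>v\<in>t \<inter> B. scale (u v) v) = - (\<Sum>v\<in>t - B. scale (u v) v)"
      using s by (simp add: eq_neg_iff_add_eq_0)
    have "(\<Sum>v\<in>t - B. scale (u v) v) \<in> U"
      using t A(5) assms(2) by (intro subspace_sum subspace_scale) auto
    then have "(\<Sum>v\<in>t \<inter> B. scale (u v) v) \<in> U"
      using e assms(2) subspace_neg by metis
    then have z: "u w = 0" if "w \<in> t \<inter> B" for w using Bi[of "t \<inter> B"] t that by auto
    then have "(\<Sum>v\<in>t - B. scale (u v) v) = 0" using e by simp
    then have "u w = 0" if "w \<in> t - B" for w
      using independentD[OF A(2), of "t - B" u w] t that by auto
    then show "u v = 0" using z v by blast
  qed
  have sp: "V \<subseteq> span (B \<union> A)"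
  proof -
    have "U \<subseteq> span (B \<union> A)" using A(3) by (metis span_mono sup_ge2)
    then have "B \<union> U \<subseteq> span (B \<union> A)" using span_superset[of "B \<union> A"] by auto
    then have "span (B \<union> U) \<subseteq> span (B \<union> A)" by (rule span_minimal) simp
    then show ?thesis using BV by auto
  qed
  obtain F where F: "finite F" "V = span F" using assms(1) unfolding fin_dim_subspace_def by auto
  have "finite (B \<union> A)"
    using independent_span_bound[of F "B \<union> A"] F ind BV A assms(3) by auto
  then show fB: "finite B" by simp
  have "card (B \<union> A) = dim V"
    by (rule basis_card_eq_dim[OF _ sp ind]) (use BV A assms(3) in auto)
  moreover have "B \<inter> A = {}" using disj A by auto
  ultimately show "card B + dim U = dim V"
    using card_Un_disjoint[of B A] fB A by simp
qed

lemma quotient_dim_eq: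
  assumes "fin_dim_subspace scale V" "subspace U" "U \<subseteq> V"
  shows "quotient_dim scale V U + dim U = dim V"
proof -
  have ex: "\<exists>B. quotient_basis scale V U B" using quotient_basis_exists[OF assms] by blast
  then have "quotient_basis scale V U (SOME B. quotient_basis scale V U B)" by (rule someI_ex)
  then show ?thesis using quotient_basis_card(2)[OF assms] ex by (simp add: quotient_dim_def)
qed

lemma fin_dim_mono:
  assumes "fin_dim_subspace scale V" "subspace U" "U \<subseteq> V"
  shows "dim U \<le> dim V"
  using quotient_dim_eq[OF assms] by simp

lemma fin_dim_eqI:
  assumes "fin_dim_subspace scale V" "subspace U" "U \<subseteq> V" "dim V \<le> dim U"
  shows "U = V"
proof -
  obtain B where B: "quotient_basis scale V U B" using quotient_basis_exists[OF assms(1-3)] .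
  have "card B = 0" using quotient_basis_card(2)[OF assms(1-3) B] assms(4) by linarith
  then have "B = {}" using quotient_basis_card(1)[OF assms(1-3) B] by simp
  then have "V \<subseteq> span U" using B unfolding quotient_basis_def by simp
  then have "V \<subseteq> U" using span_minimal[OF subset_refl assms(2)] by blast
  then show ?thesis using assms(3) by auto
qed

lemma dim_zero_subspace: "dim {0} = 0"
  using dim_span_eq_card_independent[OF independent_empty] by simp

lemma fin_dim_nonzero:
  assumes "fin_dim_subspace scale V" "V \<noteq> {0}"
  shows "dim V \<ge> 1"
proof (rule ccontr)
  assume "\<not> dim V \<ge> 1"
  then have "{0} = V"
    using assms fin_dim_subspace_imp_subspace subspace_0
    by (intro fin_dim_eqI) (auto simp: dim_zero_subspace)
  then show False using assms by auto
qed

lemma fin_dim_sum: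
  assumes "fin_dim_subspace scale U" "fin_dim_subspace scale V"
  shows "fin_dim_subspace scale (subspace_sum U V)"
proof -
  obtain A B where "finite A" "U = span A" "finite B" "V = span B"
    using assms unfolding fin_dim_subspace_def by auto
  then show ?thesis unfolding fin_dim_subspace_def subspace_sum_def
    by (intro exI[of _ "A \<union> B"]) (auto simp: span_Un)
qed

lemma fin_dim_inter:
  "fin_dim_subspace scale U \<Longrightarrow> subspace V \<Longrightarrow> fin_dim_subspace scale (U \<inter> V)"
  using fin_dim_subspace_subset[of U "U \<inter> V"] subspace_inter fin_dim_subspace_imp_subspace by auto

end

section \<open>Images, preimages and the descent of functionals along linear maps\<close>

lemma fin_dim_image:
  assumes "Vector_Spaces.linear s1 s2 f" "fin_dim_subspace s1 V"
  shows "fin_dim_subspace s2 (f ` V)"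
proof -
  interpret Vector_Spaces.linear s1 s2 f by fact
  show ?thesis using assms(2) unfolding fin_dim_subspace_def
    by (metis finite_imageI span_image)
qed

text \<open>With \<open>P = {0}\<close> this is the rank-nullity theorem.\<close>

lemma dim_image_plus_preimage:
  fixes s1 :: "'k::field \<Rightarrow> 'a::ab_group_add \<Rightarrow> 'a"
  assumes lin: "Vector_Spaces.linear s1 s2 f"
    and V: "fin_dim_subspace s1 V" and P: "fin_dim_subspace s2 P"
  shows "vector_space.dim s2 (subspace_sum P (f ` V)) + vector_space.dim s1 {v \<in> V. f v \<in> P} =
    vector_space.dim s2 P + vector_space.dim s1 V"
proof -
  interpret Vector_Spaces.linear s1 s2 f by fact
  define K where "K = {v \<in> V. f v \<in> P}"
  define T where "T = subspace_sum P (f ` V)"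
  have sV: "vs1.subspace V" and sP: "vs2.subspace P"
    using V P vs1.fin_dim_subspace_imp_subspace vs2.fin_dim_subspace_imp_subspace by auto
  have sK: "vs1.subspace K"
    using sV sP unfolding K_def vs1.subspace_def vs2.subspace_def by (auto simp: add scale)
  have fT: "fin_dim_subspace s2 T"
    unfolding T_def using fin_dim_image[OF lin V] P vs2.fin_dim_sum by blast
  have PT: "P \<subseteq> T"
    unfolding T_def subspace_sum_def using sV vs1.subspace_0 zero by force
  \<comment> \<open>A basis of \<open>V\<close> modulo the preimage \<open>K\<close> of
    \<open>P\<close> will be carried by \<open>f\<close> to a basis of \<open>T\<close> modulo
    \<open>P\<close>.\<close>
  obtain B where B: "quotient_basis s1 V K B"
    using vs1.quotient_basis_exists[OF V sK] unfolding K_def by blast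
  have cB: "finite B" "card B + vs1.dim K = vs1.dim V"
    using vs1.quotient_basis_card[OF V sK _ B] unfolding K_def by auto
  have BV: "B \<subseteq> V" "V \<subseteq> vs1.span (B \<union> K)"
    and Bi: "\<And>t r v. finite t \<Longrightarrow> t \<subseteq> B \<Longrightarrow> (\<Sum>v\<in>t. s1 (r v) v) \<in> K \<Longrightarrow> v \<in> t \<Longrightarrow> r v = 0"
    using B unfolding quotient_basis_def by blast+
  have inB: "r v = 0" if "t \<subseteq> B" "(\<Sum>v\<in>t. s2 (r v) (f v)) \<in> P" "v \<in> t" for t r v
  proof -
    have "(\<Sum>v\<in>t. s1 (r v) v) \<in> V"
      using that BV sV by (intro vs1.subspace_sum vs1.subspace_scale) auto
    then have "(\<Sum>v\<in>t. s1 (r v) v) \<in> K"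
      using that(2) unfolding K_def by (simp add: sum scale)
    then show ?thesis using Bi[of t r v] that cB(1) finite_subset by blast
  qed
  have inj: "inj_on f B"
  proof (rule inj_onI, rule ccontr)
    fix x y assume xy: "x \<in> B" "y \<in> B" "f x = f y" "x \<noteq> y"
    have "(\<Sum>v\<in>{x, y}. s2 (if v = x then 1 else - 1) (f v)) = 0"
      using xy by simp
    then have "(if x = x then 1 else - 1 :: 'k) = 0"
      using xy sP by (intro inB[of "{x, y}"]) (auto simp: vs2.subspace_0)
    then show False by simp
  qed
  have "quotient_basis s2 T P (f ` B)"
    unfolding quotient_basis_def
  proof (intro conjI allI impI ballI)
    show "f ` B \<subseteq> T"
    proof
      fix y assume "y \<in> f ` B"
      then have "y = 0 + y" "y \<in> f ` V" "0 \<in> P" using BV sP vs2.subspace_0 by auto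
      then show "y \<in> T" unfolding T_def subspace_sum_def by blast
    qed
    have "f ` V \<subseteq> f ` vs1.span (B \<union> K)" using BV by auto
    also have "\<dots> = vs2.span (f ` B \<union> f ` K)" by (simp add: span_image[symmetric] image_Un)
    also have "\<dots> \<subseteq> vs2.span (f ` B \<union> P)"
      by (rule vs2.span_mono) (auto simp: K_def)
    finally show "T \<subseteq> vs2.span (f ` B \<union> P)"
      unfolding T_def subspace_sum_def using vs2.span_superset[of "f ` B \<union> P"]
      by (auto intro!: vs2.span_add)
  next
    fix t r v assume t: "finite t \<and> t \<subseteq> f ` B \<and> (\<Sum>v\<in>t. s2 (r v) v) \<in> P" and v: "v \<in> t"
    define t' where "t' = B \<inter> f -` t"
    have t': "f ` t' = t" "t' \<subseteq> B" using t by (auto simp: t'_def)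
    have "(\<Sum>v\<in>t. s2 (r v) v) = (\<Sum>v\<in>t'. s2 (r (f v)) (f v))"
      using t' inj by (subst t'(1)[symmetric], subst sum.reindex) (auto intro: inj_on_subset)
    then have "(\<Sum>v\<in>t'. s2 (r (f v)) (f v)) \<in> P" using t by simp
    then have "r (f w) = 0" if "w \<in> t'" for w
      using inB[of t' "\<lambda>v. r (f v)" w] t' that by blast
    then show "r v = 0" using v t' by auto
  qed
  then have "card (f ` B) + vs2.dim P = vs2.dim T"
    using vs2.quotient_basis_card(2)[OF fT sP PT] by blast
  then have "vs2.dim T + vs1.dim K = vs2.dim P + vs1.dim V"
    using cB(2) card_image[OF inj] by simp
  then show ?thesis unfolding T_def K_def .
qed

text \<open>Because \<open>l\<close> vanishes on the vectors of \<open>V\<close> that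
  \<open>f\<close> sends into \<open>P\<close>, its values descend to the image of \<open>V\<close>
  modulo \<open>P\<close>. The functional \<open>m\<close> is prescribed as 0 on a basis of
  \<open>P\<close>, through chosen lifts on further basis vectors from the image of
  \<open>V\<close>, and then extended linearly.\<close>

lemma functional_factor:
  fixes s1 :: "'k::field \<Rightarrow> 'a::ab_group_add \<Rightarrow> 'a"
  assumes lin: "Vector_Spaces.linear s1 s2 f" and lam: "Vector_Spaces.linear s1 (*) l"
    and V: "module.subspace s1 V" and P: "module.subspace s2 P"
    and vanish: "\<And>v. v \<in> V \<Longrightarrow> f v \<in> P \<Longrightarrow> l v = 0"
  obtains m where "Vector_Spaces.linear s2 (*) m" "\<And>p. p \<in> P \<Longrightarrow> m p = 0"
    "\<And>v. v \<in> V \<Longrightarrow> m (f v) = l v"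
proof -
  interpret Vector_Spaces.linear s1 s2 f by fact
  interpret l: Vector_Spaces.linear s1 "(*)" l by fact
  interpret q: vector_space_pair s2 "(*) :: 'k \<Rightarrow> 'k \<Rightarrow> 'k" by unfold_locales
  obtain A where A: "A \<subseteq> P" "vs2.independent A" "P \<subseteq> vs2.span A" "card A = vs2.dim P"
    by (rule vs2.basis_exists)
  obtain B where B: "A \<subseteq> B" "B \<subseteq> A \<union> f ` V" "vs2.independent B" "A \<union> f ` V \<subseteq> vs2.span B"
    using vs2.maximal_independent_subset_extend[of A "A \<union> f ` V"] A by blast
  define g where "g b = (SOME v. v \<in> V \<and> f v = b)" for b
  have g: "g b \<in> V \<and> f (g b) = b" if "b \<in> B - A" for b
    unfolding g_def by (rule someI_ex) (use that B in auto)
  obtain m where m: "Vector_Spaces.linear s2 (*) m"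
    and mB: "\<And>b. b \<in> B \<Longrightarrow> m b = (if b \<in> A then 0 else l (g b))"
    using q.linear_independent_extend[OF B(3), of "\<lambda>b. if b \<in> A then 0 else l (g b)"] by blast
  interpret m: Vector_Spaces.linear s2 "(*)" m by fact
  have mP: "m p = 0" if "p \<in> P" for p
  proof (rule m.eq_0_on_span)
    show "p \<in> vs2.span A" using that A by auto
  qed (use mB B in auto)
  have "m (f v) = l v" if v: "v \<in> V" for v
  proof -
    have "f v \<in> vs2.span B" using v B by auto
    then obtain t r where t: "finite t" "t \<subseteq> B" "f v = (\<Sum>b\<in>t. s2 (r b) b)"
      unfolding vs2.span_explicit by auto
    \<comment> \<open>Subtracting the chosen lifts of the basis vectors outside \<open>A\<close>
      leaves a vector of \<open>V\<close> whose image lies in \<open>P\<close>, where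
      \<open>vanish\<close> applies.\<close>
    define w where "w = v - (\<Sum>b\<in>t - A. s1 (r b) (g b))"
    have wV: "w \<in> V" unfolding w_def
      using v V g t by (intro vs1.subspace_diff vs1.subspace_sum vs1.subspace_scale) auto
    have "f w = f v - (\<Sum>b\<in>t - A. s2 (r b) b)"
    proof -
      have "(\<Sum>b\<in>t - A. s2 (r b) (f (g b))) = (\<Sum>b\<in>t - A. s2 (r b) b)"
        using g t by (intro sum.cong) auto
      then show ?thesis by (simp add: w_def diff sum scale)
    qed
    also have "\<dots> = (\<Sum>b\<in>t \<inter> A. s2 (r b) b)"
      using t(1) sum.union_disjoint[of "t \<inter> A" "t - A" "\<lambda>b. s2 (r b) b"]
      by (simp add: t(3) Int_Diff_Un Int_Diff_disjoint)
    finally have fw: "f w = (\<Sum>b\<in>t \<inter> A. s2 (r b) b)" .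
    also have "\<dots> \<in> P"
      using A P by (intro vs2.subspace_sum vs2.subspace_scale) auto
    finally have fwP: "f w \<in> P" .
    have fv: "f v = f w + (\<Sum>b\<in>t - A. s2 (r b) b)"
      using t(1) sum.union_disjoint[of "t \<inter> A" "t - A" "\<lambda>b. s2 (r b) b"]
      by (simp add: t(3) fw Int_Diff_Un Int_Diff_disjoint)
    have "l v = (\<Sum>b\<in>t - A. r b * l (g b))"
      using vanish[OF wV fwP] by (simp add: w_def l.diff l.sum l.scale)
    also have "\<dots> = (\<Sum>b\<in>t - A. r b * m b)"
      using mB t by (intro sum.cong) auto
    also have "\<dots> = m (f v)"
      using mP[OF fwP] by (simp add: fv m.add m.sum m.scale)
    finally show ?thesis by simp
  qed
  then show ?thesis using that m mP by blast
qed

section \<open>Tuples and their slices\<close>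

definition fun_scale :: "('k \<Rightarrow> 'v \<Rightarrow> 'v) \<Rightarrow> 'k \<Rightarrow> ('i \<Rightarrow> 'v) \<Rightarrow> 'i \<Rightarrow> 'v" where
  "fun_scale s c f = (\<lambda>i. s c (f i))"

text \<open>The \<open>r\<close>-fold power of \<open>D\<close>, padded with zeros inside the
  functions on all naturals, so that one ambient space serves every \<open>r\<close>.\<close>

definition tuples :: "nat \<Rightarrow> 'v::zero set \<Rightarrow> (nat \<Rightarrow> 'v) set" where
  "tuples r D = {f. (\<forall>i<r. f i \<in> D) \<and> (\<forall>i\<ge>r. f i = 0)}"

definition unit_tuple :: "nat \<Rightarrow> 'v::zero \<Rightarrow> nat \<Rightarrow> 'v" where
  "unit_tuple i x = (\<lambda>j. if j = i then x else 0)"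

text \<open>The graded piece in degree \<open>i\<close> for the filtration of \<open>W\<close> by
  the position of the last nonzero entry.\<close>

definition slice :: "(nat \<Rightarrow> 'v::zero) set \<Rightarrow> nat \<Rightarrow> 'v set" where
  "slice W i = {w i | w. w \<in> W \<and> (\<forall>l>i. w l = 0)}"

definition matrix_map :: "nat \<Rightarrow> (nat \<Rightarrow> nat \<Rightarrow> 'v \<Rightarrow> 'v::ab_group_add) \<Rightarrow> (nat \<Rightarrow> 'v) \<Rightarrow> nat \<Rightarrow> 'v" where
  "matrix_map r G f = (\<lambda>i. if i < r then \<Sum>l<r. G i l (f l) else 0)"

lemma slice_tuples_subset: "W \<subseteq> tuples r D \<Longrightarrow> i < r \<Longrightarrow> slice W i \<subseteq> D"
  unfolding slice_def tuples_def by blast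

context vector_space
begin

lemma vector_space_fun_scale: "vector_space (fun_scale scale :: 'a \<Rightarrow> ('i \<Rightarrow> 'b) \<Rightarrow> _)"
  by unfold_locales (auto simp: fun_scale_def algebra_simps)

lemma linear_coordinate: "Vector_Spaces.linear (fun_scale scale) scale (\<lambda>f. f i)"
  by (rule linearI[OF vector_space_fun_scale vector_space_axioms]) (auto simp: fun_scale_def)

lemma linear_unit_tuple: "Vector_Spaces.linear scale (fun_scale scale) (unit_tuple i)"
  by (rule linearI[OF vector_space_axioms vector_space_fun_scale])
    (auto simp: fun_scale_def unit_tuple_def)

lemma fun_subspace_iff:
  "module.subspace (fun_scale scale) W \<longleftrightarrow>
    (\<lambda>i. 0) \<in> W \<and> (\<forall>v\<in>W. \<forall>w\<in>W. (\<lambda>i. v i + w i) \<in> W) \<and> (\<forall>c. \<forall>w\<in>W. (\<lambda>i. scale c (w i)) \<in> W)"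
proof -
  interpret F: vector_space "fun_scale scale :: 'a \<Rightarrow> ('c \<Rightarrow> 'b) \<Rightarrow> _" by (rule vector_space_fun_scale)
  show ?thesis unfolding F.subspace_def by (auto simp: fun_scale_def plus_fun_def zero_fun_def)
qed

lemma tuples_subspace: "subspace D \<Longrightarrow> module.subspace (fun_scale scale) (tuples r D)"
  unfolding fun_subspace_iff tuples_def by (auto intro: subspace_0 subspace_add subspace_scale)

lemma slice_subspace:
  assumes "module.subspace (fun_scale scale) W"
  shows "subspace (slice W i)"
proof (rule subspaceI)
  note W = assms[unfolded fun_subspace_iff]
  show "0 \<in> slice W i" unfolding slice_def using W by force
next
  note W = assms[unfolded fun_subspace_iff]
  fix x y assume "x \<in> slice W i" "y \<in> slice W i"
  then obtain v w where "v \<in> W" "w \<in> W" "x = v i" "y = w i" "\<forall>l>i. v l = 0" "\<forall>l>i. w l = 0"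
    unfolding slice_def by blast
  then show "x + y \<in> slice W i" unfolding slice_def
    using W by (intro CollectI exI[of _ "\<lambda>i. v i + w i"]) auto
next
  note W = assms[unfolded fun_subspace_iff]
  fix c x assume "x \<in> slice W i"
  then obtain v where "v \<in> W" "x = v i" "\<forall>l>i. v l = 0"
    unfolding slice_def by blast
  then show "scale c x \<in> slice W i" unfolding slice_def
    using W by (intro CollectI exI[of _ "\<lambda>i. scale c (v i)"]) auto
qed

lemma tuple_expand:
  assumes "f \<in> tuples r D"
  shows "f = (\<Sum>i<r. unit_tuple i (f i))"
proof
  fix j
  have "(\<Sum>i<r. unit_tuple i (f i)) j = (\<Sum>i<r. unit_tuple i (f i) j)"
    by (induction r) (auto simp: zero_fun_def plus_fun_def)
  also have "\<dots> = (\<Sum>i<r. if j = i then f i else 0)"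
    by (simp add: unit_tuple_def)
  also have "\<dots> = f j" using assms by (auto simp: tuples_def)
  finally show "f j = (\<Sum>i<r. unit_tuple i (f i)) j" ..
qed

lemma tuples_fin_dim:
  assumes "fin_dim_subspace scale D"
  shows "fin_dim_subspace (fun_scale scale) (tuples r D)"
proof -
  interpret F: vector_space "fun_scale scale :: 'a \<Rightarrow> (nat \<Rightarrow> 'b) \<Rightarrow> _" by (rule vector_space_fun_scale)
  obtain B where B: "finite B" "D = span B" using assms unfolding fin_dim_subspace_def by blast
  define A where "A = (\<Union>i<r. unit_tuple i ` B)"
  have "tuples r D \<subseteq> F.span A"
  proof
    fix f assume f: "f \<in> tuples r D"
    have "unit_tuple i (f i) \<in> F.span A" if i: "i < r" for i
    proof -
      interpret u: Vector_Spaces.linear scale "fun_scale scale" "unit_tuple i" by (rule linear_unit_tuple)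
      have "f i \<in> span B" using f i B by (simp add: tuples_def)
      then have "unit_tuple i (f i) \<in> F.span (unit_tuple i ` B)" by (simp add: u.span_image)
      also have "\<dots> \<subseteq> F.span A" by (rule F.span_mono) (use i in \<open>auto simp: A_def\<close>)
      finally show ?thesis .
    qed
    then have "(\<Sum>i<r. unit_tuple i (f i)) \<in> F.span A" by (intro F.span_sum) auto
    then show "f \<in> F.span A" using tuple_expand[OF f] by simp
  qed
  moreover have "finite A" using B by (simp add: A_def)
  ultimately show ?thesis
    using F.fin_dim_subspaceI[OF tuples_subspace] assms fin_dim_subspace_imp_subspace by blast
qed

text \<open>Filter \<open>W\<close> by the subspaces \<open>V j\<close> of tuples vanishing from
  position \<open>j\<close> on. The coordinate \<open>j\<close> maps \<open>V (Suc j)\<close> onto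
  \<open>slice W j\<close> with kernel \<open>V j\<close>, so rank-nullity adds up the
  slices.\<close>

lemma dim_slices:
  assumes W: "module.subspace (fun_scale scale) W" "W \<subseteq> tuples r D" and D: "fin_dim_subspace scale D"
  shows "vector_space.dim (fun_scale scale) W = (\<Sum>i<r. dim (slice W i))"
proof -
  interpret F: vector_space "fun_scale scale :: 'a \<Rightarrow> (nat \<Rightarrow> 'b) \<Rightarrow> _" by (rule vector_space_fun_scale)
  define V where "V j = {w \<in> W. \<forall>l\<ge>j. w l = 0}" for j
  have sV: "F.subspace (V j)" for j
    using W(1) unfolding fun_subspace_iff V_def by simp
  have fV: "fin_dim_subspace (fun_scale scale) (V j)" for j
    by (rule F.fin_dim_subspace_subset[OF tuples_fin_dim[OF D] sV])
      (use W(2) in \<open>auto simp: V_def\<close>)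
  have "F.dim (V j) = (\<Sum>i<j. dim (slice W i))" for j
  proof (induction j)
    case 0
    have "V 0 = {0}" using sV[of 0] F.subspace_0 by (auto simp: V_def zero_fun_def)
    then show ?case by (simp add: F.dim_zero_subspace)
  next
    case (Suc j)
    have "(\<lambda>w. w j) ` V (Suc j) = slice W j"
      by (auto simp: V_def slice_def Suc_le_eq)
    then have 1: "subspace_sum {0} ((\<lambda>w. w j) ` V (Suc j)) = slice W j"
      by (simp add: subspace_sum_def)
    have "(\<forall>l\<ge>Suc j. v l = 0) \<and> v j = 0 \<longleftrightarrow> (\<forall>l\<ge>j. v l = 0)" for v :: "nat \<Rightarrow> 'b"
      by (metis Suc_leD le_refl not_less_eq_eq order_antisym_conv)
    then have 2: "{v \<in> V (Suc j). v j \<in> {0}} = V j"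
      unfolding V_def by simp
    have "dim (slice W j) + F.dim (V j) = F.dim (V (Suc j))"
      using dim_image_plus_preimage[OF linear_coordinate fV fin_dim_subspace_zero, of j "Suc j"]
      by (simp only: 1 2 dim_zero_subspace)
    then show ?case using Suc by simp
  qed
  moreover have "V r = W" using W(2) by (auto simp: V_def tuples_def)
  ultimately show ?thesis by metis
qed

lemma slice_tuples:
  assumes "subspace D" "i < r"
  shows "slice (tuples r D) i = D"
proof
  show "slice (tuples r D) i \<subseteq> D" using assms by (auto simp: slice_def tuples_def)
  show "D \<subseteq> slice (tuples r D) i"
  proof
    fix x assume "x \<in> D"
    then show "x \<in> slice (tuples r D) i" unfolding slice_def tuples_def
      using assms by (intro CollectI exI[of _ "unit_tuple i x"]) (auto simp: unit_tuple_def subspace_0)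
  qed
qed

lemma dim_tuples:
  assumes "fin_dim_subspace scale D"
  shows "vector_space.dim (fun_scale scale) (tuples r D) = r * dim D"
proof -
  have sD: "subspace D" using assms by (rule fin_dim_subspace_imp_subspace)
  have "vector_space.dim (fun_scale scale) (tuples r D) = (\<Sum>i<r. dim (slice (tuples r D) i))"
    by (rule dim_slices[OF tuples_subspace[OF sD] subset_refl assms])
  also have "\<dots> = (\<Sum>i<r. dim D)" using slice_tuples[OF sD] by (intro sum.cong) auto
  finally show ?thesis by simp
qed

lemma linear_matrix_map:
  assumes "\<And>i l. Vector_Spaces.linear scale scale (G i l)"
  shows "Vector_Spaces.linear (fun_scale scale) (fun_scale scale) (matrix_map r G)"
proof (rule linearI[OF vector_space_fun_scale vector_space_fun_scale])
  have G: "G i l (x + y) = G i l x + G i l y" "G i l (scale c x) = scale c (G i l x)" for i l x y c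
    using assms[of i l] by (simp_all add: Vector_Spaces.linear_iff)
  show "matrix_map r G (x + y) = matrix_map r G x + matrix_map r G y" for x y
    by (auto simp: matrix_map_def plus_fun_def G sum.distrib)
  show "matrix_map r G (fun_scale scale c x) = fun_scale scale c (matrix_map r G x)" for c x
    by (auto simp: matrix_map_def fun_scale_def G scale_sum_right)
qed

end

section \<open>Level sets\<close>

text \<open>In the application \<open>T\<close> runs through the right and left actions \<open>\<Sum> x\<^sub>1 \<alpha>(x\<^sub>2)\<close> and \<open>\<Sum> \<alpha>(x\<^sub>1) x\<^sub>2\<close> of the
  functionals on \<open>M\<close>, and \<open>R \<alpha> h = \<Sum> h\<^sub>1 \<alpha>(h\<^sub>2c)\<close>.\<close>

locale equivariant_pair =
  M: vector_space sM + N: vector_space sN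
  for sM :: "'k::field \<Rightarrow> 'm::ab_group_add \<Rightarrow> 'm"
    and sN :: "'k \<Rightarrow> 'n::ab_group_add \<Rightarrow> 'n" +
  fixes T :: "'t \<Rightarrow> ('m \<Rightarrow> 'k) \<Rightarrow> 'm \<Rightarrow> 'm"
    and R :: "('m \<Rightarrow> 'k) \<Rightarrow> 'n \<Rightarrow> 'n"
  assumes T_linear: "Vector_Spaces.linear sM (*) \<alpha> \<Longrightarrow> Vector_Spaces.linear sM sM (T t \<alpha>)"
    and R_linear: "Vector_Spaces.linear sM (*) \<alpha> \<Longrightarrow> Vector_Spaces.linear sN sN (R \<alpha>)"
    and T_sum: "\<lbrakk>finite (I :: nat set); \<And>i. i \<in> I \<Longrightarrow> Vector_Spaces.linear sM (*) (\<beta> i)\<rbrakk> \<Longrightarrow>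
      T t (\<lambda>y. \<Sum>i\<in>I. \<beta> i y) x = (\<Sum>i\<in>I. T t (\<beta> i) x)"
    and R_sum: "\<lbrakk>finite (I :: nat set); \<And>i. i \<in> I \<Longrightarrow> Vector_Spaces.linear sM (*) (\<beta> i)\<rbrakk> \<Longrightarrow>
      R (\<lambda>y. \<Sum>i\<in>I. \<beta> i y) h = (\<Sum>i\<in>I. R (\<beta> i) h)"
begin

text \<open>When \<open>T\<close> runs through both actions of the functionals on a coalgebra, a
  finite-dimensional stable subspace is a subcoalgebra.\<close>

definition stable :: "'m set \<Rightarrow> bool" where
  "stable D \<longleftrightarrow> M.subspace D \<and> (\<forall>t \<alpha>. M.functional \<alpha> \<longrightarrow> (\<forall>x\<in>D. T t \<alpha> x \<in> D))"

text \<open>This is \<open>H\<^sub>D\<close> in the application: a tensor lies in H tensor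
  \<open>D\<close> exactly when every functional killing \<open>D\<close>, applied to its second
  factor, yields zero.\<close>

definition coefficients_in :: "'m set \<Rightarrow> 'n set" where
  "coefficients_in D = {h. \<forall>\<alpha>. M.functional \<alpha> \<longrightarrow> (\<forall>x\<in>D. \<alpha> x = 0) \<longrightarrow> R \<alpha> h = 0}"

text \<open>The function to be maximized at the rational level \<open>t / n\<close>, multiplied by
  \<open>n\<close> to keep its values integral.\<close>

definition weight :: "nat \<Rightarrow> nat \<Rightarrow> 'n set \<Rightarrow> 'm set \<Rightarrow> int" where
  "weight n t E D = int n * int (N.dim (E \<inter> coefficients_in D)) - int t * int (M.dim D)"

definition maximizer :: "nat \<Rightarrow> nat \<Rightarrow> 'n set \<Rightarrow> 'm set \<Rightarrow> bool" where
  "maximizer n t E D \<longleftrightarrow> stable D \<and> fin_dim_subspace sM D \<and>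
    (\<forall>D'. stable D' \<and> fin_dim_subspace sM D' \<longrightarrow> weight n t E D' \<le> weight n t E D)"

text \<open>Breaking ties by dimension is what later turns an equality of weights into an inclusion
  of subspaces.\<close>

definition largest_maximizer :: "nat \<Rightarrow> nat \<Rightarrow> 'n set \<Rightarrow> 'm set \<Rightarrow> bool" where
  "largest_maximizer n t E D \<longleftrightarrow> maximizer n t E D \<and>
    (\<forall>D'. maximizer n t E D' \<longrightarrow> M.dim D' \<le> M.dim D)"

lemma vector_space_tuples:
  "vector_space (fun_scale sM :: 'k \<Rightarrow> (nat \<Rightarrow> 'm) \<Rightarrow> _)"
  "vector_space (fun_scale sN :: 'k \<Rightarrow> (nat \<Rightarrow> 'n) \<Rightarrow> _)"
  by (rule M.vector_space_fun_scale, rule N.vector_space_fun_scale)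


lemma functional_compose:
  assumes "M.functional \<alpha>" "Vector_Spaces.linear s sM f"
  shows "Vector_Spaces.linear s (*) (\<lambda>x. \<alpha> (f x))"
  using Vector_Spaces.linear_compose[OF assms(2,1)] by (simp add: comp_def)

lemma coefficients_in_subspace: "N.subspace (coefficients_in D)"
proof (rule N.subspaceI)
  have lin: "R \<alpha> (x + y) = R \<alpha> x + R \<alpha> y" "R \<alpha> (sN c x) = sN c (R \<alpha> x)" "R \<alpha> 0 = 0"
    if "M.functional \<alpha>" for \<alpha> x y c
  proof -
    interpret Vector_Spaces.linear sN sN "R \<alpha>" by (rule R_linear[OF that])
    show "R \<alpha> (x + y) = R \<alpha> x + R \<alpha> y" "R \<alpha> (sN c x) = sN c (R \<alpha> x)" "R \<alpha> 0 = 0"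
      by (simp_all add: add scale)
  qed
  show "0 \<in> coefficients_in D"
    and "\<And>x y. x \<in> coefficients_in D \<Longrightarrow> y \<in> coefficients_in D \<Longrightarrow> x + y \<in> coefficients_in D"
    and "\<And>x c. x \<in> coefficients_in D \<Longrightarrow> sN c x \<in> coefficients_in D"
    by (simp_all add: coefficients_in_def lin)
qed

lemma stable_subspace: "stable D \<Longrightarrow> M.subspace D"
  unfolding stable_def by blast

lemma stable_T: "\<lbrakk>stable D; M.functional \<alpha>; x \<in> D\<rbrakk> \<Longrightarrow> T t \<alpha> x \<in> D"
  unfolding stable_def by blast

lemma T_zero: "M.functional \<alpha> \<Longrightarrow> T t \<alpha> 0 = 0"
proof -
  assume "M.functional \<alpha>"
  then interpret Vector_Spaces.linear sM sM "T t \<alpha>" by (rule T_linear)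
  show ?thesis by simp
qed

lemma R_zero: "M.functional \<alpha> \<Longrightarrow> R \<alpha> 0 = 0"
proof -
  assume "M.functional \<alpha>"
  then interpret Vector_Spaces.linear sN sN "R \<alpha>" by (rule R_linear)
  show ?thesis by simp
qed

lemma R_zero_functional: "R (\<lambda>y. 0) h = 0"
  using R_sum[of "{}"] by simp

lemma R_eq_of_coefficients:
  assumes "M.functional \<alpha>" "M.functional \<beta>" "\<And>x. x \<in> D \<Longrightarrow> \<alpha> x = \<beta> x" "h \<in> coefficients_in D"
  shows "R \<alpha> h = R \<beta> h"
proof -
  \<comment> \<open>Additivity of \<open>R\<close> in the functional is available through
    \<open>R_sum\<close>, so \<alpha> is written as the sum of a two-member family: \<beta> and the
    difference, which kills \<open>D\<close>.\<close>
  define f where "f i = (if i = (0::nat) then \<beta> else (\<lambda>y. \<alpha> y - \<beta> y))" for i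
  have d: "M.functional (\<lambda>y. \<alpha> y - \<beta> y)"
    using assms(1,2) by (simp add: Vector_Spaces.linear_iff algebra_simps)
  have "R (\<lambda>y. \<alpha> y - \<beta> y) h = 0"
    using assms(3,4) d unfolding coefficients_in_def by simp
  moreover have "R (\<lambda>y. \<Sum>i\<in>{0, 1}. f i y) h = (\<Sum>i\<in>{0, 1}. R (f i) h)"
    using d assms(2) by (intro R_sum) (auto simp: f_def)
  ultimately show ?thesis by (simp add: f_def)
qed

text \<open>The operators act entrywise and fix 0, hence preserve the condition of vanishing beyond
  position \<open>i\<close>.\<close>

lemma slice_stable:
  assumes W: "module.subspace (fun_scale sM) W"
    and T: "\<And>w t \<alpha>. w \<in> W \<Longrightarrow> M.functional \<alpha> \<Longrightarrow> (\<lambda>i. T t \<alpha> (w i)) \<in> W"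
  shows "stable (slice W i)"
  unfolding stable_def
proof (intro conjI allI impI ballI)
  show "M.subspace (slice W i)" by (rule M.slice_subspace[OF W])
  fix t \<alpha> x assume a: "M.functional \<alpha>" and "x \<in> slice W i"
  then obtain w where w: "w \<in> W" "x = w i" "\<forall>l>i. w l = 0" unfolding slice_def by blast
  then show "T t \<alpha> x \<in> slice W i" unfolding slice_def
    using T[OF w(1) a, of t] T_zero[OF a] by (intro CollectI exI[of _ "\<lambda>i. T t \<alpha> (w i)"]) auto
qed

text \<open>A functional on tuples that kills \<open>W\<close> and restricts to \<open>\<alpha>\<close> on the tuples ending in position
  \<open>i\<close> exists as soon as \<open>\<alpha>\<close> kills the slice of \<open>W\<close> at \<open>i\<close>.\<close>

lemma slice_coefficients:
  assumes W: "module.subspace (fun_scale sM) W"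
    and Z: "Z \<subseteq> tuples r UNIV" and i: "i < r"
    and vanish: "\<And>\<mu> z. \<lbrakk>Vector_Spaces.linear (fun_scale sM) (*) \<mu>; \<And>w. w \<in> W \<Longrightarrow> \<mu> w = 0; z \<in> Z\<rbrakk> \<Longrightarrow>
      (\<Sum>l<r. R (\<lambda>y. \<mu> (unit_tuple l y)) (z l)) = 0"
  shows "slice Z i \<subseteq> coefficients_in (slice W i)"
proof
  fix h assume "h \<in> slice Z i"
  then obtain z where z: "z \<in> Z" "h = z i" "\<forall>l>i. z l = 0" unfolding slice_def by blast
  interpret F: vector_space "fun_scale sM :: 'k \<Rightarrow> (nat \<Rightarrow> 'm) \<Rightarrow> _" by (rule vector_space_tuples)
  show "h \<in> coefficients_in (slice W i)"
    unfolding coefficients_in_def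
  proof (intro CollectI allI impI)
    fix \<alpha> assume a: "M.functional \<alpha>" and aW: "\<forall>x\<in>slice W i. \<alpha> x = 0"
    interpret a: Vector_Spaces.linear sM "(*)" \<alpha> by (rule a)
    define V where "V = {w :: nat \<Rightarrow> 'm. \<forall>l>i. w l = 0}"
    have id: "Vector_Spaces.linear (fun_scale sM) (fun_scale sM) (\<lambda>w :: nat \<Rightarrow> 'm. w)"
      by (rule linearI) (simp_all add: F.vector_space_axioms)
    have V: "F.subspace V"
      unfolding M.fun_subspace_iff V_def by simp
    have "\<alpha> (v i) = 0" if "v \<in> V" "v \<in> W" for v
      using aW that unfolding V_def slice_def by blast
    then obtain \<mu> where \<mu>: "Vector_Spaces.linear (fun_scale sM) (*) \<mu>" "\<And>w. w \<in> W \<Longrightarrow> \<mu> w = 0"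
      "\<And>v. v \<in> V \<Longrightarrow> \<mu> v = \<alpha> (v i)"
      using functional_factor[OF id functional_compose[OF a M.linear_coordinate[of i]] V W] by blast
    \<comment> \<open>Positions before \<open>i\<close> contribute zero since on \<open>V\<close>
      the functional \<mu> sees coordinate \<open>i\<close> alone; positions after \<open>i\<close>
      contribute zero since \<open>z\<close> vanishes there.\<close>
    have terms: "R (\<lambda>y. \<mu> (unit_tuple l y)) (z l) = (if l = i then R \<alpha> h else 0)" for l
    proof -
      consider "l < i" | "l = i" | "l > i" by linarith
      then show ?thesis
      proof cases
        case 1
        then have "(\<lambda>y. \<mu> (unit_tuple l y)) = (\<lambda>y. 0)"
          using \<mu>(3)[of "unit_tuple l _"] by (auto simp: V_def unit_tuple_def)
        then show ?thesis using 1 R_zero_functional by simp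
      next
        case 2
        then have "(\<lambda>y. \<mu> (unit_tuple l y)) = \<alpha>"
          using \<mu>(3)[of "unit_tuple l _"] by (auto simp: V_def unit_tuple_def)
        then show ?thesis using 2 z by simp
      next
        case 3
        have "M.functional (\<lambda>y. \<mu> (unit_tuple l y))"
          using Vector_Spaces.linear_compose[OF M.linear_unit_tuple \<mu>(1)] by (simp add: comp_def)
        then show ?thesis using 3 z R_zero by simp
      qed
    qed
    have "(\<Sum>l<r. R (\<lambda>y. \<mu> (unit_tuple l y)) (z l)) = R \<alpha> h"
      using i by (simp add: terms)
    then show "R \<alpha> h = 0" using vanish[OF \<mu>(1,2) z(1)] by simp
  qed
qed

text \<open>Both dimensions split over slices, and each slice of \<open>Z\<close> embeds in the
  intersection whose dimension enters the weight of the corresponding slice of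
  \<open>W\<close>.\<close>

lemma weight_slices:
  assumes E: "fin_dim_subspace sN E" and D: "fin_dim_subspace sM D"
    and W: "module.subspace (fun_scale sM) W" "W \<subseteq> tuples r D"
    and Z: "module.subspace (fun_scale sN) Z" "Z \<subseteq> tuples r E"
    and coef: "\<And>i. i < r \<Longrightarrow> slice Z i \<subseteq> coefficients_in (slice W i)"
  shows "int n * int (vector_space.dim (fun_scale sN) Z) - int t * int (vector_space.dim (fun_scale sM) W)
    \<le> (\<Sum>i<r. weight n t E (slice W i))"
proof -
  have "N.dim (slice Z i) \<le> N.dim (E \<inter> coefficients_in (slice W i))" if "i < r" for i
    using slice_tuples_subset[OF Z(2) that] coef[OF that]
    by (intro N.fin_dim_mono N.fin_dim_inter E coefficients_in_subspace N.slice_subspace Z(1)) auto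
  then have "(\<Sum>i<r. N.dim (slice Z i)) \<le> (\<Sum>i<r. N.dim (E \<inter> coefficients_in (slice W i)))"
    by (intro sum_mono) auto
  then have "int n * int (\<Sum>i<r. N.dim (slice Z i)) \<le> int n * int (\<Sum>i<r. N.dim (E \<inter> coefficients_in (slice W i)))"
    by (intro mult_left_mono) (simp_all only: of_nat_le_iff)
  then show ?thesis
    by (simp add: N.dim_slices[OF Z E] M.dim_slices[OF W D] weight_def sum_subtractf sum_distrib_left)
qed

end

text \<open>In the application \<open>G\<close> and \<open>K\<close> are the actions of a matrix
  over the Hopf algebra on M and on H, and \<open>G'\<close>, \<open>K'\<close> those of its image
  under the antipode. The plain and \<open>_opp\<close> laws differ in which matrix factor meets the
  functional; cocommutativity makes both available for both hit actions.\<close>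

locale equivariant_matrix = equivariant_pair sM sN T R
  for sM :: "'k::field \<Rightarrow> 'm::ab_group_add \<Rightarrow> 'm"
    and sN :: "'k \<Rightarrow> 'n::ab_group_add \<Rightarrow> 'n"
    and T :: "'t \<Rightarrow> ('m \<Rightarrow> 'k) \<Rightarrow> 'm \<Rightarrow> 'm"
    and R :: "('m \<Rightarrow> 'k) \<Rightarrow> 'n \<Rightarrow> 'n" +
  fixes r :: nat
    and G G' :: "nat \<Rightarrow> nat \<Rightarrow> 'm \<Rightarrow> 'm"
    and K K' :: "nat \<Rightarrow> nat \<Rightarrow> 'n \<Rightarrow> 'n"
  assumes G_linear: "Vector_Spaces.linear sM sM (G i l)" "Vector_Spaces.linear sM sM (G' i l)"
    and K_linear: "Vector_Spaces.linear sN sN (K i l)" "Vector_Spaces.linear sN sN (K' i l)"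
    and G_inverse: "\<lbrakk>i < r; j < r\<rbrakk> \<Longrightarrow> (\<Sum>l<r. G' i l (G l j x)) = (if i = j then x else 0)"
    and K_inverse: "\<lbrakk>i < r; j < r\<rbrakk> \<Longrightarrow> (\<Sum>l<r. K' i l (K l j h)) = (if i = j then h else 0)"
    and T_equiv: "\<lbrakk>Vector_Spaces.linear sM (*) \<beta>; i < r; l < r\<rbrakk> \<Longrightarrow>
      T t \<beta> (G i l x) = (\<Sum>j<r. G i j (T t (\<lambda>y. \<beta> (G j l y)) x))"
    and T_equiv_opp: "\<lbrakk>Vector_Spaces.linear sM (*) \<beta>; i < r; l < r\<rbrakk> \<Longrightarrow>
      T t \<beta> (G i l x) = (\<Sum>j<r. G j l (T t (\<lambda>y. \<beta> (G i j y)) x))"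
    and R_equiv: "\<lbrakk>Vector_Spaces.linear sM (*) \<beta>; i < r; l < r\<rbrakk> \<Longrightarrow>
      R \<beta> (K i l h) = (\<Sum>j<r. K i j (R (\<lambda>y. \<beta> (G j l y)) h))"
    and R_equiv_opp: "\<lbrakk>Vector_Spaces.linear sM (*) \<beta>; i < r; l < r\<rbrakk> \<Longrightarrow>
      R \<beta> (K i l h) = (\<Sum>j<r. K j l (R (\<lambda>y. \<beta> (G i j y)) h))"
begin

lemma G_hom:
  "G i l (\<Sum>a\<in>A. f a) = (\<Sum>a\<in>A. G i l (f a))" "G' i l (\<Sum>a\<in>A. f a) = (\<Sum>a\<in>A. G' i l (f a))"
  "G i l 0 = 0"
proof -
  interpret a: Vector_Spaces.linear sM sM "G i l" by (rule G_linear)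
  interpret b: Vector_Spaces.linear sM sM "G' i l" by (rule G_linear)
  show "G i l (\<Sum>a\<in>A. f a) = (\<Sum>a\<in>A. G i l (f a))" "G' i l (\<Sum>a\<in>A. f a) = (\<Sum>a\<in>A. G' i l (f a))"
    "G i l 0 = 0"
    by (simp_all add: a.sum b.sum)
qed

lemma K_hom:
  "K i l (\<Sum>a\<in>A. f a) = (\<Sum>a\<in>A. K i l (f a))" "K' i l (\<Sum>a\<in>A. f a) = (\<Sum>a\<in>A. K' i l (f a))"
  "K i l 0 = 0" "K' i l 0 = 0"
proof -
  interpret a: Vector_Spaces.linear sN sN "K i l" by (rule K_linear)
  interpret b: Vector_Spaces.linear sN sN "K' i l" by (rule K_linear)
  show "K i l (\<Sum>a\<in>A. f a) = (\<Sum>a\<in>A. K i l (f a))" "K' i l (\<Sum>a\<in>A. f a) = (\<Sum>a\<in>A. K' i l (f a))"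
    "K i l 0 = 0" "K' i l 0 = 0"
    by (simp_all add: a.sum b.sum)
qed

lemma T_matrix_map:
  assumes "M.functional \<beta>" "i < r"
  shows "T t \<beta> (matrix_map r G \<phi> i) = (\<Sum>l<r. T t \<beta> (G i l (\<phi> l)))"
proof -
  interpret Vector_Spaces.linear sM sM "T t \<beta>" by (rule T_linear[OF assms(1)])
  show ?thesis using assms by (simp add: matrix_map_def sum)
qed

lemma R_matrix_map:
  assumes "M.functional \<beta>" "i < r"
  shows "R \<beta> (matrix_map r K \<psi> i) = (\<Sum>l<r. R \<beta> (K i l (\<psi> l)))"
proof -
  interpret Vector_Spaces.linear sN sN "R \<beta>" by (rule R_linear[OF assms(1)])
  show ?thesis using assms by (simp add: matrix_map_def sum)
qed

text \<open>By \<open>T_equiv\<close> the operator passes inside the matrix, at the price of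
  composing \<beta> with matrix entries. The result is again an image under the matrix.\<close>

lemma T_image:
  assumes b: "M.functional \<beta>"
  shows "(\<lambda>i. T t \<beta> (matrix_map r G \<phi> i)) =
    matrix_map r G (\<lambda>j. if j < r then \<Sum>l<r. T t (\<lambda>y. \<beta> (G j l y)) (\<phi> l) else 0)"
proof
  fix i
  show "T t \<beta> (matrix_map r G \<phi> i) =
    matrix_map r G (\<lambda>j. if j < r then \<Sum>l<r. T t (\<lambda>y. \<beta> (G j l y)) (\<phi> l) else 0) i"
  proof (cases "i < r")
    case True
    have "T t \<beta> (matrix_map r G \<phi> i) = (\<Sum>l<r. \<Sum>j<r. G i j (T t (\<lambda>y. \<beta> (G j l y)) (\<phi> l)))"
      using T_matrix_map[OF b True] T_equiv[OF b True] by simp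
    also have "\<dots> = (\<Sum>j<r. G i j (\<Sum>l<r. T t (\<lambda>y. \<beta> (G j l y)) (\<phi> l)))"
      by (subst sum.swap) (simp add: G_hom)
    finally show ?thesis using True by (simp add: matrix_map_def)
  next
    case False
    then show ?thesis using T_zero[OF b] by (simp add: matrix_map_def)
  qed
qed

text \<open>Apply \<open>T_equiv_opp\<close> to the functionals obtained from \<alpha> by
  composition with \<open>G' k i\<close>. Summation over \<open>i\<close> cancels \<open>G'\<close>
  against \<open>G\<close> inside the functional, so the operator on \<phi> is expressed through
  operators on the image of \<phi>.\<close>

lemma T_preimage:
  assumes a: "M.functional \<alpha>" and k: "k < r"
  shows "(\<Sum>l<r. G k l (T t \<alpha> (\<phi> l))) = (\<Sum>i<r. T t (\<lambda>y. \<alpha> (G' k i y)) (matrix_map r G \<phi> i))"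
proof -
  interpret a: Vector_Spaces.linear sM "(*)" \<alpha> by (rule a)
  have ag: "M.functional (\<lambda>y. \<alpha> (G' k i y))" for i by (rule functional_compose[OF a G_linear(2)])
  have agg: "M.functional (\<lambda>y. \<alpha> (G' k i (G i j y)))" for i j
    by (rule functional_compose[OF ag G_linear(1)])
  have T0: "T t (\<lambda>y. 0) x = 0" for x using T_sum[of "{}"] by simp
  have inner: "(\<Sum>i<r. T t (\<lambda>y. \<alpha> (G' k i (G i j y))) (\<phi> l)) = (if j = k then T t \<alpha> (\<phi> l) else 0)"
    if "j < r" for j l
  proof -
    have "(\<Sum>i<r. T t (\<lambda>y. \<alpha> (G' k i (G i j y))) (\<phi> l)) =
        T t (\<lambda>y. \<Sum>i<r. \<alpha> (G' k i (G i j y))) (\<phi> l)"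
      by (rule T_sum[symmetric]) (auto intro: agg)
    also have "(\<lambda>y. \<Sum>i<r. \<alpha> (G' k i (G i j y))) = (\<lambda>y. if j = k then \<alpha> y else 0)"
      using G_inverse[OF k that] by (auto simp: a.sum[symmetric])
    finally show ?thesis using T0 by auto
  qed
  have "(\<Sum>i<r. T t (\<lambda>y. \<alpha> (G' k i y)) (matrix_map r G \<phi> i)) =
      (\<Sum>i<r. \<Sum>l<r. \<Sum>j<r. G j l (T t (\<lambda>y. \<alpha> (G' k i (G i j y))) (\<phi> l)))"
    using T_matrix_map[OF ag] T_equiv_opp[OF ag] by simp
  also have "\<dots> = (\<Sum>l<r. \<Sum>j<r. \<Sum>i<r. G j l (T t (\<lambda>y. \<alpha> (G' k i (G i j y))) (\<phi> l)))"
    by (subst sum.swap, rule sum.cong[OF refl], rule sum.swap)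
  also have "\<dots> = (\<Sum>l<r. \<Sum>j<r. G j l (if j = k then T t \<alpha> (\<phi> l) else 0))"
    using inner by (intro sum.cong refl) (simp add: G_hom(1)[symmetric])
  also have "\<dots> = (\<Sum>l<r. \<Sum>j<r. if j = k then G k l (T t \<alpha> (\<phi> l)) else 0)"
    by (intro sum.cong refl) (simp add: G_hom)
  also have "\<dots> = (\<Sum>l<r. G k l (T t \<alpha> (\<phi> l)))"
    using k by simp
  finally show ?thesis by simp
qed

text \<open>Here the cancellation happens outside the functional: \<open>R_equiv\<close> produces
  \<open>K i j\<close> in front, and summing against \<open>K' k i\<close> over \<open>i\<close>
  removes it.\<close>

lemma R_preimage:
  assumes b: "M.functional \<beta>" and k: "k < r"
  shows "(\<Sum>l<r. R (\<lambda>y. \<beta> (G k l y)) (\<psi> l)) = (\<Sum>i<r. K' k i (R \<beta> (matrix_map r K \<psi> i)))"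
proof -
  have "(\<Sum>i<r. K' k i (R \<beta> (matrix_map r K \<psi> i))) =
      (\<Sum>i<r. \<Sum>l<r. \<Sum>j<r. K' k i (K i j (R (\<lambda>y. \<beta> (G j l y)) (\<psi> l))))"
    using R_matrix_map[OF b] R_equiv[OF b] by (simp add: K_hom)
  also have "\<dots> = (\<Sum>l<r. \<Sum>j<r. \<Sum>i<r. K' k i (K i j (R (\<lambda>y. \<beta> (G j l y)) (\<psi> l))))"
    by (subst sum.swap, rule sum.cong[OF refl], rule sum.swap)
  also have "\<dots> = (\<Sum>l<r. \<Sum>j<r. if k = j then R (\<lambda>y. \<beta> (G j l y)) (\<psi> l) else 0)"
    using K_inverse[OF k] by (intro sum.cong refl) simp
  also have "\<dots> = (\<Sum>l<r. R (\<lambda>y. \<beta> (G k l y)) (\<psi> l))"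
    using k by simp
  finally show ?thesis by simp
qed

lemma matrix_map_unit_tuple:
  assumes "l < r"
  shows "matrix_map r G (unit_tuple l y) = (\<Sum>k<r. unit_tuple k (G k l y))"
proof -
  have "matrix_map r G (unit_tuple l y) k = (if k < r then G k l y else 0)" for k
  proof -
    have "(\<Sum>j<r. G k j (if j = l then y else 0)) = (\<Sum>j<r. if j = l then G k l y else 0)"
      by (intro sum.cong refl) (simp add: G_hom)
    then show ?thesis using assms by (simp add: matrix_map_def unit_tuple_def)
  qed
  then have "matrix_map r G (unit_tuple l y) = (\<lambda>k. if k < r then G k l y else 0)" by auto
  also have "\<dots> = (\<Sum>k<r. unit_tuple k ((\<lambda>k. if k < r then G k l y else 0) k))"
    by (rule M.tuple_expand[where D = UNIV]) (simp add: tuples_def)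
  finally show ?thesis by simp
qed

lemma functional_unit_tuple:
  "Vector_Spaces.linear (fun_scale sM) (*) \<mu> \<Longrightarrow> M.functional (\<lambda>y. \<mu> (unit_tuple l y))"
  using Vector_Spaces.linear_compose[OF M.linear_unit_tuple] by (simp add: comp_def)

text \<open>With \<open>R_equiv_opp\<close> the matrix is moved from \<psi> onto the functional.
  Summing over \<open>l\<close> reassembles the pullback of \<mu> along
  \<open>matrix_map r G\<close>.\<close>

lemma R_image:
  assumes \<mu>: "Vector_Spaces.linear (fun_scale sM) (*) \<mu>"
  shows "(\<Sum>l<r. R (\<lambda>y. \<mu> (unit_tuple l y)) (matrix_map r K \<psi> l)) =
    (\<Sum>j<r. \<Sum>q<r. K q j (R (\<lambda>y. \<mu> (matrix_map r G (unit_tuple q y))) (\<psi> j)))"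
proof -
  interpret m: Vector_Spaces.linear "fun_scale sM" "(*)" \<mu> by (rule \<mu>)
  note f = functional_unit_tuple[OF \<mu>]
  have "(\<Sum>l<r. R (\<lambda>y. \<mu> (unit_tuple l y)) (matrix_map r K \<psi> l)) =
      (\<Sum>l<r. \<Sum>j<r. \<Sum>q<r. K q j (R (\<lambda>y. \<mu> (unit_tuple l (G l q y))) (\<psi> j)))"
    using R_matrix_map[OF f] R_equiv_opp[OF f] by simp
  also have "\<dots> = (\<Sum>j<r. \<Sum>q<r. \<Sum>l<r. K q j (R (\<lambda>y. \<mu> (unit_tuple l (G l q y))) (\<psi> j)))"
    by (subst sum.swap, rule sum.cong[OF refl], rule sum.swap)
  also have "\<dots> = (\<Sum>j<r. \<Sum>q<r. K q j (R (\<lambda>y. \<Sum>l<r. \<mu> (unit_tuple l (G l q y))) (\<psi> j)))"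
    using functional_compose[OF f G_linear(1)]
    by (intro sum.cong refl) (simp add: K_hom(1)[symmetric] R_sum)
  also have "\<dots> = (\<Sum>j<r. \<Sum>q<r. K q j (R (\<lambda>y. \<mu> (matrix_map r G (unit_tuple q y))) (\<psi> j)))"
    by (intro sum.cong refl) (simp add: matrix_map_unit_tuple m.sum)
  finally show ?thesis .
qed

end

section \<open>Pulling back and pushing forward along the matrix; comparison of maximizers\<close>

context equivariant_matrix
begin

text \<open>On tuples over \<open>D\<close>, \<mu> factors through the matrix as a functional \<nu>
  killing the tuples over \<open>P\<close>. \<open>R_preimage\<close> then rewrites the sum in terms
  of components of \<nu> applied to entries of \<open>matrix_map r K \<psi>\<close>, which lie in
  \<open>coefficients_in P\<close>.\<close>

lemma preimage_coefficients:
  assumes D: "stable D" and P: "stable P"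
    and \<psi>: "\<And>l. l < r \<Longrightarrow> \<psi> l \<in> coefficients_in D"
      "\<And>i. i < r \<Longrightarrow> matrix_map r K \<psi> i \<in> coefficients_in P"
    and \<mu>: "Vector_Spaces.linear (fun_scale sM) (*) \<mu>"
      "\<And>\<phi>. \<phi> \<in> tuples r D \<Longrightarrow> matrix_map r G \<phi> \<in> tuples r P \<Longrightarrow> \<mu> \<phi> = 0"
  shows "(\<Sum>l<r. R (\<lambda>y. \<mu> (unit_tuple l y)) (\<psi> l)) = 0"
proof -
  obtain \<nu> where \<nu>: "Vector_Spaces.linear (fun_scale sM) (*) \<nu>"
    "\<And>p. p \<in> tuples r P \<Longrightarrow> \<nu> p = 0"
    "\<And>\<phi>. \<phi> \<in> tuples r D \<Longrightarrow> \<nu> (matrix_map r G \<phi>) = \<mu> \<phi>"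
    using functional_factor[OF M.linear_matrix_map[of G r, OF G_linear(1)] \<mu>(1)
      M.tuples_subspace[OF stable_subspace[OF D], of r] M.tuples_subspace[OF stable_subspace[OF P], of r] \<mu>(2)]
    by blast
  interpret v: Vector_Spaces.linear "fun_scale sM" "(*)" \<nu> by (rule \<nu>(1))
  define f where "f k = (\<lambda>y. \<nu> (unit_tuple k y))" for k
  have f: "M.functional (f k)" for k unfolding f_def by (rule functional_unit_tuple[OF \<nu>(1)])
  have fG: "M.functional (\<lambda>y. f k (G k l y))" for k l by (rule functional_compose[OF f G_linear(1)])
  have fP: "f k p = 0" if "k < r" "p \<in> P" for k p
    unfolding f_def using that stable_subspace[OF P]
    by (intro \<nu>(2)) (auto simp: tuples_def unit_tuple_def M.subspace_0)
  have sumf: "M.functional (\<lambda>y. \<Sum>k<r. f k (G k l y))" for l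
    using fG by (auto simp: Vector_Spaces.linear_iff sum.distrib sum_distrib_left)
  have "R (\<lambda>y. \<mu> (unit_tuple l y)) (\<psi> l) = (\<Sum>k<r. R (\<lambda>y. f k (G k l y)) (\<psi> l))" if l: "l < r" for l
  proof -
    \<comment> \<open>The two functionals agree on \<open>D\<close>, and this suffices because
      \<open>\<psi> l\<close> has its coefficients in \<open>D\<close>.\<close>
    have "R (\<lambda>y. \<mu> (unit_tuple l y)) (\<psi> l) = R (\<lambda>y. \<Sum>k<r. f k (G k l y)) (\<psi> l)"
    proof (rule R_eq_of_coefficients[OF functional_unit_tuple[OF \<mu>(1)] sumf _ \<psi>(1)[OF l]])
      fix x assume "x \<in> D"
      then have "unit_tuple l x \<in> tuples r D"
        using l stable_subspace[OF D] by (auto simp: tuples_def unit_tuple_def M.subspace_0)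
      then show "\<mu> (unit_tuple l x) = (\<Sum>k<r. f k (G k l x))"
        using \<nu>(3)[of "unit_tuple l x"] by (simp add: matrix_map_unit_tuple[OF l] v.sum f_def)
    qed
    then show ?thesis using fG by (simp add: R_sum)
  qed
  then have "(\<Sum>l<r. R (\<lambda>y. \<mu> (unit_tuple l y)) (\<psi> l)) = (\<Sum>l<r. \<Sum>k<r. R (\<lambda>y. f k (G k l y)) (\<psi> l))"
    by simp
  also have "\<dots> = (\<Sum>k<r. \<Sum>l<r. R (\<lambda>y. f k (G k l y)) (\<psi> l))" by (rule sum.swap)
  also have "\<dots> = (\<Sum>k<r. \<Sum>i<r. K' k i (R (f k) (matrix_map r K \<psi> i)))"
    using R_preimage[OF f] by simp
  also have "\<dots> = 0"
  proof -
    have "R (f k) (matrix_map r K \<psi> i) = 0" if "k < r" "i < r" for k i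
      using \<psi>(2)[OF that(2)] f fP[OF that(1)] unfolding coefficients_in_def by simp
    then show ?thesis by (simp add: K_hom)
  qed
  finally show ?thesis .
qed

text \<open>After \<open>R_image\<close>, every functional that occurs is a component of the
  pullback of \<mu>, and these components kill \<open>D\<close>.\<close>

lemma image_coefficients:
  assumes D: "stable D"
    and \<psi>: "\<And>l. l < r \<Longrightarrow> \<psi> l \<in> coefficients_in D"
    and \<mu>: "Vector_Spaces.linear (fun_scale sM) (*) \<mu>"
      "\<And>\<phi>. \<phi> \<in> tuples r D \<Longrightarrow> \<mu> (matrix_map r G \<phi>) = 0"
  shows "(\<Sum>l<r. R (\<lambda>y. \<mu> (unit_tuple l y)) (matrix_map r K \<psi> l)) = 0"
proof -
  have "R (\<lambda>y. \<mu> (matrix_map r G (unit_tuple q y))) (\<psi> j) = 0" if "q < r" "j < r" for q j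
  proof -
    have "M.functional (\<lambda>y. \<mu> (matrix_map r G (unit_tuple q y)))"
      using Vector_Spaces.linear_compose[OF M.linear_unit_tuple
        Vector_Spaces.linear_compose[OF M.linear_matrix_map[of G r, OF G_linear(1)] \<mu>(1)]]
      by (simp add: comp_def)
    moreover have "\<mu> (matrix_map r G (unit_tuple q y)) = 0" if "y \<in> D" for y
      using \<open>q < r\<close> that stable_subspace[OF D]
      by (intro \<mu>(2)) (auto simp: tuples_def unit_tuple_def M.subspace_0)
    ultimately show ?thesis using \<psi>[OF that(2)] unfolding coefficients_in_def by simp
  qed
  then show ?thesis by (simp add: R_image[OF \<mu>(1)] K_hom)
qed

text \<open>By \<open>T_preimage\<close>, the entries of the new image are sums of operators applied
  to entries of the old image, which lie in the stable subspace \<open>P\<close>.\<close>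

lemma preimage_stable:
  assumes D: "stable D" and P: "stable P" and \<phi>: "\<phi> \<in> tuples r D" "matrix_map r G \<phi> \<in> tuples r P"
    and a: "M.functional \<alpha>"
  shows "(\<lambda>i. T t \<alpha> (\<phi> i)) \<in> tuples r D" "matrix_map r G (\<lambda>i. T t \<alpha> (\<phi> i)) \<in> tuples r P"
proof -
  show "(\<lambda>i. T t \<alpha> (\<phi> i)) \<in> tuples r D"
    using \<phi>(1) stable_T[OF D a] T_zero[OF a] by (auto simp: tuples_def)
  have "(\<Sum>l<r. G k l (T t \<alpha> (\<phi> l))) \<in> P" if k: "k < r" for k
    unfolding T_preimage[OF a k]
    using \<phi>(2) functional_compose[OF a G_linear(2)]
    by (intro M.subspace_sum stable_subspace[OF P] stable_T[OF P]) (auto simp: tuples_def)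
  then show "matrix_map r G (\<lambda>i. T t \<alpha> (\<phi> i)) \<in> tuples r P"
    by (auto simp: tuples_def matrix_map_def)
qed

lemma image_stable:
  assumes D: "stable D" and \<phi>: "\<phi> \<in> tuples r D" and a: "M.functional \<alpha>"
  shows "(\<lambda>i. T t \<alpha> (matrix_map r G \<phi> i)) \<in> matrix_map r G ` tuples r D"
  unfolding T_image[OF a]
proof (rule imageI)
  have "(\<Sum>l<r. T t (\<lambda>y. \<alpha> (G j l y)) (\<phi> l)) \<in> D" for j
    using \<phi> functional_compose[OF a G_linear(1)]
    by (intro M.subspace_sum stable_subspace[OF D] stable_T[OF D]) (auto simp: tuples_def)
  then show "(\<lambda>j. if j < r then \<Sum>l<r. T t (\<lambda>y. \<alpha> (G j l y)) (\<phi> l) else 0) \<in> tuples r D"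
    by (auto simp: tuples_def)
qed

text \<open>The tuples over \<open>D\<close> that the matrix maps into \<open>P\<close> have slices of weight at most that of \<open>D\<close>,
  and the tuples over \<open>P\<close> together with the image of those over \<open>D\<close> have slices of weight at most
  that of \<open>P\<close>. As dimensions on both sides add up, all of these bounds are attained.\<close>

lemma matrix_maps_maximizer:
  assumes E: "fin_dim_subspace sN E" and E': "fin_dim_subspace sN E'"
    and KE: "\<And>i l h. i < r \<Longrightarrow> l < r \<Longrightarrow> h \<in> E \<Longrightarrow> K i l h \<in> E'"
    and D: "maximizer n t E D" and P: "largest_maximizer n t E' P"
    and il: "i < r" "l < r" and x: "x \<in> D"
  shows "G i l x \<in> P"
proof -
  interpret FM: vector_space "fun_scale sM :: 'k \<Rightarrow> (nat \<Rightarrow> 'm) \<Rightarrow> _" by (rule vector_space_tuples)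
  interpret FN: vector_space "fun_scale sN :: 'k \<Rightarrow> (nat \<Rightarrow> 'n) \<Rightarrow> _" by (rule vector_space_tuples)
  let ?g = "matrix_map r G" and ?k = "matrix_map r K"
  have sD: "stable D" and fD: "fin_dim_subspace sM D" and sP: "stable P" and fP: "fin_dim_subspace sM P"
    using D P unfolding largest_maximizer_def maximizer_def by auto
  have lg: "Vector_Spaces.linear (fun_scale sM) (fun_scale sM) ?g" by (rule M.linear_matrix_map[OF G_linear(1)])
  have lk: "Vector_Spaces.linear (fun_scale sN) (fun_scale sN) ?k" by (rule N.linear_matrix_map[OF K_linear(1)])
  define ED where "ED = E \<inter> coefficients_in D"
  define EP where "EP = E' \<inter> coefficients_in P"
  have fED: "fin_dim_subspace sN ED" and fEP: "fin_dim_subspace sN EP"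
    unfolding ED_def EP_def by (intro N.fin_dim_inter E E' coefficients_in_subspace)+
  note TD = M.tuples_fin_dim[OF fD, of r] and TP = M.tuples_fin_dim[OF fP, of r]
  note TED = N.tuples_fin_dim[OF fED, of r] and TEP = N.tuples_fin_dim[OF fEP, of r]
  \<comment> \<open>\<open>W\<close> and \<open>Y\<close> act as intersection and sum in a modular
    law transported along the matrix; \<open>Z\<close> and \<open>X\<close> are their counterparts
    on the side of H. The two dimension formulas below are instances of
    \<open>dim_image_plus_preimage\<close>.\<close>
  define W where "W = {\<phi> \<in> tuples r D. ?g \<phi> \<in> tuples r P}"
  define Z where "Z = {\<psi> \<in> tuples r ED. ?k \<psi> \<in> tuples r EP}"
  define Y where "Y = subspace_sum (tuples r P) (?g ` tuples r D)"
  define X where "X = subspace_sum (tuples r EP) (?k ` tuples r ED)"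
  have dimY: "FM.dim Y + FM.dim W = r * M.dim P + r * M.dim D"
    unfolding Y_def W_def dim_image_plus_preimage[OF lg TD TP] by (simp add: M.dim_tuples fD fP)
  have dimX: "FN.dim X + FN.dim Z = r * N.dim EP + r * N.dim ED"
    unfolding X_def Z_def dim_image_plus_preimage[OF lk TED TEP] by (simp add: N.dim_tuples fED fEP)
  interpret g: Vector_Spaces.linear "fun_scale sM" "fun_scale sM" ?g by (rule lg)
  interpret k: Vector_Spaces.linear "fun_scale sN" "fun_scale sN" ?k by (rule lk)
  have sW: "FM.subspace W"
    unfolding W_def
    using FM.subspace_inter[OF FM.fin_dim_subspace_imp_subspace[OF TD]
        g.subspace_linear_preimage[OF FM.fin_dim_subspace_imp_subspace[OF TP]]]
    by (simp add: Int_def)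
  have sZ: "FN.subspace Z"
    unfolding Z_def
    using FN.subspace_inter[OF FN.fin_dim_subspace_imp_subspace[OF TED]
        k.subspace_linear_preimage[OF FN.fin_dim_subspace_imp_subspace[OF TEP]]]
    by (simp add: Int_def)
  have fY: "fin_dim_subspace (fun_scale sM) Y"
    unfolding Y_def by (rule FM.fin_dim_sum[OF TP fin_dim_image[OF lg TD]])
  have fX: "fin_dim_subspace (fun_scale sN) X"
    unfolding X_def by (rule FN.fin_dim_sum[OF TEP fin_dim_image[OF lk TED]])
  have sY: "FM.subspace Y" and sX: "FN.subspace X"
    using fY fX FM.fin_dim_subspace_imp_subspace FN.fin_dim_subspace_imp_subspace by auto
  have WD: "W \<subseteq> tuples r D" and ZE: "Z \<subseteq> tuples r E" unfolding W_def Z_def ED_def by (auto simp: tuples_def)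
  have sE': "N.subspace E'" by (rule N.fin_dim_subspace_imp_subspace[OF E'])
  have "?k \<psi> \<in> tuples r E'" if "\<psi> \<in> tuples r ED" for \<psi>
    using that KE unfolding tuples_def matrix_map_def ED_def
    by (auto intro!: N.subspace_sum[OF sE'])
  moreover have "tuples r EP \<subseteq> tuples r E'" unfolding EP_def tuples_def by auto
  ultimately have XE: "X \<subseteq> tuples r E'"
    unfolding X_def subspace_sum_def using FN.subspace_add[OF N.tuples_subspace[OF sE', of r]] by blast
  have Z0: "Z \<subseteq> tuples r UNIV" and X0: "X \<subseteq> tuples r UNIV"
    using ZE XE unfolding tuples_def by auto
  have slW: "weight n t E (slice W j) \<le> weight n t E D" if "j < r" for j
  proof -
    have "stable (slice W j)"
      using preimage_stable[OF sD sP] unfolding W_def[symmetric]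
      by (intro slice_stable sW) (auto simp: W_def)
    moreover have "fin_dim_subspace sM (slice W j)"
      by (rule M.fin_dim_subspace_subset[OF fD M.slice_subspace[OF sW] slice_tuples_subset[OF WD that]])
    ultimately show ?thesis using D unfolding maximizer_def by blast
  qed
  have "slice Z j \<subseteq> coefficients_in (slice W j)" if j: "j < r" for j
  proof (rule slice_coefficients[OF sW Z0 j])
    fix \<mu> z assume "Vector_Spaces.linear (fun_scale sM) (*) \<mu>" "\<And>w. w \<in> W \<Longrightarrow> \<mu> w = 0" "z \<in> Z"
    then show "(\<Sum>l<r. R (\<lambda>y. \<mu> (unit_tuple l y)) (z l)) = 0"
      by (intro preimage_coefficients[OF sD sP]) (auto simp: Z_def W_def tuples_def ED_def EP_def)
  qed
  then have "int n * int (FN.dim Z) - int t * int (FM.dim W) \<le> (\<Sum>j<r. weight n t E (slice W j))"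
    by (rule weight_slices[OF E fD sW WD sZ ZE])
  also have "\<dots> \<le> (\<Sum>j<r. weight n t E D)" using slW by (intro sum_mono) auto
  finally have low: "int n * int (FN.dim Z) - int t * int (FM.dim W) \<le> int r * weight n t E D" by simp
  \<comment> \<open>Splitting the dimension of \<open>Y\<close> into slices requires a
    finite-dimensional subspace containing all entries; \<open>Q\<close> is spanned by the entries
    of a finite spanning set of \<open>Y\<close>.\<close>
  have span_fin: "\<exists>Q. fin_dim_subspace sM Q \<and> Y \<subseteq> tuples r Q"
  proof -
    obtain B where B: "finite B" "Y = FM.span B" using fY unfolding fin_dim_subspace_def by blast
    define Q where "Q = M.span (\<Union>b\<in>B. b ` {..<r})"
    have "Y \<subseteq> tuples r UNIV"
      unfolding Y_def subspace_sum_def by (auto simp: tuples_def matrix_map_def plus_fun_def)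
    then have "B \<subseteq> tuples r Q"
      unfolding Q_def using FM.span_superset[of B] B by (auto simp: tuples_def intro!: M.span_base)
    then have "Y \<subseteq> tuples r Q" unfolding B(2)
      by (rule FM.span_minimal) (simp add: M.tuples_subspace Q_def)
    moreover have "fin_dim_subspace sM Q"
      unfolding Q_def fin_dim_subspace_def
      by (rule exI[of _ "\<Union>b\<in>B. b ` {..<r}"]) (simp add: B(1))
    ultimately show ?thesis by blast
  qed
  then obtain Q where fQ: "fin_dim_subspace sM Q" and YQ: "Y \<subseteq> tuples r Q" by blast
  have slYmax: "stable (slice Y j) \<and> fin_dim_subspace sM (slice Y j)" if "j < r" for j
  proof
    show "stable (slice Y j)"
    proof (rule slice_stable[OF sY])
      fix w t' \<alpha> assume "w \<in> Y" and a: "M.functional \<alpha>"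
      then obtain p \<phi> where p: "p \<in> tuples r P" "\<phi> \<in> tuples r D" "w = p + ?g \<phi>"
        unfolding Y_def subspace_sum_def by auto
      interpret t: Vector_Spaces.linear sM sM "T t' \<alpha>" by (rule T_linear[OF a])
      have "(\<lambda>i. T t' \<alpha> (w i)) = (\<lambda>i. T t' \<alpha> (p i)) + (\<lambda>i. T t' \<alpha> (?g \<phi> i))"
        by (auto simp: p t.add plus_fun_def)
      moreover have "(\<lambda>i. T t' \<alpha> (p i)) \<in> tuples r P"
        using p(1) stable_T[OF sP a] by (auto simp: tuples_def)
      ultimately show "(\<lambda>i. T t' \<alpha> (w i)) \<in> Y"
        using image_stable[OF sD p(2) a] unfolding Y_def subspace_sum_def by blast
    qed
    show "fin_dim_subspace sM (slice Y j)"
      by (rule M.fin_dim_subspace_subset[OF fQ M.slice_subspace[OF sY] slice_tuples_subset[OF YQ that]])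
  qed
  have slY: "weight n t E' (slice Y j) \<le> weight n t E' P" if "j < r" for j
    using slYmax[OF that] P unfolding largest_maximizer_def maximizer_def by blast
  have PY: "tuples r P \<subseteq> Y"
  proof
    fix p assume "p \<in> tuples r P"
    moreover have "0 \<in> tuples r D" using stable_subspace[OF sD] M.subspace_0 by (auto simp: tuples_def)
    ultimately have "p + ?g 0 \<in> Y" unfolding Y_def subspace_sum_def by blast
    then show "p \<in> Y" by simp
  qed
  have gY: "?g ` tuples r D \<subseteq> Y"
  proof
    fix p assume "p \<in> ?g ` tuples r D"
    moreover have "0 \<in> tuples r P" using stable_subspace[OF sP] M.subspace_0 by (auto simp: tuples_def)
    ultimately have "0 + p \<in> Y" unfolding Y_def subspace_sum_def by blast
    then show "p \<in> Y" by simp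
  qed
  \<comment> \<open>A functional killing \<open>Y\<close> kills the tuples over \<open>P\<close> as
    well as the image of those over \<open>D\<close>. Accordingly the two summands of an element of
    \<open>X\<close> are treated separately.\<close>
  have "slice X j \<subseteq> coefficients_in (slice Y j)" if j: "j < r" for j
  proof (rule slice_coefficients[OF sY X0 j])
    fix \<mu> z assume \<mu>: "Vector_Spaces.linear (fun_scale sM) (*) \<mu>" "\<And>w. w \<in> Y \<Longrightarrow> \<mu> w = 0" and "z \<in> X"
    then obtain e \<psi> where z: "e \<in> tuples r EP" "\<psi> \<in> tuples r ED" "z = e + ?k \<psi>"
      unfolding X_def subspace_sum_def by auto
    have f: "M.functional (\<lambda>y. \<mu> (unit_tuple l y))" for l by (rule functional_unit_tuple[OF \<mu>(1)])
    have Rz: "R (\<lambda>y. \<mu> (unit_tuple l y)) (z l) = R (\<lambda>y. \<mu> (unit_tuple l y)) (?k \<psi> l)" if "l < r" for l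
    proof -
      interpret Rl: Vector_Spaces.linear sN sN "R (\<lambda>y. \<mu> (unit_tuple l y))" by (rule R_linear[OF f])
      have "\<mu> (unit_tuple l x) = 0" if "x \<in> P" for x
        using \<open>l < r\<close> that stable_subspace[OF sP] PY
        by (intro \<mu>(2) subsetD[OF PY]) (auto simp: tuples_def unit_tuple_def M.subspace_0)
      then have "R (\<lambda>y. \<mu> (unit_tuple l y)) (e l) = 0"
        using z(1) f that unfolding tuples_def EP_def coefficients_in_def by simp
      then show ?thesis by (simp add: z(3) Rl.add plus_fun_def)
    qed
    have "(\<Sum>l<r. R (\<lambda>y. \<mu> (unit_tuple l y)) (?k \<psi> l)) = 0"
      using z(2) gY \<mu> by (intro image_coefficients[OF sD]) (auto simp: tuples_def ED_def)
    then show "(\<Sum>l<r. R (\<lambda>y. \<mu> (unit_tuple l y)) (z l)) = 0" using Rz by simp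
  qed
  then have up: "int n * int (FN.dim X) - int t * int (FM.dim Y) \<le> (\<Sum>j<r. weight n t E' (slice Y j))"
    by (rule weight_slices[OF E' fQ sY YQ sX XE])
  have dimY': "int (FM.dim Y) = int r * int (M.dim P) + int r * int (M.dim D) - int (FM.dim W)"
    using dimY by (metis add_diff_cancel_right' of_nat_add of_nat_mult)
  have dimX': "int (FN.dim X) = int r * int (N.dim EP) + int r * int (N.dim ED) - int (FN.dim Z)"
    using dimX by (metis add_diff_cancel_right' of_nat_add of_nat_mult)
  \<comment> \<open>The combined weights of the pairs (\<open>X\<close>, \<open>Y\<close>) and
    (\<open>Z\<close>, \<open>W\<close>) sum to \<open>r\<close> times the weights of
    \<open>P\<close> and \<open>D\<close> together. The upper bound for the second pair becomes a
    lower bound for the first.\<close>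
  have "int n * int (FN.dim X) - int t * int (FM.dim Y) =
      int r * weight n t E' P + int r * weight n t E D - (int n * int (FN.dim Z) - int t * int (FM.dim W))"
    unfolding dimX' dimY' weight_def ED_def[symmetric] EP_def[symmetric] by (simp add: algebra_simps)
  then have "(\<Sum>j<r. weight n t E' P) \<le> (\<Sum>j<r. weight n t E' (slice Y j))" using low up by simp
  \<comment> \<open>Each slice weighs at most as much as \<open>P\<close>, while the total is at
    least \<open>r\<close> times the weight of \<open>P\<close>; so equality holds slice by
    slice.\<close>
  then have "weight n t E' (slice Y j) = weight n t E' P" if "j < r" for j
    using slY sum_mono_inv[of "\<lambda>j. weight n t E' (slice Y j)" "{..<r}" "\<lambda>j. weight n t E' P" j] that
      sum_mono[of "{..<r}" "\<lambda>j. weight n t E' (slice Y j)" "\<lambda>j. weight n t E' P"]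
    by (simp add: order_antisym)
  then have "maximizer n t E' (slice Y j)" if "j < r" for j
    using slYmax P that unfolding largest_maximizer_def maximizer_def by simp
  \<comment> \<open>The largest dimension of \<open>P\<close> among maximizers enters here. It gives
    \<open>Y\<close> no more room than the tuples over \<open>P\<close>, so the two
    coincide.\<close>
  then have "M.dim (slice Y j) \<le> M.dim P" if "j < r" for j
    using P that unfolding largest_maximizer_def by blast
  then have "FM.dim Y \<le> (\<Sum>j<r. M.dim P)"
    unfolding M.dim_slices[OF sY YQ fQ] by (intro sum_mono) auto
  then have "FM.dim Y \<le> FM.dim (tuples r P)" by (simp add: M.dim_tuples[OF fP])
  then have "tuples r P = Y"
    by (intro FM.fin_dim_eqI fY PY M.tuples_subspace stable_subspace[OF sP])
  moreover have "unit_tuple l x \<in> tuples r D"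
    using x il stable_subspace[OF sD] by (auto simp: tuples_def unit_tuple_def M.subspace_0)
  ultimately have "?g (unit_tuple l x) \<in> tuples r P" using gY by blast
  then have "?g (unit_tuple l x) i \<in> P" using il by (simp add: tuples_def)
  moreover have "G i j (unit_tuple l x j) = (if j = l then G i l x else 0)" for j
    by (simp add: unit_tuple_def G_hom)
  then have "?g (unit_tuple l x) i = G i l x"
    using il by (simp add: matrix_map_def)
  ultimately show ?thesis using il by simp
qed

end

section \<open>Existence of maximizers and summation over levels\<close>

context equivariant_pair
begin

lemma stable_zero: "stable {0}"
  unfolding stable_def using T_zero by simp

lemma weight_le:
  assumes "fin_dim_subspace sN E"
  shows "weight n t E D \<le> int n * int (N.dim E) - int t * int (M.dim D)"
proof -
  have "N.dim (E \<inter> coefficients_in D) \<le> N.dim E"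
    by (intro N.fin_dim_mono assms N.subspace_inter coefficients_in_subspace
        N.fin_dim_subspace_imp_subspace) auto
  then show ?thesis unfolding weight_def by (simp add: mult_left_mono)
qed

lemma maximizer_weight_nonneg:
  assumes "maximizer n t E D"
  shows "weight n t E D \<ge> 0"
proof -
  have "weight n t E {0} \<ge> 0" unfolding weight_def by (simp add: M.dim_zero_subspace)
  also have "weight n t E {0} \<le> weight n t E D"
    using assms stable_zero M.fin_dim_subspace_zero unfolding maximizer_def by blast
  finally show ?thesis .
qed

text \<open>Weights are integers bounded above by n dim \<open>E\<close>, so a maximum is attained.
  It is nonnegative, as comparison with the zero subspace shows, and at a positive level this bounds
  the dimension of every maximizer.\<close>

lemma largest_maximizer_exists:
  assumes E: "fin_dim_subspace sN E" and t: "t \<ge> 1"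
  obtains D where "largest_maximizer n t E D"
proof -
  define adm where "adm D \<longleftrightarrow> stable D \<and> fin_dim_subspace sM D" for D
  define m where "m D = nat (int n * int (N.dim E) - weight n t E D)" for D
  have "adm {0}" using stable_zero M.fin_dim_subspace_zero by (simp add: adm_def)
  then obtain D where D: "adm D" "\<And>D'. adm D' \<Longrightarrow> m D \<le> m D'"
    using ex_has_least_nat[of adm "{0}" m] by blast
  have up: "weight n t E D' \<le> int n * int (N.dim E)" for D'
    using weight_le[OF E, of n t D'] by (smt (verit) of_nat_0_le_iff mult_nonneg_nonneg)
  have max: "maximizer n t E D"
    unfolding maximizer_def using D up unfolding adm_def m_def by (auto simp: nat_le_eq_zle)
  have bound: "\<forall>D'. maximizer n t E D' \<longrightarrow> M.dim D' < Suc (n * N.dim E)"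
  proof (intro allI impI)
    fix D' assume D': "maximizer n t E D'"
    have "int t * int (M.dim D') \<le> int n * int (N.dim E)"
      using maximizer_weight_nonneg[OF D'] weight_le[OF E, of n t D'] by simp
    then have "t * M.dim D' \<le> n * N.dim E" by (metis of_nat_le_iff of_nat_mult)
    moreover have "M.dim D' \<le> t * M.dim D'" using t by simp
    ultimately show "M.dim D' < Suc (n * N.dim E)" by linarith
  qed
  show ?thesis
    using ex_has_greatest_nat[OF max bound] that unfolding largest_maximizer_def by blast
qed

text \<open>Layer-cake summation: over all levels \<open>t\<close>, the dimensions of the maximizers of \<open>E\<close>
  sum up to at least \<open>n dim E - dim D\<^sub>0\<close>, and those of \<open>E'\<close> to at most \<open>n dim E'\<close>.\<close>

lemma folner_level:
  fixes e :: real
  assumes E: "fin_dim_subspace sN E" and E': "fin_dim_subspace sN E'"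
    and nondegenerate: "coefficients_in {0} = {0}"
    and D0: "stable D0" "fin_dim_subspace sM D0" "E \<subseteq> coefficients_in D0"
    and e: "e > 0" and less: "real (N.dim E') < (1 + e) * real (N.dim E)"
  obtains n t D P where "maximizer n t E D" "largest_maximizer n t E' P"
    "real (M.dim P) < (1 + e) * real (M.dim D)"
proof (rule ccontr)
  assume "\<not> thesis"
  then have contra: "(1 + e) * real (M.dim D) \<le> real (M.dim P)"
    if "maximizer n t E D" "largest_maximizer n t E' P" for n t D P
    using that \<open>\<And>n t D P. \<lbrakk>maximizer n t E D; largest_maximizer n t E' P;
      real (M.dim P) < (1 + e) * real (M.dim D)\<rbrakk> \<Longrightarrow> thesis\<close> by force
  \<comment> \<open>\<open>n\<close> subdivides the levels finely enough for the boundary loss from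
    \<open>D0\<close> to be smaller than \<open>n\<close> times the available gap in
    dimension.\<close>
  obtain n :: nat where n: "(1 + e) * real (M.dim D0) < real n * ((1 + e) * real (N.dim E) - real (N.dim E'))"
    using reals_Archimedean3[of "(1 + e) * real (N.dim E) - real (N.dim E')"] less by auto
  \<comment> \<open>The levels are \<open>Suc t\<close>, since existence of a largest maximizer
    requires a positive level.\<close>
  have "\<exists>D. maximizer n (Suc t) E D" for t
    using largest_maximizer_exists[OF E, of "Suc t" n] unfolding largest_maximizer_def by auto
  then obtain D where D: "\<And>t. maximizer n (Suc t) E (D t)" by metis
  have "\<exists>P. largest_maximizer n (Suc t) E' P" for t
    using largest_maximizer_exists[OF E', of "Suc t" n] by auto
  then obtain P where P: "\<And>t. largest_maximizer n (Suc t) E' (P t)" by metis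
  then have P': "maximizer n (Suc t) E' (P t)" for t unfolding largest_maximizer_def by blast
  have step: "weight n (Suc t) F Q = weight n t F Q - int (M.dim Q)" for t F Q
    unfolding weight_def by (simp add: algebra_simps)
  \<comment> \<open>At each level the previous maximizer is a competitor of the current one, and
    raising the level costs it its dimension. The start compares with \<open>D0\<close>, which
    captures all of \<open>E\<close> and has weight n dim \<open>E\<close> - dim \<open>D0\<close>
    at level 1.\<close>
  have lower: "int n * int (N.dim E) - int (M.dim D0) \<le>
      (\<Sum>t<m. int (M.dim (D t))) + weight n (Suc m) E (D m)" for m
  proof (induction m)
    case 0
    have "weight n (Suc 0) E D0 \<le> weight n (Suc 0) E (D 0)"
      using D[of 0] D0 unfolding maximizer_def by blast
    moreover have "E \<inter> coefficients_in D0 = E" using D0 by auto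
    ultimately show ?case by (simp add: weight_def)
  next
    case (Suc m)
    have "weight n (Suc (Suc m)) E (D m) \<le> weight n (Suc (Suc m)) E (D (Suc m))"
      using D[of m] D[of "Suc m"] unfolding maximizer_def by blast
    then show ?case using Suc step[of "Suc m" E "D m"] by simp
  qed
  \<comment> \<open>Now the comparison runs downwards: the maximizer of the higher level competes at
    the lower one. The start uses the trivial bound at level 0.\<close>
  have upper: "(\<Sum>t<Suc m. int (M.dim (P t))) + weight n (Suc m) E' (P m) \<le> int n * int (N.dim E')" for m
  proof (induction m)
    case 0
    show ?case using weight_le[OF E', of n 0 "P 0"] step[of 0 E' "P 0"] by simp
  next
    case (Suc m)
    have "weight n (Suc m) E' (P (Suc m)) \<le> weight n (Suc m) E' (P m)"
      using P'[of m] P'[of "Suc m"] unfolding maximizer_def by blast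
    then show ?case using Suc step[of "Suc m" E' "P (Suc m)"] by simp
  qed
  \<comment> \<open>At level \<open>Suc m\<close> one dimension of a subspace already costs more
    than n dim \<open>E\<close>, so the remaining weight is at most 0. For the zero subspace this is
    \<open>nondegenerate\<close>.\<close>
  define m where "m = n * N.dim E"
  have "weight n (Suc m) E (D m) \<le> 0"
  proof (cases "D m = {0}")
    case True
    have "E \<inter> {0} = {0}" using N.fin_dim_subspace_imp_subspace[OF E] N.subspace_0 by auto
    then show ?thesis by (simp add: True weight_def nondegenerate M.dim_zero_subspace N.dim_zero_subspace)
  next
    case False
    then have "M.dim (D m) \<ge> 1"
      using D[of m] by (intro M.fin_dim_nonzero) (auto simp: maximizer_def)
    then have "int (Suc m) * 1 \<le> int (Suc m) * int (M.dim (D m))" by (intro mult_left_mono) auto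
    then show ?thesis using weight_le[OF E, of n "Suc m" "D m"] by (simp add: m_def)
  qed
  then have "int n * int (N.dim E) - int (M.dim D0) \<le> (\<Sum>t<m. int (M.dim (D t)))"
    using lower[of m] by simp
  also have "\<dots> \<le> (\<Sum>t<Suc m. int (M.dim (D t)))" by simp
  finally have "real_of_int (int n * int (N.dim E) - int (M.dim D0)) \<le>
      real_of_int (\<Sum>t<Suc m. int (M.dim (D t)))"
    by (simp only: of_int_le_iff)
  then have "real n * real (N.dim E) - real (M.dim D0) \<le> (\<Sum>t<Suc m. real (M.dim (D t)))"
    by simp
  \<comment> \<open>Multiplying by \<open>1 + e\<close> makes \<open>contra\<close> applicable term
    by term; the lower and upper sums then contradict the choice of \<open>n\<close>.\<close>
  then have "(1 + e) * (real n * real (N.dim E) - real (M.dim D0)) \<le>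
      (1 + e) * (\<Sum>t<Suc m. real (M.dim (D t)))"
    using e by (intro mult_left_mono) auto
  also have "\<dots> \<le> (\<Sum>t<Suc m. real (M.dim (P t)))"
    unfolding sum_distrib_left by (intro sum_mono contra[OF D P])
  also have "\<dots> \<le> real n * real (N.dim E')"
  proof -
    have "(\<Sum>t<Suc m. int (M.dim (P t))) \<le> int n * int (N.dim E')"
      using upper[of m] maximizer_weight_nonneg[OF P'[of m]] by linarith
    then have "real_of_int (\<Sum>t<Suc m. int (M.dim (P t))) \<le> real_of_int (int n * int (N.dim E'))"
      by (simp only: of_int_le_iff)
    then show ?thesis by simp
  qed
  finally show False using n by (simp add: algebra_simps)
qed

end

section \<open>Functionals on tensor powers and coalgebras\<close>

lemma vector_space_mult: "vector_space ((*) :: 'k::field \<Rightarrow> 'k \<Rightarrow> 'k)"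
  by unfold_locales (auto simp: algebra_simps)

context vector_space
begin

text \<open>Reduces identities between vectors to scalar identities; the laws of the hit actions
  below are obtained in this way.\<close>

lemma functional_separates:
  assumes "\<And>\<alpha>. functional \<alpha> \<Longrightarrow> \<alpha> x = \<alpha> y"
  shows "x = y"
proof (rule ccontr)
  assume "x \<noteq> y"
  then have "independent {x - y}" by simp
  interpret p: vector_space_pair scale "(*) :: 'a \<Rightarrow> 'a \<Rightarrow> 'a"
    by (intro vector_space_pair.intro vector_space_axioms vector_space_mult)
  obtain \<alpha> where \<alpha>: "functional \<alpha>" "\<alpha> (x - y) = 1"
    using p.linear_independent_extend[OF \<open>independent {x - y}\<close>, of "\<lambda>_. 1"] by blast
  interpret a: Vector_Spaces.linear scale "(*)" \<alpha> by (rule \<alpha>(1))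
  show False using \<alpha>(2) assms[OF \<alpha>(1)] by (simp add: a.diff)
qed

lemma dual_basis:
  assumes A: "finite A" "independent A"
  obtains \<alpha> where "\<forall>a. functional (\<alpha> a)" "\<forall>x\<in>span A. (\<Sum>a\<in>A. scale (\<alpha> a x) a) = x"
    "\<forall>a. \<forall>b\<in>A. \<alpha> a b = (if a = b then 1 else 0)"
proof -
  interpret p: vector_space_pair scale "(*) :: 'a \<Rightarrow> 'a \<Rightarrow> 'a"
    by (intro vector_space_pair.intro vector_space_axioms vector_space_mult)
  have "\<exists>f. functional f \<and> (\<forall>b\<in>A. f b = (if a = b then 1 else 0))" for a
    using p.linear_independent_extend[OF A(2), of "\<lambda>b. if a = b then 1 else 0"] .
  then obtain \<alpha> where \<alpha>: "\<And>a. functional (\<alpha> a)"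
    "\<And>a b. b \<in> A \<Longrightarrow> \<alpha> a b = (if a = b then 1 else 0)" by metis
  have "(\<Sum>a\<in>A. scale (\<alpha> a x) a) = x" if "x \<in> span A" for x
  proof -
    obtain u where u: "x = (\<Sum>b\<in>A. scale (u b) b)" using \<open>x \<in> span A\<close> span_finite[OF A(1)] by auto
    have "\<alpha> a x = u a" if "a \<in> A" for a
    proof -
      interpret a: Vector_Spaces.linear scale "(*)" "\<alpha> a" by (rule \<alpha>(1))
      have "\<alpha> a x = (\<Sum>b\<in>A. if b = a then u a else 0)"
        unfolding u a.sum a.scale by (intro sum.cong refl) (simp add: \<alpha>(2))
      then show ?thesis using A(1) that by simp
    qed
    then show ?thesis by (simp add: u)
  qed
  then show ?thesis using that \<alpha> by blast
qed

text \<open>Supports can shrink by cancellation, so linearity of \<open>lin_ext\<close> is checked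
  on a common finite set containing all supports involved.\<close>

lemma lin_ext_superset:
  assumes "finite A" "Poly_Mapping.keys u \<subseteq> A"
  shows "lin_ext scale f u = (\<Sum>x\<in>A. scale (Poly_Mapping.lookup u x) (f x))"
  unfolding lin_ext_def using assms
  by (intro sum.mono_neutral_left) (auto simp: in_keys_iff)

lemma linear_lin_ext: "Vector_Spaces.linear fscale scale (lin_ext scale f)"
proof (rule linearI[OF vector_space_fscale vector_space_axioms])
  fix u v :: "'c \<Rightarrow>\<^sub>0 'a" and c
  let ?A = "Poly_Mapping.keys u \<union> Poly_Mapping.keys v"
  show "lin_ext scale f (u + v) = lin_ext scale f u + lin_ext scale f v"
    using Poly_Mapping.keys_add[of u v]
    by (simp add: lin_ext_superset[of ?A] lookup_add scale_left_distrib sum.distrib)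
  have "Poly_Mapping.keys (fscale c u) \<subseteq> Poly_Mapping.keys u"
    by (auto simp: in_keys_iff)
  then show "lin_ext scale f (fscale c u) = scale c (lin_ext scale f u)"
    by (simp add: lin_ext_superset[of "Poly_Mapping.keys u"] scale_sum_right)
qed

lemma lin_ext_single: "lin_ext scale f (Poly_Mapping.single x a) = scale a (f x)"
  by (subst lin_ext_superset[of "{x}"]) (auto simp: lookup_single)

lemma lin_ext_sum_right: "lin_ext scale (\<lambda>x. \<Sum>i\<in>I. f i x) u = (\<Sum>i\<in>I. lin_ext scale (f i) u)"
  unfolding lin_ext_def by (subst sum.swap) (simp add: scale_sum_right)

lemma lin_ext_scale_right: "lin_ext scale (\<lambda>x. scale c (f x)) u = scale c (lin_ext scale f u)"
  unfolding lin_ext_def by (simp add: scale_sum_right mult.commute)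

lemma lin_ext_swap:
  "lin_ext scale (\<lambda>x. lin_ext scale (f x) v) u = lin_ext scale (\<lambda>y. lin_ext scale (\<lambda>x. f x y) u) v"
  unfolding lin_ext_def scale_sum_right by (subst sum.swap) (simp add: mult.commute)

end

lemma linear_lin_ext_comp:
  assumes "Vector_Spaces.linear s s' g"
  shows "g (lin_ext s f u) = lin_ext s' (\<lambda>x. g (f x)) u"
proof -
  interpret Vector_Spaces.linear s s' g by fact
  show ?thesis unfolding lin_ext_def by (simp add: sum scale)
qed

section \<open>Testing congruences in tensor powers by multilinear maps\<close>

definition bilinear_map ::
  "('k::field \<Rightarrow> 'c::ab_group_add \<Rightarrow> 'c) \<Rightarrow> ('k \<Rightarrow> 'v::ab_group_add \<Rightarrow> 'v) \<Rightarrow> ('c \<Rightarrow> 'c \<Rightarrow> 'v) \<Rightarrow> bool" where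
  "bilinear_map s s' b \<longleftrightarrow>
    (\<forall>y. Vector_Spaces.linear s s' (\<lambda>x. b x y)) \<and> (\<forall>x. Vector_Spaces.linear s s' (b x))"

text \<open>The universal property of the tensor square: the linear extension of a bilinear map
  kills each of the four families of relations.\<close>

lemma tensor_eq_lin_ext:
  assumes "tensor_eq s u v" and b: "bilinear_map s s' b"
  shows "lin_ext s' (\<lambda>(x, y). b x y) u = lin_ext s' (\<lambda>(x, y). b x y) v"
proof -
  have "Vector_Spaces.linear s s' (b 0)" using b unfolding bilinear_map_def by blast
  then interpret b0: Vector_Spaces.linear s s' "b 0" .
  interpret F: vector_space "fscale :: 'a \<Rightarrow> ('b \<times> 'b \<Rightarrow>\<^sub>0 'a) \<Rightarrow> _" by (rule vector_space_fscale)
  interpret L: Vector_Spaces.linear fscale s' "lin_ext s' (\<lambda>(x :: 'b, y). b x y)" by (rule b0.vs2.linear_lin_ext)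
  have lt: "lin_ext s' (\<lambda>(x, y). b x y) (tens x y) = b x y" for x y
    by (simp add: tens_def b0.vs2.lin_ext_single)
  have bl: "b (x + x') y = b x y + b x' y" "b x (y + y') = b x y + b x y'"
    "b (s a x) y = s' a (b x y)" "b x (s a y) = s' a (b x y)" for x x' y y' a
    using b unfolding bilinear_map_def Vector_Spaces.linear_iff by blast+
  have "u - v \<in> tensor_rel s" using assms(1) by (simp add: tensor_eq_def)
  then have "lin_ext s' (\<lambda>(x, y). b x y) (u - v) = 0"
    unfolding tensor_rel_def
    by (rule L.eq_0_on_span[rotated]) (auto simp: L.diff L.scale lt bl)
  then show ?thesis by (simp add: L.diff)
qed

text \<open>Products of three functionals suffice, as they are what coassociativity will be tested
  on.\<close>

lemma tensor3_eq_lin_ext: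
  assumes "tensor3_eq s u v"
    and f: "Vector_Spaces.linear s (*) f" and g: "Vector_Spaces.linear s (*) g" and h: "Vector_Spaces.linear s (*) h"
  shows "lin_ext (*) (\<lambda>(x, y, z). f x * g y * h z) u = lin_ext (*) (\<lambda>(x, y, z). f x * g y * h z) v"
proof -
  interpret f: Vector_Spaces.linear s "(*)" f by (rule f)
  interpret g: Vector_Spaces.linear s "(*)" g by (rule g)
  interpret h: Vector_Spaces.linear s "(*)" h by (rule h)
  interpret L: Vector_Spaces.linear fscale "(*)" "lin_ext (*) (\<lambda>(x, y, z). f x * g y * h z)"
    by (rule f.vs2.linear_lin_ext)
  have lt: "lin_ext (*) (\<lambda>(x, y, z). f x * g y * h z) (tens3 x y z) = f x * g y * h z" for x y z
    by (simp add: tens3_def f.vs2.lin_ext_single)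
  have "u - v \<in> tensor3_rel s" using assms(1) by (simp add: tensor3_eq_def)
  then have "lin_ext (*) (\<lambda>(x, y, z). f x * g y * h z) (u - v) = 0"
    unfolding tensor3_rel_def
    by (rule L.eq_0_on_span[rotated], elim UnE CollectE exE conjE;
      simp add: L.diff L.scale lt f.add g.add h.add f.scale g.scale h.scale distrib_left distrib_right)
  then show ?thesis by (simp add: L.diff)
qed

context vector_space
begin

lemma bilinear_map_functionals:
  assumes a: "functional \<alpha>" and b: "functional \<beta>"
  shows "bilinear_map scale (*) (\<lambda>x y. \<alpha> x * \<beta> y)"
proof -
  interpret a: Vector_Spaces.linear scale "(*)" \<alpha> by (rule a)
  interpret b: Vector_Spaces.linear scale "(*)" \<beta> by (rule b)
  show ?thesis unfolding bilinear_map_def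
    by (intro conjI allI linearI vector_space_axioms vector_space_mult)
      (simp_all add: a.add b.add a.scale b.scale distrib_left distrib_right)
qed

text \<open>A functional on the free space that kills the relations is a bilinear form, and on finitely
  many arguments a bilinear form is a finite sum of products of functionals.\<close>

lemma tensor_eqI:
  assumes prod: "\<And>\<alpha> \<beta>. functional \<alpha> \<Longrightarrow> functional \<beta> \<Longrightarrow>
    lin_ext (*) (\<lambda>(x, y). \<alpha> x * \<beta> y) u = lin_ext (*) (\<lambda>(x, y). \<alpha> x * \<beta> y) v"
  shows "tensor_eq scale u v"
  unfolding tensor_eq_def
proof (rule ccontr)
  assume notin: "u - v \<notin> tensor_rel scale"
  interpret F: vector_space "fscale :: 'a \<Rightarrow> ('b \<times> 'b \<Rightarrow>\<^sub>0 'a) \<Rightarrow> _" by (rule vector_space_fscale)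
  interpret k: vector_space "(*) :: 'a \<Rightarrow> 'a \<Rightarrow> 'a" by (rule vector_space_mult)
  interpret p: vector_space_pair "fscale :: 'a \<Rightarrow> ('b \<times> 'b \<Rightarrow>\<^sub>0 'a) \<Rightarrow> _" "(*) :: 'a \<Rightarrow> 'a \<Rightarrow> 'a"
    by (intro vector_space_pair.intro vector_space_fscale vector_space_mult)
  have sub: "F.subspace (tensor_rel scale)" unfolding tensor_rel_def by simp
  obtain A where A: "A \<subseteq> tensor_rel scale" "F.independent A" "tensor_rel scale \<subseteq> F.span A"
      "card A = F.dim (tensor_rel scale)"
    by (rule F.basis_exists)
  have spA: "F.span A = tensor_rel scale" by (rule F.span_subspace[OF A(1,3) sub])
  \<comment> \<open>If \<open>u - v\<close> is not a relation, a functional \<open>m\<close> on the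
    free space can be prescribed to kill all relations and to take the value 1 at
    \<open>u - v\<close>.\<close>
  have "F.independent (insert (u - v) A)"
    using notin A(2) by (intro F.independent_insertI) (simp_all add: spA)
  then obtain m where m: "Vector_Spaces.linear fscale (*) m" "\<forall>w\<in>insert (u - v) A. m w = (if w = u - v then 1 else 0)"
    using p.linear_independent_extend[of "insert (u - v) A" "\<lambda>w. if w = u - v then 1 else 0"] by blast
  interpret m: Vector_Spaces.linear fscale "(*)" m by (rule m(1))
  have "u - v \<notin> A" using notin A(1) by blast
  then have mA: "m w = 0" if "w \<in> tensor_rel scale" for w
    using that m(2) by (intro m.eq_0_on_span[of A w]) (auto simp: spA)
  define b where "b x y = m (tens x y)" for x y
  have b1: "b (x + x') y = b x y + b x' y" for x x' y
  proof -
    have "tens (x + x') y - tens x y - tens x' y \<in> tensor_rel scale"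
      unfolding tensor_rel_def by (rule F.span_base) blast
    from mA[OF this] show ?thesis by (simp add: b_def m.diff diff_eq_eq ac_simps)
  qed
  have b2: "b x (y + y') = b x y + b x y'" for x y y'
  proof -
    have "tens x (y + y') - tens x y - tens x y' \<in> tensor_rel scale"
      unfolding tensor_rel_def by (rule F.span_base) blast
    from mA[OF this] show ?thesis by (simp add: b_def m.diff diff_eq_eq ac_simps)
  qed
  have b3: "b (scale a x) y = a * b x y" for a x y
  proof -
    have "tens (scale a x) y - fscale a (tens x y) \<in> tensor_rel scale"
      unfolding tensor_rel_def by (rule F.span_base) blast
    from mA[OF this] show ?thesis by (simp add: b_def m.diff m.scale)
  qed
  have b4: "b x (scale a y) = a * b x y" for a x y
  proof -
    have "tens x (scale a y) - fscale a (tens x y) \<in> tensor_rel scale"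
      unfolding tensor_rel_def by (rule F.span_base) blast
    from mA[OF this] show ?thesis by (simp add: b_def m.diff m.scale)
  qed
  have mb: "m w = lin_ext (*) (\<lambda>(x, y). b x y) w" for w
  proof -
    have "w = lin_ext fscale (\<lambda>(x, y). tens x y) w"
    proof (rule poly_mapping_eqI)
      fix p
      have "Poly_Mapping.lookup (lin_ext fscale (\<lambda>(x, y). tens x y) w) p =
          (\<Sum>q\<in>Poly_Mapping.keys w. if q = p then Poly_Mapping.lookup w p else 0)"
        unfolding lin_ext_def lookup_sum
        by (intro sum.cong refl) (auto simp: tens_def lookup_single when_def)
      then show "Poly_Mapping.lookup w p = Poly_Mapping.lookup (lin_ext fscale (\<lambda>(x, y). tens x y) w) p"
        by (simp add: in_keys_iff)
    qed
    then have "m w = m (lin_ext fscale (\<lambda>(x, y). tens x y) w)" by simp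
    also have "\<dots> = lin_ext (*) (\<lambda>p. m (case p of (x, y) \<Rightarrow> tens x y)) w"
      by (rule linear_lin_ext_comp[OF m(1)])
    finally show ?thesis by (simp add: b_def case_prod_unfold)
  qed
  \<comment> \<open>\<open>X\<close> collects the finitely many first components that occur.
    Expanding them in a basis \<open>C\<close> of their span turns the form \<open>b\<close> into a
    finite sum of products of functionals.\<close>
  define X where "X = fst ` (Poly_Mapping.keys u \<union> Poly_Mapping.keys v)"
  have "fin_dim_subspace scale (span X)"
    unfolding fin_dim_subspace_def by (rule exI[of _ X]) (simp add: X_def)
  then obtain C where C: "finite C" "independent C" "span C = span X" "card C = dim (span X)" "C \<subseteq> span X"
    by (rule fin_dim_basis)
  obtain \<alpha> where \<alpha>: "\<forall>a. functional (\<alpha> a)" "\<forall>x\<in>span C. (\<Sum>a\<in>C. scale (\<alpha> a x) a) = x"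
    "\<forall>a. \<forall>b\<in>C. \<alpha> a b = (if a = b then 1 else 0)"
    by (rule dual_basis[OF C(1,2)])
  note \<alpha> = \<alpha>(1)[rule_format] \<alpha>(2)[rule_format]
  have fb: "functional (b a)" for a
    by (rule linearI[OF vector_space_axioms k.vector_space_axioms]) (auto simp: b2 b4)
  have fb': "functional (\<lambda>x. b x y)" for y
    by (rule linearI[OF vector_space_axioms k.vector_space_axioms]) (auto simp: b1 b3)
  have exp: "b x y = (\<Sum>a\<in>C. \<alpha> a x * b a y)" if "x \<in> X" for x y
  proof -
    interpret l: Vector_Spaces.linear scale "(*)" "\<lambda>x. b x y" by (rule fb')
    have "b x y = b (\<Sum>a\<in>C. scale (\<alpha> a x) a) y"
      using \<alpha>(2)[of x] that span_base[of x X] C(3) by simp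
    then show ?thesis by (simp add: l.sum l.scale)
  qed
  have "lin_ext (*) (\<lambda>(x, y). b x y) w = (\<Sum>a\<in>C. lin_ext (*) (\<lambda>(x, y). \<alpha> a x * b a y) w)"
    if "Poly_Mapping.keys w \<subseteq> Poly_Mapping.keys u \<union> Poly_Mapping.keys v" for w
  proof -
    have "lin_ext (*) (\<lambda>(x, y). b x y) w = lin_ext (*) (\<lambda>z. \<Sum>a\<in>C. case z of (x, y) \<Rightarrow> \<alpha> a x * b a y) w"
      unfolding lin_ext_def
    proof (rule sum.cong[OF refl])
      fix z assume z: "z \<in> Poly_Mapping.keys w"
      obtain x y where xy: "z = (x, y)" by (cases z)
      have "x \<in> X" using z that xy unfolding X_def by force
      then show "Poly_Mapping.lookup w z * (case z of (x, y) \<Rightarrow> b x y) =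
          Poly_Mapping.lookup w z * (\<Sum>a\<in>C. case z of (x, y) \<Rightarrow> \<alpha> a x * b a y)"
        using exp by (simp add: xy)
    qed
    then show ?thesis by (simp add: k.lin_ext_sum_right)
  qed
  then have "m u = m v"
    unfolding mb using prod[OF \<alpha>(1) fb] by simp
  moreover have "m (u - v) = 1" using m(2) by simp
  ultimately show False by (simp add: m.diff)
qed

end

section \<open>The dual algebra and its two actions on a coalgebra\<close>

context coalgebra
begin

text \<open>The convolution product of functionals, that is, the multiplication of the dual
  algebra.\<close>

definition pairing :: "('c \<Rightarrow> 'k) \<Rightarrow> ('c \<Rightarrow> 'k) \<Rightarrow> 'c \<Rightarrow> 'k" where
  "pairing \<alpha> \<beta> x = lin_ext (*) (\<lambda>(y, z). \<alpha> y * \<beta> z) (\<Delta> x)"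

text \<open>The hit action in which the functional consumes the right tensor factor;
  \<open>lhit\<close> is its mirror image.\<close>

definition rhit :: "('c \<Rightarrow> 'k) \<Rightarrow> 'c \<Rightarrow> 'c" where
  "rhit \<alpha> x = lin_ext scale (\<lambda>(y, z). scale (\<alpha> z) y) (\<Delta> x)"

definition lhit :: "('c \<Rightarrow> 'k) \<Rightarrow> 'c \<Rightarrow> 'c" where
  "lhit \<alpha> x = lin_ext scale (\<lambda>(y, z). scale (\<alpha> y) z) (\<Delta> x)"

text \<open>\<Delta> takes values in representatives and is linear only modulo the relations.
  Composition with a bilinear map removes the ambiguity.\<close>

lemma linear_comult:
  assumes b: "bilinear_map scale s' b"
  shows "Vector_Spaces.linear scale s' (\<lambda>x. lin_ext s' (\<lambda>(y, z). b y z) (\<Delta> x))"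
proof -
  have "Vector_Spaces.linear scale s' (b 0)" using b unfolding bilinear_map_def by blast
  then interpret b0: Vector_Spaces.linear scale s' "b 0" .
  interpret L: Vector_Spaces.linear fscale s' "lin_ext s' (\<lambda>(y :: 'c, z). b y z)" by (rule b0.vs2.linear_lin_ext)
  show ?thesis
  proof (rule linearI[OF vector_space_axioms b0.vs2.vector_space_axioms])
    show "lin_ext s' (\<lambda>(y, z). b y z) (\<Delta> (x + y)) =
        lin_ext s' (\<lambda>(y, z). b y z) (\<Delta> x) + lin_ext s' (\<lambda>(y, z). b y z) (\<Delta> y)" for x y
      using tensor_eq_lin_ext[OF comult_add b, of x y] by (simp add: L.add)
    show "lin_ext s' (\<lambda>(y, z). b y z) (\<Delta> (scale c x)) = s' c (lin_ext s' (\<lambda>(y, z). b y z) (\<Delta> x))" for c x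
      using tensor_eq_lin_ext[OF comult_scale b, of c x] by (simp add: L.scale)
  qed
qed

lemma bilinear_map_scale_right:
  assumes "functional \<alpha>"
  shows "bilinear_map scale scale (\<lambda>y z. scale (\<alpha> z) y)"
proof -
  interpret a: Vector_Spaces.linear scale "(*)" \<alpha> by (rule assms)
  show ?thesis unfolding bilinear_map_def
    by (intro conjI allI linearI vector_space_axioms)
      (simp_all add: a.add a.scale scale_right_distrib scale_left_distrib mult.commute)
qed

lemma bilinear_map_scale_left:
  assumes "functional \<alpha>"
  shows "bilinear_map scale scale (\<lambda>y z. scale (\<alpha> y) z)"
proof -
  interpret a: Vector_Spaces.linear scale "(*)" \<alpha> by (rule assms)
  show ?thesis unfolding bilinear_map_def
    by (intro conjI allI linearI vector_space_axioms)
      (simp_all add: a.add a.scale scale_right_distrib scale_left_distrib mult.commute)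
qed

lemma pairing_linear: "functional \<alpha> \<Longrightarrow> functional \<beta> \<Longrightarrow> functional (pairing \<alpha> \<beta>)"
  unfolding pairing_def by (intro linear_comult bilinear_map_functionals)

lemma rhit_linear: "functional \<alpha> \<Longrightarrow> Vector_Spaces.linear scale scale (rhit \<alpha>)"
  unfolding rhit_def by (intro linear_comult bilinear_map_scale_right)

lemma lhit_linear: "functional \<alpha> \<Longrightarrow> Vector_Spaces.linear scale scale (lhit \<alpha>)"
  unfolding lhit_def by (intro linear_comult bilinear_map_scale_left)

lemma functional_rhit:
  assumes "functional \<alpha>"
  shows "\<alpha> (rhit \<beta> x) = pairing \<alpha> \<beta> x"
proof -
  interpret a: Vector_Spaces.linear scale "(*)" \<alpha> by (rule assms)
  show ?thesis unfolding rhit_def pairing_def linear_lin_ext_comp[OF assms]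
    by (simp add: case_prod_unfold a.scale mult.commute)
qed

lemma functional_lhit:
  assumes "functional \<beta>"
  shows "\<beta> (lhit \<alpha> x) = pairing \<alpha> \<beta> x"
proof -
  interpret a: Vector_Spaces.linear scale "(*)" \<beta> by (rule assms)
  show ?thesis unfolding lhit_def pairing_def linear_lin_ext_comp[OF assms]
    by (simp add: case_prod_unfold a.scale)
qed

lemma rhit_sum: "rhit (\<lambda>y. \<Sum>i\<in>I. \<beta> i y) x = (\<Sum>i\<in>I. rhit (\<beta> i) x)"
  unfolding rhit_def lin_ext_sum_right[symmetric]
  by (simp add: case_prod_unfold scale_sum_left)

lemma lhit_sum: "lhit (\<lambda>y. \<Sum>i\<in>I. \<beta> i y) x = (\<Sum>i\<in>I. lhit (\<beta> i) x)"
  unfolding lhit_def lin_ext_sum_right[symmetric]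
  by (simp add: case_prod_unfold scale_sum_left)

text \<open>Coassociativity evaluated on a product of three functionals; the auxiliary facts
  \<open>l\<close> and \<open>r\<close> pull the factor not comultiplied again out as a
  scalar.\<close>

lemma pairing_assoc:
  assumes "functional \<alpha>" "functional \<beta>" "functional \<gamma>"
  shows "pairing (pairing \<alpha> \<beta>) \<gamma> x = pairing \<alpha> (pairing \<beta> \<gamma>) x"
proof -
  interpret k: vector_space "(*) :: 'k \<Rightarrow> 'k \<Rightarrow> 'k" by (rule vector_space_mult)
  define t where "t = (\<lambda>(x, y, z). \<alpha> x * \<beta> y * \<gamma> z)"
  have lin: "Vector_Spaces.linear fscale (*) (lin_ext (*) t)" by (rule k.linear_lin_ext)
  have single: "lin_ext (*) t (tens3 x y z) = \<alpha> x * \<beta> y * \<gamma> z" for x y z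
    by (simp add: tens3_def k.lin_ext_single t_def)
  have l: "lin_ext (*) t (lin_ext fscale (\<lambda>(y, z). tens3 y z b) u) =
      \<gamma> b * lin_ext (*) (\<lambda>(y, z). \<alpha> y * \<beta> z) u" for u b
  proof -
    have "lin_ext (*) t (case p of (y, z) \<Rightarrow> tens3 y z b) = \<gamma> b * (case p of (y, z) \<Rightarrow> \<alpha> y * \<beta> z)" for p
      by (cases p) (simp add: single)
    then show ?thesis by (simp only: linear_lin_ext_comp[OF lin] k.lin_ext_scale_right)
  qed
  have r: "lin_ext (*) t (lin_ext fscale (\<lambda>(y, z). tens3 a y z) u) =
      \<alpha> a * lin_ext (*) (\<lambda>(y, z). \<beta> y * \<gamma> z) u" for u a
  proof -
    have "lin_ext (*) t (case p of (y, z) \<Rightarrow> tens3 a y z) = \<alpha> a * (case p of (y, z) \<Rightarrow> \<beta> y * \<gamma> z)" for p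
      by (cases p) (simp add: single)
    then show ?thesis by (simp only: linear_lin_ext_comp[OF lin] k.lin_ext_scale_right)
  qed
  have "lin_ext (*) t (lin_ext fscale (\<lambda>(x1, x2). lin_ext fscale (\<lambda>(y, z). tens3 y z x2) (\<Delta> x1)) (\<Delta> x)) =
      lin_ext (*) t (lin_ext fscale (\<lambda>(x1, x2). lin_ext fscale (\<lambda>(y, z). tens3 x1 y z) (\<Delta> x2)) (\<Delta> x))"
    unfolding t_def by (rule tensor3_eq_lin_ext[OF coassoc assms])
  moreover have "lin_ext (*) t (case p of (x1, x2) \<Rightarrow> lin_ext fscale (\<lambda>(y, z). tens3 y z x2) (\<Delta> x1)) =
      (case p of (x1, x2) \<Rightarrow> pairing \<alpha> \<beta> x1 * \<gamma> x2)" for p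
    by (cases p) (simp add: l pairing_def)
  moreover have "lin_ext (*) t (case p of (x1, x2) \<Rightarrow> lin_ext fscale (\<lambda>(y, z). tens3 x1 y z) (\<Delta> x2)) =
      (case p of (x1, x2) \<Rightarrow> \<alpha> x1 * pairing \<beta> \<gamma> x2)" for p
    by (cases p) (simp add: r pairing_def)
  ultimately show ?thesis
    unfolding pairing_def[of _ _ x] by (simp only: linear_lin_ext_comp[OF lin])
qed

lemma rhit_counit: "rhit \<epsilon> x = x"
  unfolding rhit_def by (rule counit_right)

lemma lhit_counit: "lhit \<epsilon> x = x"
  unfolding lhit_def by (rule counit_left)

lemma lhit_lhit:
  assumes "functional \<alpha>" "functional \<beta>"
  shows "lhit \<alpha> (lhit \<beta> x) = lhit (pairing \<beta> \<alpha>) x"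
proof (rule functional_separates)
  fix \<gamma> assume g: "functional \<gamma>"
  show "\<gamma> (lhit \<alpha> (lhit \<beta> x)) = \<gamma> (lhit (pairing \<beta> \<alpha>) x)"
    by (simp add: functional_lhit[OF g] functional_lhit[OF pairing_linear[OF assms(1) g]]
        pairing_assoc[OF assms(2,1) g])
qed

lemma rhit_rhit:
  assumes "functional \<alpha>" "functional \<beta>"
  shows "rhit \<alpha> (rhit \<beta> x) = rhit (pairing \<alpha> \<beta>) x"
proof (rule functional_separates)
  fix \<gamma> assume g: "functional \<gamma>"
  show "\<gamma> (rhit \<alpha> (rhit \<beta> x)) = \<gamma> (rhit (pairing \<alpha> \<beta>) x)"
    by (simp add: functional_rhit[OF g] functional_rhit[OF pairing_linear[OF g assms(1)]]
        pairing_assoc[OF g assms])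
qed

lemma rhit_lhit:
  assumes "functional \<alpha>" "functional \<beta>"
  shows "rhit \<alpha> (lhit \<beta> x) = lhit \<beta> (rhit \<alpha> x)"
proof (rule functional_separates)
  fix \<gamma> assume g: "functional \<gamma>"
  show "\<gamma> (rhit \<alpha> (lhit \<beta> x)) = \<gamma> (lhit \<beta> (rhit \<alpha> x))"
    by (simp add: functional_rhit[OF g] functional_lhit[OF g] functional_lhit[OF pairing_linear[OF g assms(1)]]
        functional_rhit[OF pairing_linear[OF assms(2) g]] pairing_assoc[OF assms(2) g assms(1)])
qed

section \<open>Local finiteness, subcoalgebras and comatrices\<close>

lemma rhit_in_span: "rhit \<alpha> x \<in> span (fst ` Poly_Mapping.keys (\<Delta> x))"
  unfolding rhit_def lin_ext_def
proof (intro span_sum span_scale)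
  fix p assume "p \<in> Poly_Mapping.keys (\<Delta> x)"
  then have "fst p \<in> span (fst ` Poly_Mapping.keys (\<Delta> x))" by (intro span_base imageI)
  then show "(case p of (y, z) \<Rightarrow> scale (\<alpha> z) y) \<in> span (fst ` Poly_Mapping.keys (\<Delta> x))"
    by (simp add: case_prod_unfold span_scale)
qed

lemma lhit_in_span: "lhit \<alpha> x \<in> span (snd ` Poly_Mapping.keys (\<Delta> x))"
  unfolding lhit_def lin_ext_def
proof (intro span_sum span_scale)
  fix p assume "p \<in> Poly_Mapping.keys (\<Delta> x)"
  then have "snd p \<in> span (snd ` Poly_Mapping.keys (\<Delta> x))" by (intro span_base imageI)
  then show "(case p of (y, z) \<Rightarrow> scale (\<alpha> y) z) \<in> span (snd ` Poly_Mapping.keys (\<Delta> x))"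
    by (simp add: case_prod_unfold span_scale)
qed

lemma linear_image_span:
  assumes "Vector_Spaces.linear scale scale f" "x \<in> span A" "\<And>a. a \<in> A \<Longrightarrow> f a \<in> span B"
  shows "f x \<in> span B"
proof -
  interpret Vector_Spaces.linear scale scale f by fact
  have "f x \<in> span (f ` A)" using assms(2) by (simp add: span_image)
  also have "\<dots> \<subseteq> span B" using assms(3) by (intro span_minimal) auto
  finally show ?thesis .
qed

text \<open>The fundamental theorem of coalgebras. The span of all two-sided hits of
  \<open>F\<close> is stable since the two actions commute and compose by convolution, and it
  contains \<open>F\<close> by the counit laws. It is finite-dimensional because every hit lies in
  the span of tensor components occurring in \<Delta>.\<close>

lemma local_finiteness:
  assumes F: "finite F"
  obtains D where "fin_dim_subspace scale D" "F \<subseteq> D"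
    "\<forall>\<alpha>. functional \<alpha> \<longrightarrow> (\<forall>x\<in>D. rhit \<alpha> x \<in> D \<and> lhit \<alpha> x \<in> D)"
proof -
  define A where "A = {lhit \<alpha> (rhit \<beta> f) | \<alpha> \<beta> f. functional \<alpha> \<and> functional \<beta> \<and> f \<in> F}"
  define B where "B = (\<Union>f\<in>F. \<Union>b\<in>fst ` Poly_Mapping.keys (\<Delta> f). snd ` Poly_Mapping.keys (\<Delta> b))"
  have "A \<subseteq> span B"
  proof
    fix x assume "x \<in> A"
    then obtain \<alpha> \<beta> f where x: "x = lhit \<alpha> (rhit \<beta> f)" "functional \<alpha>" "f \<in> F" unfolding A_def by blast
    have "lhit \<alpha> b \<in> span B" if "b \<in> fst ` Poly_Mapping.keys (\<Delta> f)" for b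
    proof -
      have "span (snd ` Poly_Mapping.keys (\<Delta> b)) \<subseteq> span B"
        by (rule span_mono) (use that x(3) in \<open>unfold B_def, blast\<close>)
      then show ?thesis using lhit_in_span by blast
    qed
    then show "x \<in> span B" unfolding x(1)
      by (rule linear_image_span[OF lhit_linear[OF x(2)] rhit_in_span])
  qed
  then have "span A \<subseteq> span B" by (intro span_minimal) simp_all
  moreover have "finite B" unfolding B_def using F by simp
  ultimately have "fin_dim_subspace scale (span A)"
    by (intro fin_dim_subspaceI[of _ B]) simp_all
  moreover have "F \<subseteq> span A"
  proof
    fix f assume "f \<in> F"
    then have "lhit \<epsilon> (rhit \<epsilon> f) \<in> A" unfolding A_def using counit_linear by blast
    then show "f \<in> span A" by (simp add: rhit_counit lhit_counit span_base)
  qed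
  moreover have "rhit \<gamma> x \<in> span A \<and> lhit \<gamma> x \<in> span A" if g: "functional \<gamma>" and x: "x \<in> span A" for \<gamma> x
  proof
    show "rhit \<gamma> x \<in> span A"
    proof (rule linear_image_span[OF rhit_linear[OF g] x])
      fix a assume "a \<in> A"
      then obtain \<alpha> \<beta> f where a: "a = lhit \<alpha> (rhit \<beta> f)" "functional \<alpha>" "functional \<beta>" "f \<in> F"
        unfolding A_def by blast
      have "rhit \<gamma> a = lhit \<alpha> (rhit (pairing \<gamma> \<beta>) f)"
        by (simp add: a(1) rhit_lhit[OF g a(2)] rhit_rhit[OF g a(3)])
      then have "rhit \<gamma> a \<in> A" unfolding A_def using a pairing_linear[OF g a(3)] by blast
      then show "rhit \<gamma> a \<in> span A" by (rule span_base)
    qed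
    show "lhit \<gamma> x \<in> span A"
    proof (rule linear_image_span[OF lhit_linear[OF g] x])
      fix a assume "a \<in> A"
      then obtain \<alpha> \<beta> f where a: "a = lhit \<alpha> (rhit \<beta> f)" "functional \<alpha>" "functional \<beta>" "f \<in> F"
        unfolding A_def by blast
      have "lhit \<gamma> a = lhit (pairing \<alpha> \<gamma>) (rhit \<beta> f)"
        by (simp add: a(1) lhit_lhit[OF g a(2)])
      then have "lhit \<gamma> a \<in> A" unfolding A_def using a pairing_linear[OF a(2) g] by blast
      then show "lhit \<gamma> a \<in> span A" by (rule span_base)
    qed
  qed
  ultimately show ?thesis using that by blast
qed

text \<open>With a basis of \<open>D\<close> and dual functionals, a representative of
  \<open>\<Delta> x\<close> is formed from the basis vectors and the corresponding left hits of
  \<open>x\<close>. Stability under \<open>lhit\<close> puts it in the square of \<open>D\<close>;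
  stability under \<open>rhit\<close> shows that it is congruent to
  \<open>\<Delta> x\<close>.\<close>

lemma subcoalgebraI:
  assumes D: "fin_dim_subspace scale D"
    and stable: "\<And>\<alpha> x. functional \<alpha> \<Longrightarrow> x \<in> D \<Longrightarrow> rhit \<alpha> x \<in> D"
      "\<And>\<alpha> x. functional \<alpha> \<Longrightarrow> x \<in> D \<Longrightarrow> lhit \<alpha> x \<in> D"
  shows "subcoalgebra scale \<Delta> D"
  unfolding subcoalgebra_def
proof (intro conjI ballI)
  show "subspace D" by (rule fin_dim_subspace_imp_subspace[OF D])
  fix x assume x: "x \<in> D"
  obtain A where A: "finite A" "independent A" "span A = D" "card A = dim D" "A \<subseteq> D"
    using D by (rule fin_dim_basis)
  obtain \<alpha> where \<alpha>: "\<forall>a. functional (\<alpha> a)" "\<forall>x\<in>span A. (\<Sum>a\<in>A. scale (\<alpha> a x) a) = x"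
    "\<forall>a. \<forall>b\<in>A. \<alpha> a b = (if a = b then 1 else 0)"
    by (rule dual_basis[OF A(1,2)])
  interpret k: vector_space "(*) :: 'k \<Rightarrow> 'k \<Rightarrow> 'k" by (rule vector_space_mult)
  define u :: "'c \<times> 'c \<Rightarrow>\<^sub>0 'k" where "u = (\<Sum>a\<in>A. tens a (lhit (\<alpha> a) x))"
  have "Poly_Mapping.keys u \<subseteq> D \<times> D"
  proof
    fix p assume "p \<in> Poly_Mapping.keys u"
    then have "(\<Sum>a\<in>A. Poly_Mapping.lookup (tens a (lhit (\<alpha> a) x) :: _ \<Rightarrow>\<^sub>0 'k) p) \<noteq> 0"
      by (simp add: in_keys_iff u_def lookup_sum)
    then obtain a where a: "a \<in> A" "Poly_Mapping.lookup (tens a (lhit (\<alpha> a) x) :: _ \<Rightarrow>\<^sub>0 'k) p \<noteq> 0"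
      by (meson sum.neutral)
    then have "p = (a, lhit (\<alpha> a) x)" by (simp add: tens_def lookup_single when_def split: if_splits)
    then show "p \<in> D \<times> D" using a(1) A(5) stable(2) \<alpha>(1) x by auto
  qed
  moreover have "tensor_eq scale (\<Delta> x) u"
  proof (rule tensor_eqI)
    fix \<beta> \<gamma> assume b: "functional \<beta>" and g: "functional \<gamma>"
    let ?p = "\<lambda>(y, z). \<beta> y * \<gamma> z"
    interpret L: Vector_Spaces.linear fscale "(*)" "lin_ext (*) ?p" by (rule k.linear_lin_ext)
    interpret b: Vector_Spaces.linear scale "(*)" \<beta> by (rule b)
    have y: "rhit \<gamma> x \<in> D" by (rule stable(1)[OF g x])
    have "lin_ext (*) ?p u = (\<Sum>a\<in>A. \<beta> a * \<gamma> (lhit (\<alpha> a) x))"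
      unfolding u_def L.sum by (simp add: tens_def k.lin_ext_single)
    \<comment> \<open>Both sides of the dual pairing give the same number, so the coefficients of
      \<open>rhit \<gamma> x\<close> appear; as this vector lies in \<open>D\<close>, the basis
      expansion applies to it.\<close>
    also have "\<dots> = (\<Sum>a\<in>A. \<beta> (scale (\<alpha> a (rhit \<gamma> x)) a))"
      using \<alpha>(1) by (simp add: functional_lhit[OF g] functional_rhit b.scale mult.commute)
    also have "\<dots> = \<beta> (rhit \<gamma> x)"
      unfolding b.sum[symmetric] using \<alpha>(2) y A(3) by simp
    finally show "lin_ext (*) ?p (\<Delta> x) = lin_ext (*) ?p u"
      by (simp add: functional_rhit[OF b] pairing_def)
  qed
  ultimately show "\<exists>u. Poly_Mapping.keys u \<subseteq> D \<times> D \<and> tensor_eq scale (\<Delta> x) u" by blast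
qed

text \<open>A multiplicative matrix: \<Delta> acts on it as matrix multiplication, tested on
  products of functionals, and \<epsilon> sends it to the identity matrix.\<close>

definition comatrix :: "nat \<Rightarrow> (nat \<Rightarrow> nat \<Rightarrow> 'c) \<Rightarrow> bool" where
  "comatrix r \<Gamma> \<longleftrightarrow> (\<forall>i<r. \<forall>l<r.
    (\<forall>\<alpha> \<beta>. functional \<alpha> \<longrightarrow> functional \<beta> \<longrightarrow>
      pairing \<alpha> \<beta> (\<Gamma> i l) = (\<Sum>j<r. \<alpha> (\<Gamma> i j) * \<beta> (\<Gamma> j l))) \<and>
    \<epsilon> (\<Gamma> i l) = (if i = l then 1 else 0))"

text \<open>The matrix is that of the comultiplication on a basis of a left coideal containing \<open>F\<close>.\<close>

lemma comatrix_exists: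
  assumes F: "finite F"
  obtains r :: nat and \<Gamma> where "comatrix r \<Gamma>" "F \<subseteq> span {\<Gamma> i l | i l. i < r \<and> l < r}"
proof -
  obtain V where V: "fin_dim_subspace scale V" "F \<subseteq> V"
    "\<forall>\<alpha>. functional \<alpha> \<longrightarrow> (\<forall>x\<in>V. rhit \<alpha> x \<in> V \<and> lhit \<alpha> x \<in> V)"
    by (rule local_finiteness[OF F])
  obtain A where A: "finite A" "independent A" "span A = V" "card A = dim V" "A \<subseteq> V"
    using V(1) by (rule fin_dim_basis)
  obtain w where w: "\<forall>a. functional (w a)" "\<forall>x\<in>span A. (\<Sum>a\<in>A. scale (w a x) a) = x"
    "\<forall>a. \<forall>b\<in>A. w a b = (if a = b then 1 else 0)"
    by (rule dual_basis[OF A(1,2)])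
  define r where "r = card A"
  obtain v where "bij_betw v {0..<card A} A" using ex_bij_betw_nat_finite[OF A(1)] by blast
  then have v: "bij_betw v {..<r} A" by (simp add: r_def atLeast0LessThan)
  have vA: "v i \<in> A" if "i < r" for i using v that by (auto simp: bij_betw_def)
  have exp: "(\<Sum>j<r. scale (w (v j) x) (v j)) = x" if "x \<in> V" for x
    using w(2) A(3) that sum.reindex_bij_betw[OF v, of "\<lambda>a. scale (w a x) a"] by simp
  \<comment> \<open>These are the left tensor factors in the expansion of
    \<open>\<Delta> (v i)\<close> whose right factors are the basis vectors
    \<open>v l\<close>.\<close>
  define \<Gamma> where "\<Gamma> i l = rhit (w (v l)) (v i)" for i l
  have pair_v: "pairing \<alpha> \<beta> (v i) = (\<Sum>j<r. \<alpha> (\<Gamma> i j) * \<beta> (v j))"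
    if a: "functional \<alpha>" and b: "functional \<beta>" and i: "i < r" for \<alpha> \<beta> i
  proof -
    interpret b: Vector_Spaces.linear scale "(*)" \<beta> by (rule b)
    have "lhit \<alpha> (v i) \<in> V" using V(3) a vA[OF i] A(5) by blast
    from exp[OF this] have "\<beta> (lhit \<alpha> (v i)) = (\<Sum>j<r. w (v j) (lhit \<alpha> (v i)) * \<beta> (v j))"
      by (metis (no_types, lifting) b.scale b.sum sum.cong)
    then show ?thesis
      using w(1) by (simp add: functional_lhit b functional_rhit a \<Gamma>_def)
  qed
  have "pairing \<alpha> \<beta> (\<Gamma> i l) = (\<Sum>j<r. \<alpha> (\<Gamma> i j) * \<beta> (\<Gamma> j l))"
    if a: "functional \<alpha>" and b: "functional \<beta>" and i: "i < r" for \<alpha> \<beta> i l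
  proof -
    note wl = w(1)[rule_format, of "v l"]
    have "pairing \<alpha> \<beta> (\<Gamma> i l) = pairing \<alpha> (pairing \<beta> (w (v l))) (v i)"
      unfolding \<Gamma>_def functional_rhit[OF pairing_linear[OF a b]] by (rule pairing_assoc[OF a b wl])
    also have "\<dots> = (\<Sum>j<r. \<alpha> (\<Gamma> i j) * pairing \<beta> (w (v l)) (v j))"
      by (rule pair_v[OF a pairing_linear[OF b wl] i])
    also have "\<dots> = (\<Sum>j<r. \<alpha> (\<Gamma> i j) * \<beta> (\<Gamma> j l))"
      by (simp add: \<Gamma>_def functional_rhit[OF b])
    finally show ?thesis .
  qed
  moreover have "\<epsilon> (\<Gamma> i l) = (if i = l then 1 else 0)" if "i < r" "l < r" for i l
  proof -
    note wl = w(1)[rule_format, of "v l"]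
    have "\<epsilon> (\<Gamma> i l) = w (v l) (lhit \<epsilon> (v i))"
      by (simp add: \<Gamma>_def functional_rhit[OF counit_linear] functional_lhit[OF wl])
    also have "\<dots> = (if v l = v i then 1 else 0)" using w(3) vA[OF that(1)] by (simp add: lhit_counit)
    also have "v l = v i \<longleftrightarrow> i = l" using v that by (auto simp: bij_betw_def inj_on_def)
    finally show ?thesis .
  qed
  ultimately have "comatrix r \<Gamma>" unfolding comatrix_def by blast
  moreover have "F \<subseteq> span {\<Gamma> i l | i l. i < r \<and> l < r}"
  proof -
    have "v i \<in> span {\<Gamma> i l | i l. i < r \<and> l < r}" if i: "i < r" for i
    proof -
      \<comment> \<open>Applying the counit to the right tensor factor recovers the basis vectors
        from the matrix entries.\<close>
      have "v i = (\<Sum>j<r. scale (\<epsilon> (v j)) (\<Gamma> i j))"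
      proof (rule functional_separates)
        fix \<alpha> assume a: "functional \<alpha>"
        interpret a: Vector_Spaces.linear scale "(*)" \<alpha> by (rule a)
        have "\<alpha> (v i) = pairing \<alpha> \<epsilon> (v i)" by (simp add: functional_rhit[OF a, symmetric] rhit_counit)
        then show "\<alpha> (v i) = \<alpha> (\<Sum>j<r. scale (\<epsilon> (v j)) (\<Gamma> i j))"
          by (simp add: pair_v[OF a counit_linear i] a.sum a.scale mult.commute)
      qed
      also have "\<dots> \<in> span {\<Gamma> i l | i l. i < r \<and> l < r}"
        using i by (intro span_sum span_scale span_base) auto
      finally show ?thesis .
    qed
    then have "A \<subseteq> span {\<Gamma> i l | i l. i < r \<and> l < r}"
      using v by (auto simp: bij_betw_def)
    then have "span A \<subseteq> span {\<Gamma> i l | i l. i < r \<and> l < r}" by (intro span_minimal) simp_all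
    then show ?thesis using V(2) A(3) by simp
  qed
  ultimately show ?thesis using that by blast
qed

end

section \<open>Module coalgebras\<close>

context hopf_algebra
begin

text \<open>The antipode identity, evaluated on the matrix-product representative of
  \<open>\<Delta> (\<Gamma> i j)\<close>, says that applying \<open>S\<close> entrywise gives a left
  inverse of \<Gamma>.\<close>

lemma comatrix_antipode:
  assumes \<Gamma>: "comatrix r \<Gamma>" and ij: "i < r" "j < r"
  shows "(\<Sum>l<r. S (\<Gamma> i l) * \<Gamma> l j) = (if i = j then 1 else 0)"
proof -
  interpret S: Vector_Spaces.linear scale scale S by (rule antipode_linear)
  interpret F: vector_space "fscale :: 'k \<Rightarrow> ('h \<times> 'h \<Rightarrow>\<^sub>0 'k) \<Rightarrow> _" by (rule vector_space_fscale)
  have bil: "bilinear_map scale scale (\<lambda>x y. S x * y)"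
    unfolding bilinear_map_def
    by (intro conjI allI linearI vector_space_axioms)
      (simp_all add: S.add S.scale distrib_left distrib_right scale_mult_left scale_mult_right)
  define u :: "'h \<times> 'h \<Rightarrow>\<^sub>0 'k" where "u = (\<Sum>l<r. tens (\<Gamma> i l) (\<Gamma> l j))"
  have "tensor_eq scale (\<Delta> (\<Gamma> i j)) u"
  proof (rule tensor_eqI)
    fix \<alpha> \<beta> assume a: "functional \<alpha>" and b: "functional \<beta>"
    interpret L: Vector_Spaces.linear fscale "(*)" "lin_ext (*) (\<lambda>(x, y). \<alpha> x * \<beta> y)"
      by (rule vector_space.linear_lin_ext[OF vector_space_mult])
    have "lin_ext (*) (\<lambda>(x, y). \<alpha> x * \<beta> y) u = (\<Sum>l<r. \<alpha> (\<Gamma> i l) * \<beta> (\<Gamma> l j))"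
      unfolding u_def L.sum by (simp add: tens_def vector_space.lin_ext_single[OF vector_space_mult])
    moreover have "pairing \<alpha> \<beta> (\<Gamma> i j) = (\<Sum>l<r. \<alpha> (\<Gamma> i l) * \<beta> (\<Gamma> l j))"
      using \<Gamma> ij a b unfolding comatrix_def by blast
    ultimately show "lin_ext (*) (\<lambda>(x, y). \<alpha> x * \<beta> y) (\<Delta> (\<Gamma> i j)) = lin_ext (*) (\<lambda>(x, y). \<alpha> x * \<beta> y) u"
      by (simp add: pairing_def)
  qed
  from tensor_eq_lin_ext[OF this bil]
  have "scale (\<epsilon> (\<Gamma> i j)) 1 = lin_ext scale (\<lambda>(x, y). S x * y) u"
    by (simp add: antipode_left)
  also have "\<dots> = (\<Sum>l<r. S (\<Gamma> i l) * \<Gamma> l j)"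
  proof -
    interpret L: Vector_Spaces.linear fscale scale "lin_ext scale (\<lambda>(x, y). S x * y)"
      by (rule linear_lin_ext)
    show ?thesis unfolding u_def L.sum by (simp add: tens_def lin_ext_single)
  qed
  finally show ?thesis using \<Gamma> ij unfolding comatrix_def by auto
qed

lemma regular_module_coalgebra: "module_coalgebra scale \<Delta> \<epsilon> S scale \<Delta> \<epsilon> (*)"
proof (intro module_coalgebra.intro module_coalgebra_axioms.intro hopf_algebra_axioms coalgebra_axioms)
  show "Vector_Spaces.linear scale scale (\<lambda>h. h * m)" for m
    by (intro linearI vector_space_axioms) (simp_all add: distrib_right scale_mult_left)
  show "Vector_Spaces.linear scale scale ((*) h)" for h
    by (intro linearI vector_space_axioms) (simp_all add: distrib_left scale_mult_right)
  show "g * h * m = g * (h * m)" for g h m :: 'h by (rule mult.assoc)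
qed (simp_all add: comult_mult counit_mult)

end

lemma (in cocommutative_hopf_algebra) pairing_commute:
  assumes "functional \<alpha>" "functional \<beta>"
  shows "pairing \<alpha> \<beta> x = pairing \<beta> \<alpha> x"
proof -
  have lin: "Vector_Spaces.linear fscale (*) (lin_ext (*) (\<lambda>(y, z). \<beta> y * \<alpha> z))"
    by (rule vector_space.linear_lin_ext[OF vector_space_mult])
  have "lin_ext (*) (\<lambda>(y, z). \<beta> y * \<alpha> z) (case p of (y, z) \<Rightarrow> tens z y) = (case p of (y, z) \<Rightarrow> \<alpha> y * \<beta> z)" for p
    by (cases p) (simp add: tens_def vector_space.lin_ext_single[OF vector_space_mult] mult.commute)
  then have "lin_ext (*) (\<lambda>(y, z). \<beta> y * \<alpha> z) (lin_ext fscale (\<lambda>(y, z). tens z y) (\<Delta> x)) = pairing \<alpha> \<beta> x"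
    by (simp only: linear_lin_ext_comp[OF lin] pairing_def)
  then show ?thesis
    using tensor_eq_lin_ext[OF cocommutative bilinear_map_functionals[OF assms(2,1)], of x]
    by (simp add: pairing_def)
qed

context module_coalgebra
begin

text \<open>Interchanging the two Sweedler sums puts the one over \<open>h\<close> innermost, where
  the comultiplication rule of a comatrix can be inserted.\<close>

lemma pairing_act:
  assumes a: "functional \<alpha>" and b: "functional \<beta>"
  shows "pairing \<alpha> \<beta> (act h m) =
    lin_ext (*) (\<lambda>(m1, m2). H.pairing (\<lambda>h. \<alpha> (act h m1)) (\<lambda>h. \<beta> (act h m2)) h) (\<Delta>M m)"
proof -
  define q where "q = (\<lambda>(m1, m2). \<alpha> m1 * \<beta> m2)"
  define Q where "Q = (\<lambda>(h1, h2) (m1, m2). \<alpha> (act h1 m1) * \<beta> (act h2 m2))"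
  have lin: "Vector_Spaces.linear fscale (*) (lin_ext (*) q)"
    by (rule vector_space.linear_lin_ext[OF vector_space_mult])
  have single: "lin_ext (*) q (tens x y) = \<alpha> x * \<beta> y" for x y
    by (simp add: tens_def vector_space.lin_ext_single[OF vector_space_mult] q_def)
  have inner: "lin_ext (*) q (case mm of (m1, m2) \<Rightarrow> tens (act h1 m1) (act h2 m2)) = Q (h1, h2) mm" for h1 h2 mm
    by (cases mm) (simp add: single Q_def)
  have outer: "lin_ext (*) q (case hh of (h1, h2) \<Rightarrow>
      lin_ext fscale (\<lambda>(m1, m2). tens (act h1 m1) (act h2 m2)) (\<Delta>M m)) = lin_ext (*) (Q hh) (\<Delta>M m)" for hh
    by (cases hh) (simp only: prod.case linear_lin_ext_comp[OF lin] inner)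
  have "pairing \<alpha> \<beta> (act h m) = lin_ext (*) q (tensor_act act (\<Delta>H h) (\<Delta>M m))"
    unfolding pairing_def q_def by (rule tensor_eq_lin_ext[OF comult_act bilinear_map_functionals[OF a b]])
  also have "\<dots> = lin_ext (*) (\<lambda>hh. lin_ext (*) (Q hh) (\<Delta>M m)) (\<Delta>H h)"
    by (simp only: tensor_act_def linear_lin_ext_comp[OF lin] outer)
  also have "\<dots> = lin_ext (*) (\<lambda>mm. lin_ext (*) (\<lambda>hh. Q hh mm) (\<Delta>H h)) (\<Delta>M m)"
    by (rule vector_space.lin_ext_swap[OF vector_space_mult])
  also have "(\<lambda>mm. lin_ext (*) (\<lambda>hh. Q hh mm) (\<Delta>H h)) =
      (\<lambda>(m1, m2). H.pairing (\<lambda>h. \<alpha> (act h m1)) (\<lambda>h. \<beta> (act h m2)) h)"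
    by (auto simp: fun_eq_iff H.pairing_def Q_def case_prod_unfold)
  finally show ?thesis .
qed

lemma functional_act_left: "functional \<alpha> \<Longrightarrow> H.functional (\<lambda>h. \<alpha> (act h m))"
  using Vector_Spaces.linear_compose[OF act_linear_left] by (simp add: comp_def)

lemma functional_act_right: "functional \<alpha> \<Longrightarrow> functional (\<lambda>m. \<alpha> (act h m))"
  using Vector_Spaces.linear_compose[OF act_linear_right] by (simp add: comp_def)

lemma pairing_comatrix:
  assumes a: "functional \<alpha>" and b: "functional \<beta>" and \<Gamma>: "H.comatrix r \<Gamma>" "i < r" "l < r"
  shows "pairing \<alpha> \<beta> (act (\<Gamma> i l) m) =
    (\<Sum>j<r. pairing (\<lambda>y. \<alpha> (act (\<Gamma> i j) y)) (\<lambda>y. \<beta> (act (\<Gamma> j l) y)) m)"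
proof -
  have "H.pairing (\<lambda>h. \<alpha> (act h m1)) (\<lambda>h. \<beta> (act h m2)) (\<Gamma> i l) =
      (\<Sum>j<r. \<alpha> (act (\<Gamma> i j) m1) * \<beta> (act (\<Gamma> j l) m2))" for m1 m2
    using \<Gamma> functional_act_left[OF a] functional_act_left[OF b] unfolding H.comatrix_def by blast
  then have "pairing \<alpha> \<beta> (act (\<Gamma> i l) m) =
      lin_ext (*) (\<lambda>(m1, m2). \<Sum>j<r. \<alpha> (act (\<Gamma> i j) m1) * \<beta> (act (\<Gamma> j l) m2)) (\<Delta>M m)"
    unfolding pairing_act[OF a b] by simp
  also have "\<dots> = lin_ext (*) (\<lambda>p. \<Sum>j<r. case p of (m1, m2) \<Rightarrow> \<alpha> (act (\<Gamma> i j) m1) * \<beta> (act (\<Gamma> j l) m2)) (\<Delta>M m)"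
    by (simp only: case_prod_unfold)
  also have "\<dots> = (\<Sum>j<r. pairing (\<lambda>y. \<alpha> (act (\<Gamma> i j) y)) (\<lambda>y. \<beta> (act (\<Gamma> j l) y)) m)"
    by (simp only: vector_space.lin_ext_sum_right[OF vector_space_mult] pairing_def)
  finally show ?thesis .
qed

end

section \<open>Module coalgebras over a cocommutative Hopf algebra\<close>

locale cocommutative_module_coalgebra =
  module_coalgebra scaleH \<Delta>H \<epsilon>H S scaleM \<Delta>M \<epsilon>M act +
  H: cocommutative_hopf_algebra scaleH \<Delta>H \<epsilon>H S
  for scaleH :: "'k::field \<Rightarrow> 'h::ring_1 \<Rightarrow> 'h"
    and \<Delta>H :: "'h \<Rightarrow> ('h \<times> 'h \<Rightarrow>\<^sub>0 'k)"
    and \<epsilon>H :: "'h \<Rightarrow> 'k"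
    and S :: "'h \<Rightarrow> 'h"
    and scaleM :: "'k \<Rightarrow> 'm::ab_group_add \<Rightarrow> 'm"
    and \<Delta>M :: "'m \<Rightarrow> ('m \<times> 'm \<Rightarrow>\<^sub>0 'k)"
    and \<epsilon>M :: "'m \<Rightarrow> 'k"
    and act :: "'h \<Rightarrow> 'm \<Rightarrow> 'm"
begin

text \<open>Commuting the two functionals on H before expanding exchanges the matrix factors. This
  is where cocommutativity enters.\<close>

lemma pairing_comatrix_opp:
  assumes a: "functional \<alpha>" and b: "functional \<beta>" and \<Gamma>: "H.comatrix r \<Gamma>" "i < r" "l < r"
  shows "pairing \<alpha> \<beta> (act (\<Gamma> i l) m) =
    (\<Sum>j<r. pairing (\<lambda>y. \<alpha> (act (\<Gamma> j l) y)) (\<lambda>y. \<beta> (act (\<Gamma> i j) y)) m)"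
proof -
  have "H.pairing (\<lambda>h. \<alpha> (act h m1)) (\<lambda>h. \<beta> (act h m2)) (\<Gamma> i l) =
      (\<Sum>j<r. \<alpha> (act (\<Gamma> j l) m1) * \<beta> (act (\<Gamma> i j) m2))" for m1 m2
  proof -
    have "H.pairing (\<lambda>h. \<beta> (act h m2)) (\<lambda>h. \<alpha> (act h m1)) (\<Gamma> i l) =
        (\<Sum>j<r. \<beta> (act (\<Gamma> i j) m2) * \<alpha> (act (\<Gamma> j l) m1))"
      using \<Gamma> functional_act_left[OF a] functional_act_left[OF b] unfolding H.comatrix_def by blast
    then show ?thesis
      by (simp add: H.pairing_commute[OF functional_act_left[OF a] functional_act_left[OF b]] mult.commute)
  qed
  then have "pairing \<alpha> \<beta> (act (\<Gamma> i l) m) =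
      lin_ext (*) (\<lambda>(m1, m2). \<Sum>j<r. \<alpha> (act (\<Gamma> j l) m1) * \<beta> (act (\<Gamma> i j) m2)) (\<Delta>M m)"
    unfolding pairing_act[OF a b] by simp
  also have "\<dots> = lin_ext (*) (\<lambda>p. \<Sum>j<r. case p of (m1, m2) \<Rightarrow> \<alpha> (act (\<Gamma> j l) m1) * \<beta> (act (\<Gamma> i j) m2)) (\<Delta>M m)"
    by (simp only: case_prod_unfold)
  also have "\<dots> = (\<Sum>j<r. pairing (\<lambda>y. \<alpha> (act (\<Gamma> j l) y)) (\<lambda>y. \<beta> (act (\<Gamma> i j) y)) m)"
    by (simp only: vector_space.lin_ext_sum_right[OF vector_space_mult] pairing_def)
  finally show ?thesis .
qed

text \<open>The boolean index combines the two actions into the family \<open>T\<close> required by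
  \<open>equivariant_pair\<close>.\<close>

definition hit :: "bool \<Rightarrow> ('m \<Rightarrow> 'k) \<Rightarrow> 'm \<Rightarrow> 'm" where
  "hit t = (if t then rhit else lhit)"

lemma functional_hit:
  assumes "functional \<alpha>"
  shows "\<alpha> (hit t \<beta> x) = (if t then pairing \<alpha> \<beta> x else pairing \<beta> \<alpha> x)"
  by (simp add: hit_def functional_rhit[OF assms] functional_lhit[OF assms])

text \<open>For \<open>rhit\<close> the first form is the direct expansion and the second the
  opposite one; for \<open>lhit\<close> the roles are reversed.\<close>

lemma hit_comatrix:
  assumes b: "functional \<beta>" and \<Gamma>: "H.comatrix r \<Gamma>" "i < r" "l < r"
  shows "hit t \<beta> (act (\<Gamma> i l) m) = (\<Sum>j<r. act (\<Gamma> i j) (hit t (\<lambda>y. \<beta> (act (\<Gamma> j l) y)) m))"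
    and "hit t \<beta> (act (\<Gamma> i l) m) = (\<Sum>j<r. act (\<Gamma> j l) (hit t (\<lambda>y. \<beta> (act (\<Gamma> i j) y)) m))"
proof -
  have sum: "\<alpha> (\<Sum>j<r. act (f j) (hit t (g j) m)) =
      (\<Sum>j<r. if t then pairing (\<lambda>y. \<alpha> (act (f j) y)) (g j) m else pairing (g j) (\<lambda>y. \<alpha> (act (f j) y)) m)"
    if a: "functional \<alpha>" for \<alpha> f g
  proof -
    interpret a: Vector_Spaces.linear scaleM "(*)" \<alpha> by (rule a)
    show ?thesis
      using functional_hit[OF functional_act_right[OF a]] by (simp add: a.sum)
  qed
  show "hit t \<beta> (act (\<Gamma> i l) m) = (\<Sum>j<r. act (\<Gamma> i j) (hit t (\<lambda>y. \<beta> (act (\<Gamma> j l) y)) m))"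
  proof (rule functional_separates)
    fix \<alpha> assume a: "functional \<alpha>"
    show "\<alpha> (hit t \<beta> (act (\<Gamma> i l) m)) = \<alpha> (\<Sum>j<r. act (\<Gamma> i j) (hit t (\<lambda>y. \<beta> (act (\<Gamma> j l) y)) m))"
      unfolding sum[OF a] functional_hit[OF a]
      using pairing_comatrix[OF a b \<Gamma>] pairing_comatrix_opp[OF b a \<Gamma>] by simp
  qed
  show "hit t \<beta> (act (\<Gamma> i l) m) = (\<Sum>j<r. act (\<Gamma> j l) (hit t (\<lambda>y. \<beta> (act (\<Gamma> i j) y)) m))"
  proof (rule functional_separates)
    fix \<alpha> assume a: "functional \<alpha>"
    show "\<alpha> (hit t \<beta> (act (\<Gamma> i l) m)) = \<alpha> (\<Sum>j<r. act (\<Gamma> j l) (hit t (\<lambda>y. \<beta> (act (\<Gamma> i j) y)) m))"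
      unfolding sum[OF a] functional_hit[OF a]
      using pairing_comatrix_opp[OF a b \<Gamma>] pairing_comatrix[OF b a \<Gamma>] by simp
  qed
qed

lemma hit_linear: "functional \<alpha> \<Longrightarrow> Vector_Spaces.linear scaleM scaleM (hit t \<alpha>)"
  by (simp add: hit_def rhit_linear lhit_linear)

lemma hit_sum: "hit t (\<lambda>y. \<Sum>i\<in>I. \<beta> i y) x = (\<Sum>i\<in>I. hit t (\<beta> i) x)"
  by (simp add: hit_def rhit_sum lhit_sum)

lemma product_fin_dim:
  assumes F: "fin_dim_subspace scaleH F" and E: "fin_dim_subspace scaleM E"
  shows "fin_dim_subspace scaleM (subspace_product scaleM act F E)"
proof -
  obtain A B where A: "finite A" "F = H.span A" and B: "finite B" "E = span B"
    using F E unfolding fin_dim_subspace_def by blast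
  define C where "C = (\<Union>a\<in>A. act a ` B)"
  have "act f e \<in> span C" if "f \<in> F" "e \<in> E" for f e
  proof -
    have "act a e \<in> span C" if a: "a \<in> A" for a
    proof (rule linear_image_span[OF act_linear_right])
      show "e \<in> span B" using \<open>e \<in> E\<close> B by simp
      show "act a b \<in> span C" if "b \<in> B" for b
        using a that by (intro span_base) (auto simp: C_def)
    qed
    moreover interpret l: Vector_Spaces.linear scaleH scaleM "\<lambda>h. act h e" by (rule act_linear_left)
    have "H.span A \<subseteq> {h. act h e \<in> span C}" if "A \<subseteq> {h. act h e \<in> span C}"
      using that l.subspace_linear_preimage[OF subspace_span] by (rule H.span_minimal)
    ultimately show ?thesis using \<open>f \<in> F\<close> A(2) by blast
  qed
  then have "subspace_product scaleM act F E \<subseteq> span C"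
    unfolding subspace_product_def by (intro span_minimal) auto
  moreover have "finite C" using A B by (simp add: C_def)
  ultimately show ?thesis
    by (intro fin_dim_subspaceI[of _ C]) (simp_all add: subspace_product_def)
qed

lemma subspace_sum_subset:
  assumes "subspace P" "U \<subseteq> P" "V \<subseteq> P"
  shows "subspace_sum U V \<subseteq> P"
  using assms unfolding subspace_sum_def by (auto intro: subspace_add)

lemma amenable_if_hopf_amenable:
  assumes H: "amenable_hopf_algebra scaleH \<Delta>H" and nonzero: "(UNIV :: 'm set) \<noteq> {0}"
  shows "amenable_module_coalgebra scaleH scaleM \<Delta>M act"
  unfolding amenable_module_coalgebra_def
proof (intro allI impI)
  fix F :: "'h set" and e :: real
  assume "fin_dim_subspace scaleH F \<and> e > 0"
  then obtain B0 where B0: "finite B0" "F = H.span B0" and e: "e > 0"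
    unfolding fin_dim_subspace_def by blast
  interpret reg: cocommutative_module_coalgebra scaleH \<Delta>H \<epsilon>H S scaleH \<Delta>H \<epsilon>H "(*)"
    by (intro cocommutative_module_coalgebra.intro H.regular_module_coalgebra H.cocommutative_hopf_algebra_axioms)
  interpret eM: Vector_Spaces.linear scaleM "(*)" \<epsilon>M by (rule counit_linear)
  \<comment> \<open>\<epsilon> cannot vanish on a nonzero coalgebra, since it recovers every vector
    by the counit law; rescaling gives the base point \<open>c\<close> of the orbit map from H to
    M.\<close>
  obtain c where c: "\<epsilon>M c = 1"
  proof -
    obtain m :: 'm where "m \<noteq> 0" using nonzero by auto
    have "\<exists>x. \<epsilon>M x \<noteq> 0"
    proof (rule ccontr)
      assume "\<not> ?thesis"
      then have "lhit \<epsilon>M m = 0" by (simp add: lhit_def lin_ext_def case_prod_unfold)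
      then show False using \<open>m \<noteq> 0\<close> by (simp add: lhit_counit)
    qed
    then obtain x where "\<epsilon>M x \<noteq> 0" ..
    then have "\<epsilon>M (scaleM (inverse (\<epsilon>M x)) x) = 1" by (simp add: eM.scale)
    then show ?thesis using that by blast
  qed
  \<comment> \<open>Including 1 among the elements spanned by the matrix entries will yield the
    inclusion of \<open>D\<close> in \<open>P\<close>.\<close>
  obtain r \<Gamma> where \<Gamma>: "H.comatrix r \<Gamma>" "insert 1 B0 \<subseteq> H.span {\<Gamma> i l | i l. i < r \<and> l < r}"
    using B0(1) by (elim H.comatrix_exists[OF finite.insertI])
  define R where "R \<alpha> h = H.rhit (\<lambda>y. \<alpha> (act y c)) h" for \<alpha> :: "'m \<Rightarrow> 'k" and h
  interpret eq: equivariant_matrix scaleM scaleH hit R r "\<lambda>i l. act (\<Gamma> i l)" "\<lambda>i l. act (S (\<Gamma> i l))"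
    "\<lambda>i l. (*) (\<Gamma> i l)" "\<lambda>i l. (*) (S (\<Gamma> i l))"
  proof (intro equivariant_matrix.intro equivariant_pair.intro equivariant_pair_axioms.intro
      equivariant_matrix_axioms.intro vector_space_axioms H.vector_space_axioms)
    fix \<alpha> \<beta> :: "'m \<Rightarrow> 'k" and \<delta> :: "nat \<Rightarrow> 'm \<Rightarrow> 'k" and I :: "nat set" and t x h
    show "functional \<alpha> \<Longrightarrow> Vector_Spaces.linear scaleM scaleM (hit t \<alpha>)" by (rule hit_linear)
    show "functional \<alpha> \<Longrightarrow> Vector_Spaces.linear scaleH scaleH (R \<alpha>)"
      unfolding R_def by (intro H.rhit_linear functional_act_left)
    show "hit t (\<lambda>y. \<Sum>i\<in>I. \<delta> i y) x = (\<Sum>i\<in>I. hit t (\<delta> i) x)" by (rule hit_sum)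
    show "R (\<lambda>y. \<Sum>i\<in>I. \<delta> i y) h = (\<Sum>i\<in>I. R (\<delta> i) h)" unfolding R_def by (rule H.rhit_sum)
    fix i l j :: nat
    show "Vector_Spaces.linear scaleM scaleM (act (\<Gamma> i l))" "Vector_Spaces.linear scaleM scaleM (act (S (\<Gamma> i l)))"
      by (rule act_linear_right)+
    show "Vector_Spaces.linear scaleH scaleH ((*) (\<Gamma> i l))" "Vector_Spaces.linear scaleH scaleH ((*) (S (\<Gamma> i l)))"
      by (rule reg.act_linear_right)+
    show "(\<Sum>l<r. act (S (\<Gamma> i l)) (act (\<Gamma> l j) x)) = (if i = j then x else 0)" if "i < r" "j < r"
    proof -
      interpret l: Vector_Spaces.linear scaleH scaleM "\<lambda>h. act h x" by (rule act_linear_left)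
      have "(\<Sum>l<r. act (S (\<Gamma> i l)) (act (\<Gamma> l j) x)) = act (\<Sum>l<r. S (\<Gamma> i l) * \<Gamma> l j) x"
        by (simp add: l.sum act_mult)
      then show ?thesis by (simp add: H.comatrix_antipode[OF \<Gamma>(1) that] act_one)
    qed
    show "(\<Sum>l<r. S (\<Gamma> i l) * (\<Gamma> l j * h)) = (if i = j then h else 0)" if "i < r" "j < r"
    proof -
      have "(\<Sum>l<r. S (\<Gamma> i l) * (\<Gamma> l j * h)) = (\<Sum>l<r. S (\<Gamma> i l) * \<Gamma> l j) * h"
        by (simp add: sum_distrib_right mult.assoc)
      then show ?thesis by (simp add: H.comatrix_antipode[OF \<Gamma>(1) that])
    qed
    assume b: "functional \<beta>" and il: "i < r" "l < r"
    show "hit t \<beta> (act (\<Gamma> i l) x) = (\<Sum>j<r. act (\<Gamma> i j) (hit t (\<lambda>y. \<beta> (act (\<Gamma> j l) y)) x))"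
      "hit t \<beta> (act (\<Gamma> i l) x) = (\<Sum>j<r. act (\<Gamma> j l) (hit t (\<lambda>y. \<beta> (act (\<Gamma> i j) y)) x))"
      by (rule hit_comatrix[OF b \<Gamma>(1) il])+
    \<comment> \<open>\<open>R \<beta>\<close> is a right hit on H by the pullback of \<beta> along
      the orbit map, so the laws for the regular module coalgebra apply.\<close>
    show "R \<beta> (\<Gamma> i l * h) = (\<Sum>j<r. \<Gamma> i j * R (\<lambda>y. \<beta> (act (\<Gamma> j l) y)) h)"
      "R \<beta> (\<Gamma> i l * h) = (\<Sum>j<r. \<Gamma> j l * R (\<lambda>y. \<beta> (act (\<Gamma> i j) y)) h)"
      using reg.hit_comatrix[OF functional_act_left[OF b] \<Gamma>(1) il, of True c h]
      by (simp_all add: R_def reg.hit_def act_mult)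
  qed
  define F' where "F' = H.span {\<Gamma> i l | i l. i < r \<and> l < r}"
  have "{\<Gamma> i l | i l. i < r \<and> l < r} = (\<lambda>(i, l). \<Gamma> i l) ` ({..<r} \<times> {..<r})" by auto
  then have fF': "fin_dim_subspace scaleH F'"
    unfolding F'_def fin_dim_subspace_def by (metis finite_SigmaI finite_imageI finite_lessThan)
  have FF': "F \<subseteq> F'" and F'1: "1 \<in> F'"
    using \<Gamma>(2) unfolding F'_def B0(2) by (auto intro: H.span_minimal[THEN subsetD])
  \<comment> \<open>Amenability of H is applied to the larger space \<open>F'\<close> of matrix
    entries, so that every entry of \<Gamma> maps \<open>E\<close> into \<open>E'\<close>.\<close>
  obtain E where E: "fin_dim_subspace scaleH E"
    "real (quotient_dim scaleH (subspace_sum E (subspace_product scaleH (*) F' E)) E) < e * real (H.dim E)"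
    using H fF' e unfolding amenable_hopf_algebra_def amenable_module_coalgebra_def by blast
  define E' where "E' = subspace_sum E (subspace_product scaleH (*) F' E)"
  have fP: "fin_dim_subspace scaleH (subspace_product scaleH (*) F' E)"
    by (rule reg.product_fin_dim[OF fF' E(1)])
  have fE': "fin_dim_subspace scaleH E'" unfolding E'_def by (rule H.fin_dim_sum[OF E(1) fP])
  have EE': "E \<subseteq> E'"
    using H.subspace_0[OF H.fin_dim_subspace_imp_subspace[OF fP]] unfolding E'_def subspace_sum_def by force
  have KE: "\<Gamma> i l * h \<in> E'" if "i < r" "l < r" "h \<in> E" for i l h
  proof -
    have "\<Gamma> i l \<in> F'" unfolding F'_def by (rule H.span_base) (use that in blast)
    then have "\<Gamma> i l * h \<in> subspace_product scaleH (*) F' E"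
      unfolding subspace_product_def by (intro H.span_base) (use that in blast)
    moreover have "0 \<in> E" by (rule H.subspace_0[OF H.fin_dim_subspace_imp_subspace[OF E(1)]])
    ultimately show ?thesis unfolding E'_def subspace_sum_def by force
  qed
  have "quotient_dim scaleH E' E + H.dim E = H.dim E'"
    by (rule H.quotient_dim_eq[OF fE' H.fin_dim_subspace_imp_subspace[OF E(1)] EE'])
  then have less: "real (H.dim E') < (1 + e) * real (H.dim E)"
    using E(2) unfolding E'_def[symmetric] by (simp add: algebra_simps flip: of_nat_add)
  \<comment> \<open>Normalization of \<open>c\<close> makes \<open>R \<epsilon>M\<close> the
    identity, so an element without coefficients is zero.\<close>
  have nondeg: "eq.coefficients_in {0} = {0}"
  proof
    show "eq.coefficients_in {0} \<subseteq> {0}"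
    proof
      fix h assume "h \<in> eq.coefficients_in {0}"
      then have "R \<epsilon>M h = 0" using counit_linear unfolding eq.coefficients_in_def by auto
      moreover have "R \<epsilon>M h = h" unfolding R_def by (simp add: counit_act c H.rhit_counit)
      ultimately show "h \<in> {0}" by simp
    qed
    show "{0} \<subseteq> eq.coefficients_in {0}"
      using H.subspace_0[OF eq.coefficients_in_subspace] by simp
  qed
  obtain B where B: "finite B" "E = H.span B" using E(1) unfolding fin_dim_subspace_def by blast
  \<comment> \<open>\<open>X\<close> contains the right tensor factors of a spanning set of
    \<open>E\<close>, moved to M by the orbit map. Its stable hull \<open>D0\<close> therefore
    captures all coefficients of \<open>E\<close>.\<close>
  define X where "X = (\<Union>b\<in>B. (\<lambda>(y, z). act z c) ` Poly_Mapping.keys (\<Delta>H b))"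
  have "finite X" using B(1) by (simp add: X_def)
  then obtain D0 where D0: "fin_dim_subspace scaleM D0" "X \<subseteq> D0"
    "\<forall>\<alpha>. functional \<alpha> \<longrightarrow> (\<forall>x\<in>D0. rhit \<alpha> x \<in> D0 \<and> lhit \<alpha> x \<in> D0)"
    by (rule local_finiteness)
  have stable_iff: "eq.stable D \<longleftrightarrow> subspace D \<and> (\<forall>\<alpha>. functional \<alpha> \<longrightarrow> (\<forall>x\<in>D. rhit \<alpha> x \<in> D \<and> lhit \<alpha> x \<in> D))" for D
    unfolding eq.stable_def hit_def by (auto split: if_splits)
  have sD0: "eq.stable D0" using D0 fin_dim_subspace_imp_subspace unfolding stable_iff by blast
  have "B \<subseteq> eq.coefficients_in D0"
  proof
    fix b assume b: "b \<in> B"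
    have "R \<alpha> b = 0" if "\<forall>x\<in>D0. \<alpha> x = 0" for \<alpha>
    proof -
      have "\<alpha> (act z c) = 0" if "(y, z) \<in> Poly_Mapping.keys (\<Delta>H b)" for y z
      proof -
        have "act z c \<in> X" unfolding X_def using that b by force
        then show ?thesis using D0(2) \<open>\<forall>x\<in>D0. \<alpha> x = 0\<close> by blast
      qed
      then show ?thesis unfolding R_def H.rhit_def lin_ext_def by (intro sum.neutral) auto
    qed
    then show "b \<in> eq.coefficients_in D0" unfolding eq.coefficients_in_def by blast
  qed
  then have ED0: "E \<subseteq> eq.coefficients_in D0"
    unfolding B(2) by (rule H.span_minimal[OF _ eq.coefficients_in_subspace])
  obtain n t D P where DP: "eq.maximizer n t E D" "eq.largest_maximizer n t E' P"
    "real (dim P) < (1 + e) * real (dim D)"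
    by (rule eq.folner_level[OF E(1) fE' nondeg sD0 D0(1) ED0 e less])
  have D: "eq.stable D" "fin_dim_subspace scaleM D" using DP(1) unfolding eq.maximizer_def by auto
  have P: "eq.stable P" "fin_dim_subspace scaleM P"
    using DP(2) unfolding eq.largest_maximizer_def eq.maximizer_def by auto
  have sD: "subspace D" and sP: "subspace P" using D P fin_dim_subspace_imp_subspace by auto
  have F'DP: "act f x \<in> P" if "f \<in> F'" "x \<in> D" for f x
  proof -
    interpret l: Vector_Spaces.linear scaleH scaleM "\<lambda>h. act h x" by (rule act_linear_left)
    have "{\<Gamma> i l | i l. i < r \<and> l < r} \<subseteq> {h. act h x \<in> P}"
      using eq.matrix_maps_maximizer[OF E(1) fE' KE DP(1,2)] that(2) by auto
    then have "F' \<subseteq> {h. act h x \<in> P}"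
      unfolding F'_def using l.subspace_linear_preimage[OF sP] by (rule H.span_minimal)
    then show ?thesis using that(1) by blast
  qed
  have DsubP: "D \<subseteq> P" using F'DP[OF F'1] by (auto simp: act_one)
  have prodP: "subspace_product scaleM act F D \<subseteq> P"
    unfolding subspace_product_def using F'DP FF' by (intro span_minimal sP) auto
  define Q where "Q = subspace_sum D (subspace_product scaleM act F D)"
  have QP: "Q \<subseteq> P" unfolding Q_def by (rule subspace_sum_subset[OF sP DsubP prodP])
  have fQ: "fin_dim_subspace scaleM Q"
    unfolding Q_def using B0 by (intro fin_dim_sum D(2) product_fin_dim) (auto simp: fin_dim_subspace_def)
  have DQ: "D \<subseteq> Q"
    using span_zero unfolding Q_def subspace_sum_def subspace_product_def by force
  \<comment> \<open>Since \<open>Q\<close> lies in \<open>P\<close>, the growth of \<open>D\<close>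
    under \<open>F\<close> is at most dim \<open>P\<close> - dim \<open>D\<close>, which is less
    than \<open>e\<close> times dim \<open>D\<close>.\<close>
  have "quotient_dim scaleM Q D + dim D = dim Q" by (rule quotient_dim_eq[OF fQ sD DQ])
  moreover have "dim Q \<le> dim P"
    by (rule fin_dim_mono[OF P(2) fin_dim_subspace_imp_subspace[OF fQ] QP])
  ultimately have "real (quotient_dim scaleM Q D) + real (dim D) \<le> real (dim P)"
    by (simp flip: of_nat_add)
  then have "real (quotient_dim scaleM Q D) < e * real (dim D)"
    using DP(3) by (simp add: algebra_simps)
  moreover have "subcoalgebra scaleM \<Delta>M D"
    using D(1) unfolding stable_iff by (intro subcoalgebraI D(2)) blast+
  ultimately show "\<exists>E. fin_dim_subspace scaleM E \<and> subcoalgebra scaleM \<Delta>M E \<and>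
      real (quotient_dim scaleM (subspace_sum E (subspace_product scaleM act F E)) E) < e * real (dim E)"
    using D(2) unfolding Q_def by blast
qed

end

text \<open>A carrier is a type, and a formula cannot quantify over all types. The equivalence is
  therefore stated for module coalgebras carried by the type of H, which include the regular one
  used for the converse, and the forward implication again for an arbitrary carrier type.\<close>

theorem corollary3:
  fixes scaleH :: "'k::field \<Rightarrow> 'h::ring_1 \<Rightarrow> 'h"
    and \<Delta>H :: "'h \<Rightarrow> ('h \<times> 'h \<Rightarrow>\<^sub>0 'k)"
    and \<epsilon>H :: "'h \<Rightarrow> 'k"
    and S :: "'h \<Rightarrow> 'h"
  assumes "cocommutative_hopf_algebra scaleH \<Delta>H \<epsilon>H S"
  shows "(amenable_hopf_algebra scaleH \<Delta>H \<longleftrightarrow>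
      (\<forall>(scaleM :: 'k \<Rightarrow> 'h \<Rightarrow> 'h) \<Delta>M \<epsilon>M act.
         module_coalgebra scaleH \<Delta>H \<epsilon>H S scaleM \<Delta>M \<epsilon>M act \<and> (UNIV :: 'h set) \<noteq> {0} \<longrightarrow>
         amenable_module_coalgebra scaleH scaleM \<Delta>M act)) \<and>
    (amenable_hopf_algebra scaleH \<Delta>H \<longrightarrow>
      (\<forall>(scaleM :: 'k \<Rightarrow> 'm::ab_group_add \<Rightarrow> 'm) \<Delta>M \<epsilon>M act.
         module_coalgebra scaleH \<Delta>H \<epsilon>H S scaleM \<Delta>M \<epsilon>M act \<and> (UNIV :: 'm set) \<noteq> {0} \<longrightarrow>
         amenable_module_coalgebra scaleH scaleM \<Delta>M act))"
proof -
  interpret H: cocommutative_hopf_algebra scaleH \<Delta>H \<epsilon>H S by fact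
  have h: "\<forall>(scaleM :: 'k \<Rightarrow> 'h \<Rightarrow> 'h) \<Delta>M \<epsilon>M act.
      module_coalgebra scaleH \<Delta>H \<epsilon>H S scaleM \<Delta>M \<epsilon>M act \<and> (UNIV :: 'h set) \<noteq> {0} \<longrightarrow>
      amenable_module_coalgebra scaleH scaleM \<Delta>M act" if "amenable_hopf_algebra scaleH \<Delta>H"
    using cocommutative_module_coalgebra.amenable_if_hopf_amenable[OF
        cocommutative_module_coalgebra.intro[OF _ assms] that] by blast
  have m: "\<forall>(scaleM :: 'k \<Rightarrow> 'm \<Rightarrow> 'm) \<Delta>M \<epsilon>M act.
      module_coalgebra scaleH \<Delta>H \<epsilon>H S scaleM \<Delta>M \<epsilon>M act \<and> (UNIV :: 'm set) \<noteq> {0} \<longrightarrow>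
      amenable_module_coalgebra scaleH scaleM \<Delta>M act" if "amenable_hopf_algebra scaleH \<Delta>H"
    using cocommutative_module_coalgebra.amenable_if_hopf_amenable[OF
        cocommutative_module_coalgebra.intro[OF _ assms] that] by blast
  have "(UNIV :: 'h set) \<noteq> {0}" by (metis UNIV_I singletonD zero_neq_one)
  then have "amenable_hopf_algebra scaleH \<Delta>H"
    if "\<forall>(scaleM :: 'k \<Rightarrow> 'h \<Rightarrow> 'h) \<Delta>M \<epsilon>M act.
      module_coalgebra scaleH \<Delta>H \<epsilon>H S scaleM \<Delta>M \<epsilon>M act \<and> (UNIV :: 'h set) \<noteq> {0} \<longrightarrow>
      amenable_module_coalgebra scaleH scaleM \<Delta>M act"
    using that H.regular_module_coalgebra unfolding amenable_hopf_algebra_def by blast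
  then show ?thesis using h m by blast
qed

end
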